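(* Let $\Omega$ be a smooth bounded domain in $\mathbb{R}^N$, $N\ge 2$, and let $f$ be one of the nonlinearities $f(u)=e^u$, $f(u)=(1+u)^p$ or $f(u)=\frac{1}{(1-u)^p}$, where $p>1$. Let $0<\lambda<\lambda^*$ and let $u_\lambda$ denote the minimal solution of $(N)_\lambda$: $\Delta^2 u=\lambda f(u)$ in $\Omega$, $u=\Delta u=0$ on $\partial\Omega$. Then \[ \sqrt{\lambda}\int_\Omega \sqrt{f'(u_\lambda)}\,\phi^2\,dx \le \int_\Omega |\nabla\phi|^2\,dx \qquad\text{for all }\phi\in H_0^1(\Omega). \]
   Context: For $\lambda\ge 0$, $(N)_\lambda$ denotes the fourth order Navier problem \[ \Delta^2 u=\lambda f(u)\ \text{ in }\Omega,\qquad u=\Delta u=0\ \text{ on }\partial\Omega. \] Smooth solutions take values in the domain of $f$ (so $u<1$ on $\overline\Omega$ when $f(u)=(1-u)^{-p}$). A smooth solution $u$ of $(N)_\lambda$ is called minimal if $u\le v$ a.e. in $\Omega$ for any solution $v$ of $(N)_\lambda$. The extremal parameter is $\lambda^*:=\sup\{\lambda>0:\ \text{there exists a smooth solution of }(N)_\lambda\}$. It is known that $0<\lambda^*<\infty$, that for each $0<\lambda<\lambda^*$ there exists a smooth minimal solution $u_\lambda$ of $(N)_\lambda$, and that for each $x\in\Omega$ the map $\lambda\mapsto u_\lambda(x)$ is strictly increasing on $(0,\lambda^* )$. *)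

theory Defs
  imports "HOL-Analysis.Analysis"
begin

text \<open>Only used for open \<open>S\<close>; all directional derivatives up to order \<open>k\<close> are required.\<close>

primrec Ck_on :: "nat \<Rightarrow> 'a::real_normed_vector set \<Rightarrow> ('a \<Rightarrow> real) \<Rightarrow> bool" where
  "Ck_on 0 S g \<longleftrightarrow> continuous_on S g"
| "Ck_on (Suc k) S g \<longleftrightarrow>
     (\<forall>x\<in>S. g differentiable (at x)) \<and>
     (\<forall>v. Ck_on k S (\<lambda>x. frechet_derivative g (at x) v))"

definition smooth_on :: "'a::real_normed_vector set \<Rightarrow> ('a \<Rightarrow> real) \<Rightarrow> bool" where
  "smooth_on S g \<longleftrightarrow> (\<forall>k. Ck_on k S g)"

definition grad :: "('a::euclidean_space \<Rightarrow> real) \<Rightarrow> 'a \<Rightarrow> 'a" where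
  "grad g x = (\<Sum>i\<in>Basis. frechet_derivative g (at x) i *\<^sub>R i)"

definition laplacian :: "('a::euclidean_space \<Rightarrow> real) \<Rightarrow> 'a \<Rightarrow> real" where
  "laplacian g x = (\<Sum>i\<in>Basis. frechet_derivative (\<lambda>y. frechet_derivative g (at y) i) (at x) i)"

text \<open>The boundary is described by local defining functions \<open>\<rho>\<close>: near each boundary point,
  \<open>\<Omega>\<close> is the sublevel set of a smooth function with nonvanishing gradient. In particular the
  boundary is locally \<open>{\<rho> = 0}\<close> and \<open>\<Omega>\<close> lies locally on one side of it.\<close>

definition smooth_bounded_domain :: "'a::euclidean_space set \<Rightarrow> bool" where
  "smooth_bounded_domain \<Omega> \<longleftrightarrow>
     open \<Omega> \<and> connected \<Omega> \<and> \<Omega> \<noteq> {} \<and> bounded \<Omega> \<and>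
     (\<forall>x\<^sub>0\<in>frontier \<Omega>. \<exists>U \<rho>. open U \<and> x\<^sub>0 \<in> U \<and> smooth_on U \<rho> \<and>
        (\<forall>x\<in>U. grad \<rho> x \<noteq> 0) \<and> \<Omega> \<inter> U = {x\<in>U. \<rho> x < 0})"

text \<open>Smooth solutions of the Navier problem \<open>\<Delta>\<^sup>2 u = lam f(u)\<close> in \<open>\<Omega>\<close>, \<open>u = \<Delta> u = 0\<close> on the
  boundary, where \<open>D\<close> is the domain of the nonlinearity \<open>f\<close>. The function \<open>u\<close> is
  infinitely differentiable in \<open>\<Omega>\<close>, and \<open>u\<close> and \<open>\<Delta> u\<close> attain their boundary values continuously.
  The condition on \<open>\<Delta> u\<close> is a limit from within \<open>\<Omega>\<close>, since the values of \<open>u\<close> outside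
  \<open>closure \<Omega>\<close> are irrelevant.\<close>

definition navier_solution ::
  "'a::euclidean_space set \<Rightarrow> (real \<Rightarrow> real) \<Rightarrow> real set \<Rightarrow> real \<Rightarrow> ('a \<Rightarrow> real) \<Rightarrow> bool" where
  "navier_solution \<Omega> f D lam u \<longleftrightarrow>
     smooth_on \<Omega> u \<and> continuous_on (closure \<Omega>) u \<and>
     (\<forall>x\<in>closure \<Omega>. u x \<in> D) \<and>
     (\<forall>x\<in>\<Omega>. laplacian (laplacian u) x = lam * f (u x)) \<and>
     (\<forall>x\<in>frontier \<Omega>. u x = 0 \<and> (laplacian u \<longlongrightarrow> 0) (at x within \<Omega>))"

definition minimal_navier_solution ::
  "'a::euclidean_space set \<Rightarrow> (real \<Rightarrow> real) \<Rightarrow> real set \<Rightarrow> real \<Rightarrow> ('a \<Rightarrow> real) \<Rightarrow> bool" where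
  "minimal_navier_solution \<Omega> f D lam u \<longleftrightarrow>
     navier_solution \<Omega> f D lam u \<and>
     (\<forall>v. navier_solution \<Omega> f D lam v \<longrightarrow> (AE x in lebesgue_on \<Omega>. u x \<le> v x))"

text \<open>The supremum is taken in the extended reals, so that it is meaningful without
  first knowing that the set is nonempty and bounded.\<close>

definition extremal_parameter ::
  "'a::euclidean_space set \<Rightarrow> (real \<Rightarrow> real) \<Rightarrow> real set \<Rightarrow> ereal" where
  "extremal_parameter \<Omega> f D = Sup (ereal ` {lam. lam > 0 \<and> (\<exists>u. navier_solution \<Omega> f D lam u)})"

definition test_function :: "'a::euclidean_space set \<Rightarrow> ('a \<Rightarrow> real) \<Rightarrow> bool" where
  "test_function \<Omega> \<psi> \<longleftrightarrow>
     smooth_on UNIV \<psi> \<and> (\<exists>K. compact K \<and> K \<subseteq> \<Omega> \<and> (\<forall>x. x \<notin> K \<longrightarrow> \<psi> x = 0))"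

definition square_integrable :: "'a::euclidean_space set \<Rightarrow> ('a \<Rightarrow> 'b::euclidean_space) \<Rightarrow> bool" where
  "square_integrable \<Omega> g \<longleftrightarrow>
     g \<in> borel_measurable (lebesgue_on \<Omega>) \<and> integrable (lebesgue_on \<Omega>) (\<lambda>x. (norm (g x))\<^sup>2)"

text \<open>\<open>H1 \<Omega> \<phi> G\<close> says that \<open>\<phi>\<close> belongs to the Sobolev space \<open>H\<^sup>1(\<Omega>)\<close> and has weak gradient \<open>G\<close>
  (which is unique up to null sets). \<open>H1_0 \<Omega> \<phi> G\<close> says that moreover \<open>\<phi>\<close> lies in the closure of
  the test functions with respect to the \<open>H\<^sup>1\<close>-norm.\<close>

definition H1 :: "'a::euclidean_space set \<Rightarrow> ('a \<Rightarrow> real) \<Rightarrow> ('a \<Rightarrow> 'a) \<Rightarrow> bool" where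
  "H1 \<Omega> \<phi> G \<longleftrightarrow>
     square_integrable \<Omega> \<phi> \<and> square_integrable \<Omega> G \<and>
     (\<forall>\<psi>. test_function \<Omega> \<psi> \<longrightarrow> (\<forall>i\<in>Basis.
        (LINT x|lebesgue_on \<Omega>. \<phi> x * (grad \<psi> x \<bullet> i)) = - (LINT x|lebesgue_on \<Omega>. (G x \<bullet> i) * \<psi> x)))"

definition H1_0 :: "'a::euclidean_space set \<Rightarrow> ('a \<Rightarrow> real) \<Rightarrow> ('a \<Rightarrow> 'a) \<Rightarrow> bool" where
  "H1_0 \<Omega> \<phi> G \<longleftrightarrow>
     H1 \<Omega> \<phi> G \<and>
     (\<exists>\<psi>. (\<forall>n. test_function \<Omega> (\<psi> n)) \<and>
        (\<lambda>n::nat. (LINT x|lebesgue_on \<Omega>. (\<psi> n x - \<phi> x)\<^sup>2)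
              + (LINT x|lebesgue_on \<Omega>. (norm (grad (\<psi> n) x - G x))\<^sup>2)) \<longlonglongrightarrow> 0)"

end

theory Submission
  imports Defs
begin

text \<open>
  Let \<open>v\<close> be a solution for some parameter \<open>\<mu> > \<lambda>\<close>. The pair \<open>(v, - \<Delta>v)\<close> is a supersolution of the
  cooperative system \<open>- \<Delta>a = b\<close>, \<open>- \<Delta>b = \<lambda> f(a)\<close>, so sweeping \<open>(0, 0)\<close> upwards (Poisson problems on
  a countable family of balls, each ball used infinitely often) converges to a solution of \<open>(N)\<^sub>\<lambda>\<close>
  below \<open>v\<close>; its boundary values come from the squeeze \<open>0 \<le> a \<le> v\<close>, \<open>0 \<le> b \<le> - \<Delta>v\<close>, so that no
  barriers are needed. By minimality \<open>u \<le> a \<le> v\<close>. Then \<open>U = v - u\<close> and \<open>W = \<Delta>u - \<Delta>v\<close> are positive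
  with \<open>- \<Delta>U = W\<close> and, by convexity of \<open>f\<close>, \<open>- \<Delta>W \<ge> \<lambda> f'(u) U\<close>. Testing
  \<open>- \<Delta>U / U - \<Delta>W / W \<ge> W / U + \<lambda> f'(u) U / W \<ge> 2 \<surd>(\<lambda> f'(u))\<close> with \<open>\<psi>\<^sup>2\<close> gives the claim for test
  functions \<open>\<psi>\<close>, and density gives it on \<open>H\<^sup>1\<^sub>0\<close>.

  Everything about the Laplacian rests on the identity \<open>u = avg r u + pot r (- \<Delta>u)\<close>, where \<open>avg r\<close> and
  \<open>pot r\<close> are positive operators, supported in a ball of radius \<open>r\<close>, which gain one derivative.
\<close>

section \<open>Calculus of directional derivatives\<close>

text \<open>Minimality compares \<open>u\<close> only with solutions for the same parameter, so
  nothing orders \<open>u\<close> and \<open>v\<close> in advance; this is why a solution for lambda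
  is manufactured under \<open>v\<close>. Since mu > lambda and f > 0 along \<open>v\<close>, the
  supersolution inequality is strict, and the same strictness later makes the Laplacian of
  \<open>W\<close> negative everywhere. The difference v - u plays the part of the derivative of the
  solution branch in lambda, or of a positive eigenfunction of the linearized system. In the product
  of W / U and lambda f'(u) U / W the unknown ratio cancels, which explains the weight sqrt(lambda
  f'(u)); the factor 2 is matched by the two copies of |grad psi|^2 that the two quotients produce.

  Functions glued from Poisson solutions on balls are continuous but need not be twice
  differentiable across the spheres. Inequalities for - Laplacian are therefore stated as
  \<open>a x \<le> avg r a x + pot r b x\<close> for all small r. This form survives gluing, its
  equality case passes to bounded pointwise limits, and derivatives are recovered afterwards by
  bootstrapping.\<close>

abbreviation pd :: "'a::real_normed_vector \<Rightarrow> ('a \<Rightarrow> real) \<Rightarrow> 'a \<Rightarrow> real" where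
  "pd v g \<equiv> (\<lambda>x. frechet_derivative g (at x) v)"

lemma has_derivative_frechet:
  "g differentiable (at x) \<Longrightarrow> (g has_derivative (\<lambda>v. pd v g x)) (at x)"
  by (simp add: frechet_derivative_works)

lemma pd_eqI: "(g has_derivative g') (at x) \<Longrightarrow> pd v g x = g' v"
  using frechet_derivative_at by metis

lemma pd_cong:
  assumes "open S" "x \<in> S" "\<And>y. y \<in> S \<Longrightarrow> g y = h y"
  shows "g differentiable (at x) \<longleftrightarrow> h differentiable (at x)" "pd v g x = pd v h x"
proof -
  have "(g has_derivative D) (at x) \<longleftrightarrow> (h has_derivative D) (at x)" for D
    using assms has_derivative_transform_within_open[OF _ assms(1,2), of g D UNIV h]
      has_derivative_transform_within_open[OF _ assms(1,2), of h D UNIV g] by auto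
  then show "g differentiable (at x) \<longleftrightarrow> h differentiable (at x)" "pd v g x = pd v h x"
    by (auto simp: differentiable_def frechet_derivative_def)
qed

lemma Ck_on_cong:
  assumes "open S" "\<And>y. y \<in> S \<Longrightarrow> g y = h y"
  shows "Ck_on k S g \<longleftrightarrow> Ck_on k S h"
  using assms(2)
proof (induction k arbitrary: g h)
  case 0
  then show ?case by (simp cong: continuous_on_cong)
next
  case (Suc k)
  have "Ck_on k S (pd v g) \<longleftrightarrow> Ck_on k S (pd v h)" for v
    by (intro Suc.IH pd_cong(2)[OF assms(1)] Suc.prems)
  moreover have "g differentiable (at x) \<longleftrightarrow> h differentiable (at x)" if "x \<in> S" for x
    using that Suc.prems by (intro pd_cong(1)[OF assms(1)])
  ultimately show ?case by simp
qed

lemma Ck_on_subset: "Ck_on k S g \<Longrightarrow> T \<subseteq> S \<Longrightarrow> Ck_on k T g"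
  by (induction k arbitrary: g) (auto intro: continuous_on_subset)

lemma Ck_on_Suc_D: "Ck_on (Suc k) S g \<Longrightarrow> Ck_on k S g"
proof (induction k arbitrary: g)
  case 0
  then show ?case
    by (auto intro!: continuous_at_imp_continuous_on differentiable_imp_continuous_within)
next
  case (Suc k)
  then show ?case by (metis Ck_on.simps(2))
qed

lemma Ck_on_mono: "Ck_on k S g \<Longrightarrow> j \<le> k \<Longrightarrow> Ck_on j S g"
  by (induction k) (auto simp: le_Suc_eq dest: Ck_on_Suc_D simp del: Ck_on.simps)

lemma Ck_on_continuous_on: "Ck_on k S g \<Longrightarrow> continuous_on S g"
  using Ck_on_mono[of k S g 0] by simp

lemma Ck_on_differentiable: "Ck_on (Suc k) S g \<Longrightarrow> x \<in> S \<Longrightarrow> g differentiable (at x)"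
  by simp

lemma Ck_on_pd: "Ck_on (Suc k) S g \<Longrightarrow> Ck_on k S (pd v g)"
  by simp

text \<open>Allows different formulas on different neighbourhoods: a product with a cut-off is
  smooth where the other factor is, and vanishes identically elsewhere.\<close>

lemma Ck_on_local:
  assumes "\<And>x. x \<in> S \<Longrightarrow> \<exists>V. open V \<and> x \<in> V \<and> Ck_on k V g"
  shows "Ck_on k S g"
  using assms
proof (induction k arbitrary: g)
  case 0
  show ?case
    unfolding Ck_on.simps
  proof (rule continuous_at_imp_continuous_on, intro ballI)
    fix x assume "x \<in> S"
    then show "isCont g x"
      using 0 continuous_on_eq_continuous_at by fastforce
  qed
next
  case (Suc k)
  have "Ck_on k S (pd v g)" for v
    using Suc.prems by (intro Suc.IH) (metis Ck_on_pd)
  moreover have "g differentiable (at x)" if "x \<in> S" for x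
    using Suc.prems[OF that] by auto
  ultimately show ?case by simp
qed

lemma Ck_on_const: "Ck_on k S (\<lambda>x. c)"
proof (induction k arbitrary: c)
  case (Suc k)
  have "pd v (\<lambda>x. c) = (\<lambda>x. 0)" for v :: 'a by simp
  then show ?case using Suc[of 0] by simp
qed simp

lemma Ck_on_add:
  assumes "open S" "Ck_on k S g" "Ck_on k S h"
  shows "Ck_on k S (\<lambda>x. g x + h x)"
  using assms(2,3)
proof (induction k arbitrary: g h)
  case 0
  then show ?case by (simp add: continuous_on_add)
next
  case (Suc k)
  have d: "g differentiable (at x)" "h differentiable (at x)" if "x \<in> S" for x
    using Suc.prems that by auto
  have e: "pd v (\<lambda>x. g x + h x) x = pd v g x + pd v h x" if "x \<in> S" for x v
    using d[OF that] by (intro pd_eqI has_derivative_add has_derivative_frechet)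
  have "Ck_on k S (\<lambda>x. pd v g x + pd v h x)" for v
    by (intro Suc.IH Ck_on_pd Suc.prems)
  then have "Ck_on k S (pd v (\<lambda>x. g x + h x))" for v
    by (subst Ck_on_cong[OF assms(1) e])
  then show ?case using d by auto
qed

lemma Ck_on_mult:
  assumes "open S" "Ck_on k S g" "Ck_on k S h"
  shows "Ck_on k S (\<lambda>x. g x * h x)"
  using assms(2,3)
proof (induction k arbitrary: g h)
  case 0
  then show ?case by (simp add: continuous_on_mult)
next
  case (Suc k)
  have d: "g differentiable (at x)" "h differentiable (at x)" if "x \<in> S" for x
    using Suc.prems that by auto
  have e: "pd v (\<lambda>x. g x * h x) x = g x * pd v h x + pd v g x * h x" if "x \<in> S" for x v
    using d[OF that] by (intro pd_eqI has_derivative_mult has_derivative_frechet)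
  have "Ck_on k S (\<lambda>x. g x * pd v h x + pd v g x * h x)" for v
    by (intro Ck_on_add assms(1) Suc.IH Ck_on_Suc_D[OF Suc.prems(1)] Ck_on_Suc_D[OF Suc.prems(2)]
        Ck_on_pd[OF Suc.prems(1)] Ck_on_pd[OF Suc.prems(2)])
  then have "Ck_on k S (pd v (\<lambda>x. g x * h x))" for v
    by (subst Ck_on_cong[OF assms(1) e])
  then show ?case using d by auto
qed

lemma Ck_on_cmult: "open S \<Longrightarrow> Ck_on k S g \<Longrightarrow> Ck_on k S (\<lambda>x. c * g x)"
  by (intro Ck_on_mult Ck_on_const)

lemma Ck_on_minus: "open S \<Longrightarrow> Ck_on k S g \<Longrightarrow> Ck_on k S (\<lambda>x. - g x)"
  using Ck_on_cmult[of S k g "-1"] by simp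

lemma Ck_on_diff: "open S \<Longrightarrow> Ck_on k S g \<Longrightarrow> Ck_on k S h \<Longrightarrow> Ck_on k S (\<lambda>x. g x - h x)"
  using Ck_on_add[of S k g "\<lambda>x. - h x"] Ck_on_minus[of S k h] by simp

lemma Ck_on_sum:
  "open S \<Longrightarrow> (\<And>i. i \<in> I \<Longrightarrow> Ck_on k S (g i)) \<Longrightarrow> Ck_on k S (\<lambda>x. \<Sum>i\<in>I. g i x)"
  by (induction I rule: infinite_finite_induct) (auto intro: Ck_on_const Ck_on_add)

lemma Ck_on_bounded_linear:
  assumes "bounded_linear g" shows "Ck_on k S g"
proof (cases k)
  case 0
  then show ?thesis using assms by (simp add: linear_continuous_on)
next
  case (Suc j)
  have "pd v g = (\<lambda>x. g v)" for v
    using pd_eqI[OF bounded_linear_imp_has_derivative[OF assms]] by auto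
  then show ?thesis
    using Suc assms by (simp add: Ck_on_const bounded_linear_imp_differentiable)
qed

text \<open>The class \<open>H\<close> is meant to be closed under differentiation, so that the chain rule can be
  iterated.\<close>

lemma Ck_on_compose:
  fixes H :: "(real \<Rightarrow> real) set"
  assumes "open S" "Ck_on k S g" "h \<in> H" "\<And>x. x \<in> S \<Longrightarrow> g x \<in> J"
    and H: "\<And>h. h \<in> H \<Longrightarrow> \<exists>h'\<in>H. \<forall>t\<in>J. (h has_real_derivative h' t) (at t)"
  shows "Ck_on k S (\<lambda>x. h (g x))"
  using assms(2,3)
proof (induction k arbitrary: h)
  case 0
  obtain h' where h': "\<And>t. t \<in> J \<Longrightarrow> (h has_real_derivative h' t) (at t)"
    using H[OF 0(2)] by blast
  then have "continuous_on J h"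
    by (meson DERIV_continuous_on has_field_derivative_at_within)
  then show ?case
    using 0 assms(4) by (auto intro: continuous_on_compose2[where t=J])
next
  case (Suc k)
  obtain h' where "h' \<in> H" and h': "\<And>t. t \<in> J \<Longrightarrow> (h has_real_derivative h' t) (at t)"
    using H[OF Suc(3)] by blast
  have hd: "((\<lambda>x. h (g x)) has_derivative (\<lambda>v. h' (g x) * pd v g x)) (at x)" if "x \<in> S" for x
  proof -
    have "(g has_derivative (\<lambda>v. pd v g x)) (at x)"
      using Suc.prems that by (intro has_derivative_frechet) auto
    from has_derivative_compose[OF this, of h "(*) (h' (g x))"] show ?thesis
      using h'[OF assms(4)[OF that]] by (simp add: has_field_derivative_def)
  qed
  have "Ck_on k S (pd v (\<lambda>x. h (g x)))" for v
  proof -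
    have "Ck_on k S (\<lambda>x. h' (g x) * pd v g x)"
      by (rule Ck_on_mult[OF assms(1) Suc.IH[OF Ck_on_Suc_D[OF Suc.prems(1)] \<open>h' \<in> H\<close>]
            Ck_on_pd[OF Suc.prems(1)]])
    then show ?thesis
      by (subst Ck_on_cong[OF assms(1) pd_eqI[OF hd]])
  qed
  then show ?case using hd by (auto simp: differentiable_def)
qed

section \<open>Rules for directional derivatives and the Laplacian\<close>

lemma pd_add:
  "g differentiable (at x) \<Longrightarrow> h differentiable (at x) \<Longrightarrow>
    pd v (\<lambda>x. g x + h x) x = pd v g x + pd v h x"
  by (intro pd_eqI has_derivative_add has_derivative_frechet)

lemma pd_diff:
  "g differentiable (at x) \<Longrightarrow> h differentiable (at x) \<Longrightarrow>
    pd v (\<lambda>x. g x - h x) x = pd v g x - pd v h x"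
  by (intro pd_eqI has_derivative_diff has_derivative_frechet)

lemma pd_mult:
  "g differentiable (at x) \<Longrightarrow> h differentiable (at x) \<Longrightarrow>
    pd v (\<lambda>x. g x * h x) x = g x * pd v h x + pd v g x * h x"
  by (intro pd_eqI has_derivative_mult has_derivative_frechet)

lemma pd_cmult: "g differentiable (at x) \<Longrightarrow> pd v (\<lambda>x. c * g x) x = c * pd v g x"
  by (subst pd_mult) auto

lemma pd_as_sum:
  fixes g :: "'a::euclidean_space \<Rightarrow> real"
  assumes "g differentiable (at x)"
  shows "pd v g x = (\<Sum>i\<in>Basis. (v \<bullet> i) * pd i g x)"
proof -
  have l: "linear (\<lambda>v. pd v g x)"
    using has_derivative_linear[OF has_derivative_frechet[OF assms]] .
  have "pd v g x = pd (\<Sum>i\<in>Basis. (v \<bullet> i) *\<^sub>R i) g x" by (simp add: euclidean_representation)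
  also have "\<dots> = (\<Sum>i\<in>Basis. (v \<bullet> i) * pd i g x)"
    using linear_sum[OF l, of "\<lambda>i. (v \<bullet> i) *\<^sub>R i" Basis] linear_cmul[OF l] by simp
  finally show ?thesis .
qed

lemma laplacian_cong:
  assumes "open S" "x \<in> S" "\<And>y. y \<in> S \<Longrightarrow> g y = h y"
  shows "laplacian g x = laplacian h x"
proof -
  have "pd i (pd i g) x = pd i (pd i h) x" for i
    by (intro pd_cong(2)[OF assms(1,2)] pd_cong(2)[OF assms(1) _ assms(3)])
  then show ?thesis by (simp add: laplacian_def)
qed

lemma laplacian_add:
  assumes "open S" "x \<in> S" "Ck_on 2 S g" "Ck_on 2 S h"
  shows "laplacian (\<lambda>x. g x + h x) x = laplacian g x + laplacian h x"
proof -
  have C: "Ck_on (Suc (Suc 0)) S g" "Ck_on (Suc (Suc 0)) S h"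
    using assms by (simp_all add: numeral_2_eq_2)
  have "pd i (pd i (\<lambda>x. g x + h x)) x = pd i (pd i g) x + pd i (pd i h) x" for i
  proof -
    have "pd i (\<lambda>x. g x + h x) y = pd i g y + pd i h y" if "y \<in> S" for y
      using C that by (auto intro!: pd_add)
    then have "pd i (pd i (\<lambda>x. g x + h x)) x = pd i (\<lambda>x. pd i g x + pd i h x) x"
      by (rule pd_cong(2)[OF assms(1,2)])
    also have "\<dots> = pd i (pd i g) x + pd i (pd i h) x"
      using C assms(2) by (auto intro!: pd_add)
    finally show ?thesis .
  qed
  then show ?thesis by (simp add: laplacian_def sum.distrib)
qed

lemma laplacian_mult:
  assumes "open S" "x \<in> S" "Ck_on 2 S g" "Ck_on 2 S h"
  shows "laplacian (\<lambda>x. g x * h x) x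
    = g x * laplacian h x + h x * laplacian g x + 2 * (\<Sum>i\<in>Basis. pd i g x * pd i h x)"
proof -
  have C: "Ck_on (Suc (Suc 0)) S g" "Ck_on (Suc (Suc 0)) S h"
    using assms by (simp_all add: numeral_2_eq_2)
  have "pd i (pd i (\<lambda>x. g x * h x)) x
      = g x * pd i (pd i h) x + h x * pd i (pd i g) x + 2 * (pd i g x * pd i h x)" for i
  proof -
    have "pd i (\<lambda>x. g x * h x) y = g y * pd i h y + pd i g y * h y" if "y \<in> S" for y
      using C that by (auto intro!: pd_mult)
    then have "pd i (pd i (\<lambda>x. g x * h x)) x = pd i (\<lambda>x. g x * pd i h x + pd i g x * h x) x"
      by (rule pd_cong(2)[OF assms(1,2)])
    also have "\<dots> = pd i (\<lambda>x. g x * pd i h x) x + pd i (\<lambda>x. pd i g x * h x) x"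
      using C assms(2) by (auto intro!: pd_add)
    also have "\<dots> = g x * pd i (pd i h) x + pd i g x * pd i h x
        + (pd i g x * pd i h x + pd i (pd i g) x * h x)"
      using C assms(2) by (subst (1 2) pd_mult) auto
    finally show ?thesis by (simp add: algebra_simps)
  qed
  then show ?thesis by (simp add: laplacian_def sum.distrib sum_distrib_left)
qed

lemma laplacian_cmult:
  assumes "open S" "x \<in> S" "Ck_on 2 S g"
  shows "laplacian (\<lambda>x. c * g x) x = c * laplacian g x"
  unfolding laplacian_mult[OF assms(1,2) Ck_on_const assms(3)]
  by (simp add: laplacian_def[of "\<lambda>_. c"])

lemma laplacian_diff:
  assumes "open S" "x \<in> S" "Ck_on 2 S g" "Ck_on 2 S h"
  shows "laplacian (\<lambda>x. g x - h x) x = laplacian g x - laplacian h x"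
  using laplacian_add[OF assms(1-3) Ck_on_cmult[OF assms(1,4), of "-1"]]
    laplacian_cmult[OF assms(1,2,4), of "-1"] by simp

lemma continuous_on_laplacian: "open S \<Longrightarrow> Ck_on 2 S g \<Longrightarrow> continuous_on S (laplacian g)"
  unfolding laplacian_def numeral_2_eq_2 by (auto intro!: continuous_on_sum)

lemma Ck_on_laplacian: "open S \<Longrightarrow> Ck_on (Suc (Suc k)) S g \<Longrightarrow> Ck_on k S (laplacian g)"
  unfolding laplacian_def[abs_def] by (intro Ck_on_sum) auto

section \<open>Kernel operators\<close>

text \<open>A superposition of translates of \<open>w\<close>: \<open>x\<close> enters only through
  the shift, so derivatives in \<open>x\<close> fall on \<open>w\<close> alone. Averages over a ball
  (shift r y) and potentials (shift r t y with parameter (t, y)) are both of this form and share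
  their regularity theory.\<close>

definition kop :: "'b::euclidean_space set \<Rightarrow> ('b \<Rightarrow> real) \<Rightarrow> ('b \<Rightarrow> 'a::euclidean_space) \<Rightarrow>
    ('a \<Rightarrow> real) \<Rightarrow> 'a \<Rightarrow> real" where
  "kop C \<kappa> \<eta> w x = integral C (\<lambda>q. \<kappa> q * w (x + \<eta> q))"

lemma kop_integrand_continuous:
  fixes \<kappa> :: "'b::euclidean_space \<Rightarrow> real" and \<eta> :: "'b \<Rightarrow> 'a::euclidean_space"
  assumes "continuous_on C \<kappa>" "continuous_on C \<eta>" "continuous_on S w" "\<And>q. q \<in> C \<Longrightarrow> x + \<eta> q \<in> S"
  shows "continuous_on C (\<lambda>q. \<kappa> q * w (x + \<eta> q))"
proof -
  have "continuous_on C (\<lambda>q. x + \<eta> q)" by (intro continuous_intros assms)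
  from continuous_on_compose2[OF assms(3) this] have "continuous_on C (\<lambda>q. w (x + \<eta> q))"
    using assms(4) by auto
  then show ?thesis by (intro continuous_intros assms)
qed

lemma kop_integrable:
  fixes \<kappa> :: "'b::euclidean_space \<Rightarrow> real" and \<eta> :: "'b \<Rightarrow> 'a::euclidean_space"
  assumes "continuous_on (cbox a b) \<kappa>" "continuous_on (cbox a b) \<eta>" "continuous_on S w"
    "\<And>q. q \<in> cbox a b \<Longrightarrow> x + \<eta> q \<in> S"
  shows "(\<lambda>q. \<kappa> q * w (x + \<eta> q)) integrable_on cbox a b"
  by (rule integrable_continuous, rule kop_integrand_continuous[OF assms])

lemma kop_continuous:
  assumes "continuous_on (cbox a b) \<kappa>" "continuous_on (cbox a b) \<eta>" "continuous_on S w"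
    "\<And>x q. x \<in> V \<Longrightarrow> q \<in> cbox a b \<Longrightarrow> x + \<eta> q \<in> S"
  shows "continuous_on V (kop (cbox a b) \<kappa> \<eta> w)"
proof -
  have "continuous_on (V \<times> cbox a b) (\<lambda>(x, q). \<kappa> q * w (x + \<eta> q))"
    unfolding split_beta
    by (intro continuous_intros continuous_on_compose2[OF assms(3)]
        continuous_on_compose2[OF assms(1)] continuous_on_compose2[OF assms(2)]) (use assms in auto)
  from integral_continuous_on_param[OF this] show ?thesis
    by (simp add: kop_def[abs_def])
qed

lemma kop_diff:
  assumes "continuous_on (cbox a b) \<kappa>" "continuous_on (cbox a b) \<eta>"
    "continuous_on S w" "continuous_on S w'" "\<And>q. q \<in> cbox a b \<Longrightarrow> x + \<eta> q \<in> S"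
  shows "kop (cbox a b) \<kappa> \<eta> (\<lambda>y. w y - w' y) x = kop (cbox a b) \<kappa> \<eta> w x - kop (cbox a b) \<kappa> \<eta> w' x"
  unfolding kop_def right_diff_distrib
  by (intro integral_diff kop_integrable[OF assms(1-3,5)] kop_integrable[OF assms(1,2,4,5)])

lemma kop_add:
  assumes "continuous_on (cbox a b) \<kappa>" "continuous_on (cbox a b) \<eta>"
    "continuous_on S w" "continuous_on S w'" "\<And>q. q \<in> cbox a b \<Longrightarrow> x + \<eta> q \<in> S"
  shows "kop (cbox a b) \<kappa> \<eta> (\<lambda>y. w y + w' y) x = kop (cbox a b) \<kappa> \<eta> w x + kop (cbox a b) \<kappa> \<eta> w' x"
  unfolding kop_def distrib_left
  by (intro integral_add kop_integrable[OF assms(1-3,5)] kop_integrable[OF assms(1,2,4,5)])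

lemma kop_cmult: "kop C \<kappa> \<eta> (\<lambda>y. c * w y) x = c * kop C \<kappa> \<eta> w x"
  unfolding kop_def integral_mult_right[symmetric] by (simp add: mult_ac)

lemma kop_cong: "(\<And>q. q \<in> C \<Longrightarrow> w (x + \<eta> q) = w' (x + \<eta> q)) \<Longrightarrow> kop C \<kappa> \<eta> w x = kop C \<kappa> \<eta> w' x"
  unfolding kop_def by (intro integral_cong) auto

lemma kop_mono:
  assumes "continuous_on (cbox a b) \<kappa>" "continuous_on (cbox a b) \<eta>"
    "continuous_on S w" "continuous_on S w'" "\<And>q. q \<in> cbox a b \<Longrightarrow> x + \<eta> q \<in> S"
    "\<And>q. q \<in> cbox a b \<Longrightarrow> 0 \<le> \<kappa> q" "\<And>q. q \<in> cbox a b \<Longrightarrow> w (x + \<eta> q) \<le> w' (x + \<eta> q)"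
  shows "kop (cbox a b) \<kappa> \<eta> w x \<le> kop (cbox a b) \<kappa> \<eta> w' x"
  unfolding kop_def
  by (intro integral_le kop_integrable[OF assms(1-3,5)] kop_integrable[OF assms(1,2,4,5)] mult_left_mono assms(6,7))

lemma kop_abs_le:
  assumes "continuous_on (cbox a b) \<kappa>" "continuous_on (cbox a b) \<eta>"
    "continuous_on S w" "\<And>q. q \<in> cbox a b \<Longrightarrow> x + \<eta> q \<in> S"
    "\<And>q. q \<in> cbox a b \<Longrightarrow> \<bar>\<kappa> q\<bar> \<le> B" "\<And>q. q \<in> cbox a b \<Longrightarrow> \<bar>w (x + \<eta> q)\<bar> \<le> W"
    "0 \<le> B" "0 \<le> W"
  shows "\<bar>kop (cbox a b) \<kappa> \<eta> w x\<bar> \<le> B * W * measure lborel (cbox a b)"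
proof -
  have "norm (integral (cbox a b) (\<lambda>q. \<kappa> q * w (x + \<eta> q))) \<le> B * W * measure lborel (cbox a b)"
    by (rule integrable_bound[OF _ kop_integrable[OF assms(1-4)]])
      (use assms(5-) in \<open>auto simp: abs_mult intro!: mult_mono\<close>)
  then show ?thesis by (simp add: kop_def)
qed

text \<open>Dominated convergence: a uniform bound and pointwise convergence suffice, which is what
  a monotone iteration provides.\<close>

lemma kop_tendsto:
  assumes "continuous_on (cbox a b) \<kappa>" "continuous_on (cbox a b) \<eta>"
    "\<And>n. continuous_on S (w n)" "\<And>q. q \<in> cbox a b \<Longrightarrow> x + \<eta> q \<in> S"
    "\<And>n y. y \<in> S \<Longrightarrow> \<bar>w n y\<bar> \<le> W" "\<And>y. y \<in> S \<Longrightarrow> (\<lambda>n. w n y) \<longlonglongrightarrow> w' y"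
  shows "(\<lambda>n. kop (cbox a b) \<kappa> \<eta> (w n) x) \<longlonglongrightarrow> kop (cbox a b) \<kappa> \<eta> w' x"
proof -
  have "(\<lambda>q. \<bar>\<kappa> q\<bar> * W) integrable_on cbox a b"
    by (intro integrable_continuous continuous_intros assms)
  then show ?thesis
    unfolding kop_def
    by (intro dominated_convergence(2)[where h="\<lambda>q. \<bar>\<kappa> q\<bar> * W"] kop_integrable[OF assms(1-4)])
      (use assms(4-) in \<open>auto simp: abs_mult intro!: mult_left_mono tendsto_intros\<close>)
qed

lemma kop_leibniz:
  fixes w :: "'a::euclidean_space \<Rightarrow> real" and \<kappa> :: "'b::euclidean_space \<Rightarrow> real"
  assumes \<kappa>: "continuous_on (cbox a b) \<kappa>" and \<eta>: "continuous_on (cbox a b) \<eta>"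
    and S: "open S" and w: "Ck_on 1 S w" and V: "open V" "x0 \<in> V"
    and VS: "\<And>x q. x \<in> V \<Longrightarrow> q \<in> cbox a b \<Longrightarrow> x + \<eta> q \<in> S"
  shows "(kop (cbox a b) \<kappa> \<eta> w has_derivative (\<lambda>v. kop (cbox a b) \<kappa> \<eta> (pd v w) x0)) (at x0)"
proof -
  obtain e where e: "e > 0" "ball x0 e \<subseteq> V"
    using V open_contains_ball by blast
  have wd: "w differentiable (at y)" if "y \<in> S" for y
    using w that by auto
  have cpd: "continuous_on S (pd v w)" for v
    using w by simp
  have bl: "bounded_linear (\<lambda>v. pd v w y)" if "y \<in> S" for y
    using has_derivative_frechet[OF wd[OF that]] by (rule has_derivative_bounded_linear)
  \<comment> \<open>\<open>leibniz_rule\<close> takes the derivative as a continuous family of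
    bounded linear maps. In finite dimensions such a family is continuous once it is so in every
    direction.\<close>
  define L where "L y = Blinfun (\<lambda>v. pd v w y)" for y
  have L: "blinfun_apply (L y) v = pd v w y" if "y \<in> S" for y v
    unfolding L_def using bounded_linear_Blinfun_apply[OF bl[OF that]] by simp
  have cL: "continuous_on S L"
  proof (rule continuous_on_blinfun_componentwise)
    fix i :: 'a
    show "continuous_on S (\<lambda>y. blinfun_apply (L y) i)"
      using cpd L by (simp cong: continuous_on_cong)
  qed
  define fx where "fx x q = \<kappa> q *\<^sub>R L (x + \<eta> q)" for x q
  have cfx: "continuous_on (ball x0 e \<times> cbox a b) (\<lambda>(x, q). fx x q)"
    unfolding split_beta fx_def
    by (intro continuous_intros continuous_on_compose2[OF cL]
        continuous_on_compose2[OF \<kappa>] continuous_on_compose2[OF \<eta>]) (use VS e in auto)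
  have der: "((\<lambda>x. \<kappa> q * w (x + \<eta> q)) has_derivative blinfun_apply (fx x q)) (at x within ball x0 e)"
    if "x \<in> ball x0 e" "q \<in> cbox a b" for x q
  proof -
    have xS: "x + \<eta> q \<in> S" using that e VS by auto
    have "((\<lambda>x. x + \<eta> q) has_derivative (\<lambda>v. v)) (at x)"
      by (auto intro!: derivative_eq_intros)
    from has_derivative_compose[OF this has_derivative_frechet[OF wd[OF xS]]]
    have "((\<lambda>x. \<kappa> q * w (x + \<eta> q)) has_derivative (\<lambda>v. \<kappa> q * pd v w (x + \<eta> q))) (at x)"
      by (rule has_derivative_mult_right)
    moreover have "blinfun_apply (fx x q) = (\<lambda>v. \<kappa> q * pd v w (x + \<eta> q))"
      using L[OF xS] by (auto simp: fx_def blinfun.scaleR_left)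
    ultimately show ?thesis
      by (simp add: has_derivative_at_withinI)
  qed
  have x0: "x0 \<in> ball x0 e" using e by simp
  have "((\<lambda>x. integral (cbox a b) (\<lambda>q. \<kappa> q * w (x + \<eta> q))) has_derivative
      blinfun_apply (integral (cbox a b) (fx x0))) (at x0 within ball x0 e)"
    by (rule leibniz_rule[OF der _ cfx x0])
      (use e VS in \<open>auto intro!: kop_integrable[OF \<kappa> \<eta>, of S] Ck_on_continuous_on[OF w]\<close>)
  moreover have "blinfun_apply (integral (cbox a b) (fx x0)) v = kop (cbox a b) \<kappa> \<eta> (pd v w) x0" for v
  proof -
    have "continuous_on (cbox a b) (fx x0)"
      unfolding fx_def
      by (intro continuous_intros \<kappa> continuous_on_compose2[OF cL] \<eta>) (use VS V in auto)
    then have "blinfun_apply (integral (cbox a b) (fx x0)) v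
        = integral (cbox a b) (\<lambda>q. blinfun_apply (fx x0 q) v)"
      by (intro blinfun_apply_integral integrable_continuous)
    also have "\<dots> = kop (cbox a b) \<kappa> \<eta> (pd v w) x0"
      unfolding kop_def
      by (intro integral_cong) (use VS V in \<open>auto simp: fx_def blinfun.scaleR_left L\<close>)
    finally show ?thesis .
  qed
  then have "blinfun_apply (integral (cbox a b) (fx x0)) = (\<lambda>v. kop (cbox a b) \<kappa> \<eta> (pd v w) x0)"
    by (rule ext)
  ultimately have "(kop (cbox a b) \<kappa> \<eta> w has_derivative (\<lambda>v. kop (cbox a b) \<kappa> \<eta> (pd v w) x0))
      (at x0 within ball x0 e)"
    unfolding kop_def[abs_def] by simp
  then show ?thesis
    using at_within_open[OF x0 open_ball] by simp
qed

section \<open>Polynomial approximation and smoothing kernels\<close>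

lemma Ck_on_polynomial:
  assumes "real_polynomial_function p" shows "Ck_on k UNIV p"
  using assms
  by (induction) (auto intro: Ck_on_bounded_linear Ck_on_const Ck_on_add Ck_on_mult)

lemma polynomial_approximation:
  fixes a :: "'a::euclidean_space \<Rightarrow> real"
  assumes "compact S" "continuous_on S a"
  obtains q where "\<And>n. real_polynomial_function (q n)" "\<And>n x. x \<in> S \<Longrightarrow> \<bar>a x - q n x\<bar> < 1 / Suc n"
proof -
  have "\<exists>p. real_polynomial_function p \<and> (\<forall>x\<in>S. \<bar>a x - p x\<bar> < 1 / Suc n)" for n
    using Stone_Weierstrass_real_polynomial_function[OF assms, of "1 / Suc n"]
    by (metis divide_pos_pos of_nat_0_less_iff zero_less_Suc zero_less_one)
  then show ?thesis using that by metis
qed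

lemma continuous_on_compact_bound:
  fixes a :: "'a::metric_space \<Rightarrow> real"
  assumes "compact S" "continuous_on S a"
  obtains C where "0 \<le> C" "\<And>x. x \<in> S \<Longrightarrow> \<bar>a x\<bar> \<le> C"
proof -
  obtain C where C: "\<forall>y\<in>a ` S. norm y \<le> C"
    using compact_imp_bounded[OF compact_continuous_image[OF assms(2,1)]] bounded_iff by blast
  then show ?thesis by (intro that[of "max C 0"]) (auto simp: le_max_iff_disj)
qed

text \<open>In \<open>ibp\<close> the derivative has been moved onto the kernel; this is what makes a kernel operator
  gain one derivative.\<close>

locale smoothing_kernel =
  fixes a b :: "'b::euclidean_space" and \<kappa> :: "'b \<Rightarrow> real" and \<eta> :: "'b \<Rightarrow> 'a::euclidean_space"
    and \<kappa>' :: "'a \<Rightarrow> 'b \<Rightarrow> real" and B :: real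
  assumes cont_kernel: "continuous_on (cbox a b) \<kappa>"
    and cont_shift: "continuous_on (cbox a b) \<eta>"
    and cont_deriv: "\<And>v. continuous_on (cbox a b) (\<kappa>' v)"
    and deriv_bound: "\<And>v q. q \<in> cbox a b \<Longrightarrow> \<bar>\<kappa>' v q\<bar> \<le> B * norm v"
    and B_nonneg: "0 \<le> B"
    and ibp: "\<And>p v x. real_polynomial_function p \<Longrightarrow>
      kop (cbox a b) \<kappa> \<eta> (pd v p) x = kop (cbox a b) (\<kappa>' v) \<eta> p x"
begin

abbreviation "K \<equiv> kop (cbox a b) \<kappa> \<eta>"

text \<open>For merely continuous \<open>w\<close> the derivative cannot be taken under the
  integral. Polynomials approximate \<open>w\<close> uniformly on a compact set; after
  \<open>ibp\<close> their derivatives involve only the values of the polynomials, so these converge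
  uniformly too and \<open>has_derivative_sequence\<close> applies.\<close>

lemma has_derivative_kop:
  assumes w: "continuous_on S w" and V: "open V" "x0 \<in> V"
    and VS: "\<And>x q. x \<in> V \<Longrightarrow> q \<in> cbox a b \<Longrightarrow> x + \<eta> q \<in> S"
  shows "(K w has_derivative (\<lambda>v. kop (cbox a b) (\<kappa>' v) \<eta> w x0)) (at x0)"
proof -
  obtain e where e: "e > 0" "cball x0 e \<subseteq> V"
    using V open_contains_cball by blast
  \<comment> \<open>All points at which \<open>w\<close> is evaluated while \<open>x\<close> stays
    in the closed ball; compact, so Weierstrass approximation is available there.\<close>
  define T where "T = (\<lambda>(x, q). x + \<eta> q) ` (cball x0 e \<times> cbox a b)"
  have "compact T"
    unfolding T_def split_beta
    by (intro compact_continuous_image compact_Times compact_cball compact_cbox continuous_intros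
        continuous_on_compose2[OF cont_shift]) auto
  have TS: "T \<subseteq> S" using VS e by (auto simp: T_def)
  have inT: "x + \<eta> q \<in> T" if "x \<in> ball x0 e" "q \<in> cbox a b" for x q
    using that unfolding T_def by force
  have cw: "continuous_on T w" using w TS continuous_on_subset by blast
  obtain p where p: "\<And>n. real_polynomial_function (p n)"
      and pw: "\<And>n x. x \<in> T \<Longrightarrow> \<bar>w x - p n x\<bar> < 1 / Suc n"
    using polynomial_approximation[OF \<open>compact T\<close> cw] by blast
  have cp: "continuous_on T (p n)" for n
    using Ck_on_continuous_on[OF Ck_on_polynomial[OF p, of 0]] continuous_on_subset by blast
  let ?D = "B * measure lborel (cbox a b)"
  have D: "?D \<ge> 0" using B_nonneg by simp
  have bound: "\<bar>kop (cbox a b) (\<kappa>' v) \<eta> (p n) x - kop (cbox a b) (\<kappa>' v) \<eta> w x\<bar>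
      \<le> ?D * (1 / Suc n) * norm v" if "x \<in> ball x0 e" for n x v
  proof -
    have "\<bar>kop (cbox a b) (\<kappa>' v) \<eta> (\<lambda>y. p n y - w y) x\<bar> \<le> (B * norm v) * (1 / Suc n) * measure lborel (cbox a b)"
    proof (rule kop_abs_le[where S=T])
      show "\<bar>p n (x + \<eta> q) - w (x + \<eta> q)\<bar> \<le> 1 / Suc n" if "q \<in> cbox a b" for q
        using pw[OF inT[OF \<open>x \<in> ball x0 e\<close> that], of n] by (simp add: abs_minus_commute)
    qed (use that inT deriv_bound B_nonneg in \<open>auto intro!: cont_deriv cont_shift continuous_on_diff cp cw\<close>)
    then show ?thesis
      by (subst (asm) kop_diff[OF cont_deriv cont_shift cp cw]) (use inT that in \<open>auto simp: mult_ac\<close>)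
  qed
  have lim0: "(\<lambda>n. C * (1 / real (Suc n))) \<longlonglongrightarrow> 0" for C
    using tendsto_mult_right_zero[OF LIMSEQ_inverse_real_of_nat, of C] by (simp add: field_simps)
  have Klim: "(\<lambda>n. K (p n) x) \<longlonglongrightarrow> K w x" if "x \<in> ball x0 e" for x
  proof -
    obtain W where W: "\<And>y. y \<in> T \<Longrightarrow> \<bar>w y\<bar> \<le> W"
      using continuous_on_compact_bound[OF \<open>compact T\<close> cw] by blast
    show ?thesis
    proof (rule kop_tendsto[OF cont_kernel cont_shift cp, where W="W+1"])
      fix y assume y: "y \<in> T"
      have "1 / real (Suc n) \<le> 1" for n by simp
      then show "\<bar>p n y\<bar> \<le> W + 1" for n
        using pw[OF y, of n] W[OF y] by (smt (verit))
      show "(\<lambda>n. p n y) \<longlonglongrightarrow> w y"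
        by (rule LIM_zero_cancel, rule Lim_null_comparison[OF _ lim0[of 1]])
          (use pw[OF y] in \<open>auto intro!: always_eventually simp: abs_minus_commute less_imp_le\<close>)
    qed (use that inT in auto)
  qed
  have "\<exists>g. \<forall>x\<in>ball x0 e. (\<lambda>n. K (p n) x) \<longlonglongrightarrow> g x \<and>
      (g has_derivative (\<lambda>v. kop (cbox a b) (\<kappa>' v) \<eta> w x)) (at x within ball x0 e)"
  proof (rule has_derivative_sequence[of "ball x0 e"  _ _ _ x0 "K w x0"])
    show "x0 \<in> ball x0 e" "convex (ball x0 e)" using e by auto
    then show "(\<lambda>n. K (p n) x0) \<longlonglongrightarrow> K w x0" using Klim by blast
    show "(K (p n) has_derivative (\<lambda>v. kop (cbox a b) (\<kappa>' v) \<eta> (p n) x)) (at x within ball x0 e)" for n x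
      using kop_leibniz[OF cont_kernel cont_shift open_UNIV Ck_on_polynomial[OF p] open_UNIV]
      unfolding ibp[OF p] by (auto intro: has_derivative_at_withinI)
    fix r :: real assume "r > 0"
    then have "\<forall>\<^sub>F n in sequentially. ?D * (1 / Suc n) < r"
      using order_tendstoD(2)[OF lim0] by blast
    then show "\<forall>\<^sub>F n in sequentially. \<forall>x\<in>ball x0 e. \<forall>v.
        norm (kop (cbox a b) (\<kappa>' v) \<eta> (p n) x - kop (cbox a b) (\<kappa>' v) \<eta> w x) \<le> r * norm v"
      by eventually_elim (smt (verit) bound mult_right_mono norm_ge_zero real_norm_def)
  qed
  then obtain g where g: "\<And>x. x \<in> ball x0 e \<Longrightarrow> (\<lambda>n. K (p n) x) \<longlonglongrightarrow> g x"
    "\<And>x. x \<in> ball x0 e \<Longrightarrow> (g has_derivative (\<lambda>v. kop (cbox a b) (\<kappa>' v) \<eta> w x)) (at x within ball x0 e)"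
    by blast
  have "g x = K w x" if "x \<in> ball x0 e" for x
    using LIMSEQ_unique[OF g(1)[OF that] Klim[OF that]] .
  moreover have x0: "x0 \<in> ball x0 e" using e by simp
  ultimately show ?thesis
    using has_derivative_transform_within_open[OF g(2)[OF x0] open_ball x0]
      at_within_open[OF x0 open_ball] by auto
qed

text \<open>Derivatives commute with \<open>K\<close> as soon as \<open>w\<close> is C^1, so the
  gain of one derivative for continuous functions propagates to every order.\<close>

lemma Ck_on_kop:
  assumes "open S" "Ck_on k S w" "open V"
    and VS: "\<And>x q. x \<in> V \<Longrightarrow> q \<in> cbox a b \<Longrightarrow> x + \<eta> q \<in> S"
  shows "Ck_on (Suc k) V (K w)"
  using assms(2)
proof (induction k arbitrary: w)
  case 0
  then have w: "continuous_on S w" by simp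
  note d = has_derivative_kop[OF w assms(3) _ VS]
  have "continuous_on V (pd v (K w))" for v
  proof -
    have "continuous_on V (kop (cbox a b) (\<kappa>' v) \<eta> w)"
      by (rule kop_continuous[OF cont_deriv cont_shift w VS])
    then show ?thesis
      using pd_eqI[OF d] by (simp cong: continuous_on_cong)
  qed
  then show ?case using d by (auto simp: differentiable_def)
next
  case (Suc k)
  have w: "continuous_on S w" by (rule Ck_on_continuous_on[OF Suc.prems])
  have w1: "Ck_on 1 S w" by (rule Ck_on_mono[OF Suc.prems]) simp
  have "K w differentiable (at x)" if "x \<in> V" for x
    using has_derivative_kop[OF w assms(3) that VS] by (auto simp: differentiable_def)
  moreover have "Ck_on (Suc k) V (pd v (K w))" for v
    by (subst Ck_on_cong[OF assms(3) pd_eqI[OF kop_leibniz[OF cont_kernel cont_shift assms(1) w1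
              assms(3) _ VS]]]) (simp_all only: Suc.IH[OF Ck_on_pd[OF Suc.prems]])
  ultimately show ?case by (subst Ck_on.simps) auto
qed

text \<open>The constant sees \<open>w\<close> only through its supremum. This gives equi-Lipschitz
  bounds for iterates about which nothing but a bound is known.\<close>

lemma kop_Lipschitz:
  assumes w: "continuous_on S w" and V: "open V" "convex V" "x \<in> V" "y \<in> V"
    and VS: "\<And>x q. x \<in> V \<Longrightarrow> q \<in> cbox a b \<Longrightarrow> x + \<eta> q \<in> S"
    and W: "\<And>y. y \<in> S \<Longrightarrow> \<bar>w y\<bar> \<le> W" "0 \<le> W"
  shows "\<bar>K w x - K w y\<bar> \<le> B * measure lborel (cbox a b) * W * norm (x - y)"
proof -
  have "norm (K w x - K w y) \<le> B * measure lborel (cbox a b) * W * norm (x - y)"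
  proof (rule differentiable_bound[OF V(2) _ _ V(3,4), where f="K w"
          and f'="\<lambda>z v. kop (cbox a b) (\<kappa>' v) \<eta> w z"])
    fix z assume z: "z \<in> V"
    show "(K w has_derivative (\<lambda>v. kop (cbox a b) (\<kappa>' v) \<eta> w z)) (at z within V)"
      by (rule has_derivative_at_withinI, rule has_derivative_kop[OF w V(1) z VS])
    show "onorm (\<lambda>v. kop (cbox a b) (\<kappa>' v) \<eta> w z) \<le> B * measure lborel (cbox a b) * W"
    proof (rule onorm_le)
      fix v
      have "\<bar>kop (cbox a b) (\<kappa>' v) \<eta> w z\<bar> \<le> (B * norm v) * W * measure lborel (cbox a b)"
        using VS[OF z] by (intro kop_abs_le[OF cont_deriv cont_shift w] deriv_bound W mult_nonneg_nonneg
            B_nonneg norm_ge_zero)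
      then show "norm (kop (cbox a b) (\<kappa>' v) \<eta> w z) \<le> B * measure lborel (cbox a b) * W * norm v"
        by (simp add: mult_ac)
    qed
  qed
  then show ?thesis by simp
qed

end

section \<open>Integration by parts against bumps\<close>

lemma integrable_compact_support:
  fixes g :: "'a::euclidean_space \<Rightarrow> real"
  assumes K: "compact K" and "continuous_on K g" "\<And>x. x \<notin> K \<Longrightarrow> g x = 0"
  shows "integrable lborel g"
proof -
  have "integrable lborel (\<lambda>x. indicator K x *\<^sub>R g x)"
    using borel_integrable_compact[OF assms(1,2)] .
  moreover have "(\<lambda>x. indicator K x *\<^sub>R g x) = g"
  proof
    show "indicator K x *\<^sub>R g x = g x" for x by (cases "x \<in> K") (simp_all add: assms(3))
  qed
  ultimately show ?thesis by simp
qed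

text \<open>Difference quotients of \<open>F\<close> have integral 0 by translation invariance of
  Lebesgue measure. They are bounded by the mean value theorem and supported in one ball, so
  dominated convergence carries this over to the derivative.\<close>

lemma integral_pd_compact_support:
  fixes F :: "'a::euclidean_space \<Rightarrow> real"
  assumes F: "Ck_on 1 UNIV F" and K: "compact K" and F0: "\<And>x. x \<notin> K \<Longrightarrow> F x = 0"
  shows "integrable lborel (pd e F)" "(LINT x|lborel. pd e F x) = 0" "\<And>x. x \<notin> K \<Longrightarrow> pd e F x = 0"
proof -
  have "open (- K)" using K by (simp add: compact_imp_closed open_Compl)
  then have pd0: "pd e F x = 0" if "x \<notin> K" for x
    using pd_cong(2)[of "-K" x F "\<lambda>_. 0" e] F0 that by auto
  then show "\<And>x. x \<notin> K \<Longrightarrow> pd e F x = 0" .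
  have cF: "continuous_on UNIV F" and cpd: "continuous_on UNIV (pd e F)"
    using Ck_on_continuous_on[OF F] F by simp_all
  have F': "(F has_derivative (\<lambda>v. pd v F x)) (at x)" for x
    using F by (intro has_derivative_frechet) auto
  have intF: "integrable lborel F" and "integrable lborel (pd e F)"
    using integrable_compact_support[OF K continuous_on_subset[OF cF] F0]
      integrable_compact_support[OF K continuous_on_subset[OF cpd] pd0] by auto
  then show "integrable lborel (pd e F)" by simp
  obtain B where B: "\<And>x. \<bar>pd e F x\<bar> \<le> B"
  proof -
    have "compact (pd e F ` K)"
      using compact_continuous_image[OF continuous_on_subset[OF cpd] K] by simp
    then obtain B where "\<forall>z\<in>pd e F ` K. norm z \<le> B"
      using compact_imp_bounded bounded_iff by blast
    then have B: "\<bar>pd e F x\<bar> \<le> B" if "x \<in> K" for x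
      using that by simp
    have "\<bar>pd e F x\<bar> \<le> max B 0" for x
    proof (cases "x \<in> K")
      case True
      then show ?thesis using B[OF True] by simp
    next
      case False
      then show ?thesis using pd0[OF False] by simp
    qed
    then show ?thesis by (rule that)
  qed
  obtain R where R: "\<forall>x\<in>K. norm x \<le> R"
    using compact_imp_bounded[OF K] bounded_iff by blast
  define q where "q n x = (F (x + (1 / Suc n) *\<^sub>R e) - F x) * Suc n" for n :: nat and x
  have der: "((\<lambda>s. F (x + s *\<^sub>R e)) has_real_derivative pd e F (x + s *\<^sub>R e)) (at s)" for x s
  proof -
    have "((\<lambda>s. x + s *\<^sub>R e) has_derivative (\<lambda>s. s *\<^sub>R e)) (at s)"
      by (auto intro!: derivative_eq_intros)
    from has_derivative_compose[OF this F']
    have "((\<lambda>s. F (x + s *\<^sub>R e)) has_derivative (\<lambda>t. pd (t *\<^sub>R e) F (x + s *\<^sub>R e))) (at s)" .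
    moreover have "pd (t *\<^sub>R e) F (x + s *\<^sub>R e) = pd e F (x + s *\<^sub>R e) * t" for t
      using linear_cmul[OF has_derivative_linear[OF F']] by simp
    ultimately show ?thesis by (simp add: has_field_derivative_def)
  qed
  have qB: "\<bar>q n x\<bar> \<le> B" for n x
  proof -
    obtain z where "F (x + (1 / Suc n) *\<^sub>R e) - F (x + 0 *\<^sub>R e) = (1 / Suc n - 0) * pd e F (x + z *\<^sub>R e)"
      using MVT2[of 0 "1 / Suc n" "\<lambda>s. F (x + s *\<^sub>R e)" "\<lambda>s. pd e F (x + s *\<^sub>R e)"] der by auto
    then have "q n x = pd e F (x + z *\<^sub>R e)" by (simp add: q_def)
    then show ?thesis using B by simp
  qed
  \<comment> \<open>The increments are at most 1 times \<open>e\<close>, so the supports of all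
    quotients stay within distance \<open>norm e\<close> of that of \<open>F\<close>.\<close>
  have q0: "q n x = 0" if "x \<notin> cball 0 (R + norm e)" for n x
  proof -
    have "norm x \<le> norm (x + (1 / Suc n) *\<^sub>R e) + norm ((1 / Suc n) *\<^sub>R e)"
      by (metis add_diff_cancel_right' norm_triangle_ineq4)
    moreover have "norm ((1 / Suc n) *\<^sub>R e) \<le> 1 * norm e"
      unfolding norm_scaleR by (intro mult_right_mono) auto
    moreover have "norm x > R + norm e" using that by simp
    ultimately have "R < norm (x + (1 / Suc n) *\<^sub>R e)" "R < norm x"
      using norm_ge_zero[of e] by linarith+
    then have "x + (1 / Suc n) *\<^sub>R e \<notin> K" "x \<notin> K"
      using R not_le by blast+
    then show ?thesis using F0 by (simp add: q_def)
  qed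
  have qlim: "(\<lambda>n. q n x) \<longlonglongrightarrow> pd e F x" for x
  proof -
    have "((\<lambda>s. (F (x + s *\<^sub>R e) - F x) / s) \<longlongrightarrow> pd e F x) (at 0)"
      using der[of x 0] by (simp add: has_field_derivative_iff)
    moreover have "filterlim (\<lambda>n. 1 / real (Suc n)) (at 0) sequentially"
      using LIMSEQ_inverse_real_of_nat by (auto simp: filterlim_at inverse_eq_divide)
    ultimately have "(\<lambda>n. (F (x + (1 / real (Suc n)) *\<^sub>R e) - F x) / (1 / real (Suc n))) \<longlonglongrightarrow> pd e F x"
      by (rule filterlim_compose)
    then show ?thesis by (simp add: q_def[abs_def])
  qed
  have Ftr: "integrable lborel (\<lambda>x. F (x + c))" "(LINT x|lborel. F (x + c)) = (LINT x|lborel. F x)" for c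
  proof -
    have "integrable (distr lborel borel ((+) c)) F" using intF by (simp add: lborel_distr_plus)
    then show "integrable lborel (\<lambda>x. F (x + c))"
      by (subst (asm) integrable_distr_eq) (use intF in \<open>auto simp: add.commute\<close>)
    have "(LINT x|distr lborel borel ((+) c). F x) = (LINT x|lborel. F (c + x))"
      by (rule integral_distr) (use intF in auto)
    then show "(LINT x|lborel. F (x + c)) = (LINT x|lborel. F x)"
      by (simp add: lborel_distr_plus add.commute)
  qed
  have "(LINT x|lborel. q n x) = 0" for n
    unfolding q_def using Ftr intF by (simp add: Bochner_Integration.integral_diff)
  moreover have "(\<lambda>n. LINT x|lborel. q n x) \<longlonglongrightarrow> (LINT x|lborel. pd e F x)"
  proof (rule integral_dominated_convergence[where w="\<lambda>x. B * indicator (cball 0 (R + norm e)) x"])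
    show "pd e F \<in> borel_measurable lborel"
      using \<open>integrable lborel (pd e F)\<close> by auto
    show "q n \<in> borel_measurable lborel" for n
    proof -
      have "continuous_on UNIV (q n)"
        unfolding q_def[abs_def]
        by (intro continuous_intros continuous_on_compose2[OF cF]) auto
      then show ?thesis by (simp add: borel_measurable_continuous_onI)
    qed
    show "integrable lborel (\<lambda>x::'a. B * indicator (cball 0 (R + norm e)) x :: real)"
      using emeasure_compact_finite[OF compact_cball, of "0::'a" "R + norm e"]
      by (intro integrable_mult_right integrable_real_indicator) auto
    show "AE x in lborel. (\<lambda>n. q n x) \<longlonglongrightarrow> pd e F x" using qlim by auto
    show "AE x in lborel. norm (q n x) \<le> B * indicator (cball 0 (R + norm e)) x" for n
      using qB q0 by (auto simp: indicator_def)
  qed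
  ultimately show "(LINT x|lborel. pd e F x) = 0"
    by (simp add: LIMSEQ_const_iff)
qed

lemma integral_cbox_pd_eq_0:
  fixes F :: "'a::euclidean_space \<Rightarrow> real"
  assumes F: "Ck_on 1 UNIV F" and F0: "\<And>x. x \<notin> cbox a b \<Longrightarrow> F x = 0"
  shows "integral (cbox a b) (pd e F) = 0"
proof -
  note * = integral_pd_compact_support[OF F compact_cbox F0]
  have "integral UNIV (pd e F) = (LINT x|lborel. pd e F x)"
    by (rule integral_lborel[OF *(1)])
  also have "\<dots> = 0" by (rule *(2))
  also have "integral UNIV (pd e F) = integral UNIV (\<lambda>x. if x \<in> cbox a b then pd e F x else 0)"
    by (rule arg_cong[where f="integral UNIV"]) (use *(3) in auto)
  also have "\<dots> = integral (cbox a b) (pd e F)"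
    by (rule integral_restrict_UNIV)
  finally show ?thesis .
qed

text \<open>Polynomial bumps suffice: \<open>bump 2\<close> is \<open>C\<^sup>1\<close>, and \<open>bump 3\<close> is, up to a factor, the
  potential whose gradient is \<open>- y * bump 2 y\<close>.\<close>

definition bump :: "nat \<Rightarrow> 'a::euclidean_space \<Rightarrow> real" where
  "bump m y = (max 0 (1 - y \<bullet> y)) ^ m"

lemma bump_nonneg: "0 \<le> bump m y"
  by (simp add: bump_def)

lemma bump_le_1: "bump m y \<le> 1"
  unfolding bump_def by (intro power_le_one) auto

lemma continuous_on_bump: "continuous_on S (bump m)"
  unfolding bump_def by (intro continuous_intros)

lemma bump_eq_0: "0 < m \<Longrightarrow> 1 \<le> norm y \<Longrightarrow> bump m y = 0"
  by (simp add: bump_def dot_square_norm)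

lemma norm_le_1_in_cbox: "norm y \<le> 1 \<Longrightarrow> y \<in> cbox (- One) One"
  using Basis_le_norm[of _ y] by (fastforce simp: mem_box abs_le_iff)

text \<open>Only the kink at 0 matters: the exponent is at least 2, so the difference quotient there
  is bounded by |h|^(j+1) and tends to 0.\<close>

lemma DERIV_max_power:
  "((\<lambda>s. max 0 s ^ Suc (Suc j)) has_real_derivative real (Suc (Suc j)) * max 0 s ^ Suc j) (at s)"
proof -
  consider "s < 0" | "s = 0" | "s > 0" by linarith
  then show ?thesis
  proof cases
    case 1
    have "((\<lambda>s::real. 0) has_real_derivative 0) (at s)" by simp
    then show ?thesis
      by (rule has_field_derivative_transform_within_open[of _ _ _ "{..<0}", THEN DERIV_cong]) (use 1 in auto)
  next
    case 2
    have "((\<lambda>h::real. max 0 h ^ Suc (Suc j) / h) \<longlongrightarrow> 0) (at 0)"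
    proof (rule Lim_null_comparison)
      show "\<forall>\<^sub>F h::real in at 0. norm (max 0 h ^ Suc (Suc j) / h) \<le> \<bar>h\<bar> ^ Suc j"
      proof (rule always_eventually, rule allI)
        fix h :: real
        show "norm (max 0 h ^ Suc (Suc j) / h) \<le> \<bar>h\<bar> ^ Suc j"
        proof (cases "h > 0")
          case False
          then have "max 0 h = 0" by simp
          then show ?thesis by (simp del: power_Suc abs_of_nonpos)
        qed (simp add: max_def)
      qed
      show "((\<lambda>h::real. \<bar>h\<bar> ^ Suc j) \<longlongrightarrow> 0) (at 0)"
        by (rule tendsto_eq_intros refl | simp)+
    qed
    then show ?thesis using 2 by (simp add: has_field_derivative_iff)
  next
    case 3
    have "((\<lambda>s. s ^ Suc (Suc j)) has_real_derivative real (Suc (Suc j)) * s ^ Suc j) (at s)"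
      using DERIV_pow[of "Suc (Suc j)" s] by simp
    then show ?thesis
      by (rule has_field_derivative_transform_within_open[of _ _ _ "{0<..}", THEN DERIV_cong]) (use 3 in auto)
  qed
qed

lemma bump_has_derivative:
  "(bump (Suc (Suc j)) has_derivative
     (\<lambda>v. - 2 * real (Suc (Suc j)) * (y \<bullet> v) * bump (Suc j) y)) (at y)"
proof -
  have "((\<lambda>y. 1 - y \<bullet> y) has_derivative (\<lambda>v. - 2 * (y \<bullet> v))) (at y)"
    by (auto intro!: derivative_eq_intros simp: inner_commute)
  from has_derivative_compose[OF this DERIV_max_power[unfolded has_field_derivative_def]]
  show ?thesis by (simp add: bump_def[abs_def] algebra_simps)
qed

lemma pd_bump: "pd v (bump (Suc (Suc j))) y = - 2 * real (Suc (Suc j)) * (y \<bullet> v) * bump (Suc j) y"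
  by (rule pd_eqI[OF bump_has_derivative])

lemma Ck_on_bump: "Ck_on 1 S (bump (Suc (Suc j)))"
proof -
  have "continuous_on S (pd v (bump (Suc (Suc j))))" for v :: 'a
    unfolding pd_bump by (intro continuous_intros continuous_on_bump)
  moreover have "bump (Suc (Suc j)) differentiable (at y)" for y :: 'a
    using bump_has_derivative differentiable_def by blast
  ultimately show ?thesis by simp
qed

text \<open>Off the unit ball the product of \<open>g\<close> with a bump vanishes identically, so it is \<open>C\<^sup>1\<close> on the
  whole space.\<close>

lemma integral_bump_by_parts:
  fixes g :: "'a::euclidean_space \<Rightarrow> real"
  assumes "open S" "cball 0 1 \<subseteq> S" "Ck_on 1 S g"
  shows "integral (cbox (- One) One) (\<lambda>y. bump (Suc (Suc j)) y * pd v g y)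
    = integral (cbox (- One) One) (\<lambda>y. 2 * real (Suc (Suc j)) * (y \<bullet> v) * bump (Suc j) y * g y)"
proof -
  let ?C = "cbox (- One) One :: 'a set"
  let ?b = "bump (Suc (Suc j)) :: 'a \<Rightarrow> real"
  let ?F = "\<lambda>y. ?b y * g y"
  have F0: "?F y = 0" if "y \<in> - cball 0 1" for y
    using that by (simp add: bump_eq_0)
  have out: "Ck_on 1 (- cball 0 1) ?F"
    by (subst Ck_on_cong[OF _ F0]) (auto intro: Ck_on_const)
  have inn: "Ck_on 1 S ?F"
    by (intro Ck_on_mult Ck_on_bump assms)
  have F: "Ck_on 1 UNIV ?F"
  proof (rule Ck_on_local)
    fix x :: 'a
    show "\<exists>V. open V \<and> x \<in> V \<and> Ck_on 1 V ?F"
      using out inn assms(1,2) open_Compl[OF closed_cball, of "0::'a" 1] by (cases "x \<in> cball 0 1") blast+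
  qed
  have F00: "?F y = 0" if "y \<notin> ?C" for y
    using that F0[of y] norm_le_1_in_cbox[of y] by (cases "norm y \<le> 1") auto
  have eq: "pd v ?F y = ?b y * pd v g y - 2 * real (Suc (Suc j)) * (y \<bullet> v) * bump (Suc j) y * g y" for y
  proof (cases "y \<in> cball 0 1")
    case True
    then have "g differentiable (at y)" using assms by auto
    then have "pd v ?F y = ?b y * pd v g y + pd v ?b y * g y"
      using bump_has_derivative differentiable_def by (intro pd_mult) blast+
    then show ?thesis by (simp add: pd_bump algebra_simps)
  next
    case False
    then have "pd v ?F y = pd v (\<lambda>_. 0) y"
      by (intro pd_cong(2)[of "- cball 0 1"] F0) auto
    then show ?thesis using False by (simp add: bump_eq_0)
  qed
  let ?h = "\<lambda>y. 2 * real (Suc (Suc j)) * (y \<bullet> v) * bump (Suc j) y * g y"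
  have "continuous_on UNIV ?h"
  proof (rule Ck_on_local[where k=0, simplified])
    fix x :: 'a
    have "continuous_on S ?h"
      by (intro continuous_intros continuous_on_bump Ck_on_continuous_on[OF assms(3)])
    moreover have "continuous_on (- cball 0 1) ?h"
      by (subst continuous_on_cong[OF refl, of _ _ "\<lambda>_. 0"]) (auto simp: bump_eq_0)
    ultimately show "\<exists>V. open V \<and> x \<in> V \<and> continuous_on V ?h"
      using assms(1,2) open_Compl[OF closed_cball, of "0::'a" 1] by (cases "x \<in> cball 0 1") blast+
  qed
  then have h: "?h integrable_on ?C"
    by (intro integrable_continuous) (rule continuous_on_subset, auto)
  have "continuous_on UNIV (pd v ?F)" using F by simp
  then have p: "pd v ?F integrable_on ?C"
    by (intro integrable_continuous) (rule continuous_on_subset, auto)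
  have "integral ?C (\<lambda>y. ?b y * pd v g y) = integral ?C (\<lambda>y. pd v ?F y + ?h y)"
    unfolding eq by simp
  also have "\<dots> = integral ?C (pd v ?F) + integral ?C ?h"
    by (rule Henstock_Kurzweil_Integration.integral_add[OF p h])
  also have "integral ?C (pd v ?F) = 0"
    by (rule integral_cbox_pd_eq_0[OF F F00])
  finally show ?thesis by simp
qed

section \<open>Averages and potentials\<close>

text \<open>Integrals run over the box [-1, 1]^N, although the bumps vanish off the unit ball. Hence
  \<open>cube x r\<close> is the set of all points at which \<open>avg r w x\<close> and
  \<open>pot r w x\<close> evaluate \<open>w\<close>, and hypotheses on \<open>w\<close> are placed
  there.\<close>

definition cube :: "'a::euclidean_space \<Rightarrow> real \<Rightarrow> 'a set" where
  "cube x r = (\<lambda>q. x + r *\<^sub>R q) ` cbox (- One) One"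

lemma cubeI: "q \<in> cbox (- One) One \<Longrightarrow> x + r *\<^sub>R q \<in> cube x r"
  unfolding cube_def by (rule imageI)

lemma scaleR_in_cbox_One:
  fixes q :: "'a::euclidean_space"
  assumes "q \<in> cbox (- One) One" "0 \<le> t" "t \<le> 1" shows "t *\<^sub>R q \<in> cbox (- One) One"
proof -
  have "0 \<in> cbox (- One) (One::'a)" by (simp add: mem_box)
  then have "(1 - t) *\<^sub>R 0 + t *\<^sub>R q \<in> cbox (- One) (One::'a)"
    using assms by (intro convexD convex_box) auto
  then show ?thesis by simp
qed

lemma cube_scale: "q \<in> cbox (- One) One \<Longrightarrow> 0 \<le> t \<Longrightarrow> t \<le> 1 \<Longrightarrow> x + (r * t) *\<^sub>R q \<in> cube x r"
  using cubeI[OF scaleR_in_cbox_One[of q t], of x r] by simp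

lemma center_in_cube: "x \<in> cube x r"
  using cubeI[of 0 x r] by (simp add: mem_box)

lemma cbox_0: "0 \<in> cbox (- One) (One::'a::euclidean_space)"
  by (simp add: mem_box)

lemma norm_One_pos: "0 < norm (One::'a::euclidean_space)"
  by simp

lemma cube_subset_cball:
  fixes x :: "'a::euclidean_space"
  assumes r: "0 \<le> r"
  shows "cube x r \<subseteq> cball x (r * norm (One::'a))"
proof -
  have "norm q \<le> norm (One::'a)" if "q \<in> cbox (- One) (One::'a)" for q
    by (rule norm_le_componentwise) (use that in \<open>auto simp: mem_box abs_le_iff\<close>)
  then show ?thesis
    using r by (auto simp: cube_def dist_norm intro!: mult_left_mono)
qed

lemma cube_subset_open_uniform:
  fixes S :: "'a::euclidean_space set"
  assumes "open S" "x0 \<in> S"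
  obtains e r0 where "0 < e" "0 < r0" "ball x0 e \<subseteq> S"
    "\<And>x r. x \<in> ball x0 e \<Longrightarrow> 0 \<le> r \<Longrightarrow> r \<le> r0 \<Longrightarrow> cube x r \<subseteq> S"
proof -
  obtain e where e: "0 < e" "ball x0 e \<subseteq> S" using assms open_contains_ball by blast
  \<comment> \<open>A cube with parameter r reaches at most r * norm One from its centre. With r up
    to \<open>r0\<close> this is e/3 < e/2, so it stays in the ball of radius e if its centre is
    within e/2.\<close>
  define r0 where "r0 = e / (3 * norm (One::'a))"
  have r0: "r0 > 0" using e norm_One_pos[where 'a='a] by (simp add: r0_def)
  have "cube x r \<subseteq> S" if "x \<in> ball x0 (e/2)" "0 \<le> r" "r \<le> r0" for x r
  proof -
    have "r * norm (One::'a) \<le> r0 * norm (One::'a)" using that by (intro mult_right_mono) auto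
    also have "\<dots> < e / 2" using e norm_One_pos[where 'a='a] by (simp add: r0_def field_simps)
    finally have "cball x (r * norm (One::'a)) \<subseteq> ball x0 e"
      using that(1) by (intro subsetI) (smt (verit) dist_triangle field_sum_of_halves mem_ball mem_cball)
    then show ?thesis using cube_subset_cball[OF that(2), of x] e(2) by blast
  qed
  then show ?thesis using that[of "e/2" r0] e r0 by (auto simp: subset_iff)
qed

lemma cube_subset_open:
  fixes S :: "'a::euclidean_space set"
  assumes "open S" "x \<in> S"
  obtains r0 where "0 < r0" "\<And>r. 0 \<le> r \<Longrightarrow> r \<le> r0 \<Longrightarrow> cube x r \<subseteq> S"
  using cube_subset_open_uniform[OF assms] by (metis centre_in_ball)

section \<open>Affine changes of variables\<close>

lemma pd_affine:
  assumes "p differentiable (at (x + s *\<^sub>R y))"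
  shows "pd v (\<lambda>y. p (x + s *\<^sub>R y)) y = s * pd v p (x + s *\<^sub>R y)"
    "(\<lambda>y. p (x + s *\<^sub>R y)) differentiable (at y)"
proof -
  have "((\<lambda>y. x + s *\<^sub>R y) has_derivative (\<lambda>v. s *\<^sub>R v)) (at y)"
    by (auto intro!: derivative_eq_intros)
  from has_derivative_compose[OF this has_derivative_frechet[OF assms]]
  have d: "((\<lambda>y. p (x + s *\<^sub>R y)) has_derivative (\<lambda>v. pd (s *\<^sub>R v) p (x + s *\<^sub>R y))) (at y)" .
  then show "(\<lambda>y. p (x + s *\<^sub>R y)) differentiable (at y)" by (auto simp: differentiable_def)
  show "pd v (\<lambda>y. p (x + s *\<^sub>R y)) y = s * pd v p (x + s *\<^sub>R y)"
    unfolding pd_eqI[OF d] using linear_cmul[OF has_derivative_linear[OF has_derivative_frechet[OF assms]]] by simp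
qed

lemma open_affine_vimage:
  fixes x :: "'a::real_normed_vector"
  assumes "open S"
  shows "open {y. x + s *\<^sub>R y \<in> S}"
proof -
  have "open ((\<lambda>y. x + s *\<^sub>R y) -` S)"
    by (rule open_vimage[OF assms]) (intro continuous_intros)
  then show ?thesis by (simp add: vimage_def)
qed

lemma Ck_on_affine:
  assumes "open S" "Ck_on k S p"
  shows "Ck_on k {y. x + s *\<^sub>R y \<in> S} (\<lambda>y. p (x + s *\<^sub>R y))"
  using assms(2)
proof (induction k arbitrary: p)
  case 0
  then show ?case by (auto intro!: continuous_on_compose2[of S p] continuous_intros)
next
  case (Suc k)
  let ?T = "{y. x + s *\<^sub>R y \<in> S}"
  have d: "p differentiable (at (x + s *\<^sub>R y))" if "y \<in> ?T" for y using Suc.prems that by auto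
  have "Ck_on k ?T (\<lambda>y. s * pd v p (x + s *\<^sub>R y))" for v
    by (intro Ck_on_cmult open_affine_vimage assms Suc.IH[OF Ck_on_pd[OF Suc.prems]])
  then have "Ck_on k ?T (pd v (\<lambda>y. p (x + s *\<^sub>R y)))" for v
    by (subst Ck_on_cong[OF open_affine_vimage[OF assms(1)] pd_affine(1)[OF d]])
  then show ?case using pd_affine(2)[OF d] by auto
qed

text \<open>The normalizing constant depends on the space only, hence the type argument.\<close>

definition bump_mass :: "'a::euclidean_space itself \<Rightarrow> real" where
  "bump_mass _ = integral (cbox (- One) (One::'a)) (bump 2)"

abbreviation avg_kernel :: "'a::euclidean_space \<Rightarrow> real" where
  "avg_kernel y \<equiv> bump 2 y / bump_mass TYPE('a)"

text \<open>Origin of the constants: the t-derivative of u (x + r t y) is r times the derivative of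
  u in direction y. Since the gradient of \<open>bump 3\<close> is -6 y \<open>bump 2\<close>,
  integrating by parts in y against \<open>bump 2\<close> gives the factor r / 6, and the chain rule
  gives another r t.\<close>

abbreviation pot_kernel :: "real \<Rightarrow> real \<times> 'a::euclidean_space \<Rightarrow> real" where
  "pot_kernel r \<equiv> (\<lambda>(t, y). r\<^sup>2 * t * bump 3 y / (6 * bump_mass TYPE('a)))"

abbreviation pot_shift :: "real \<Rightarrow> real \<times> 'a::euclidean_space \<Rightarrow> 'a" where
  "pot_shift r \<equiv> (\<lambda>(t, y). (r * t) *\<^sub>R y)"

definition avg :: "real \<Rightarrow> ('a::euclidean_space \<Rightarrow> real) \<Rightarrow> 'a \<Rightarrow> real" where
  "avg r = kop (cbox (- One) One) avg_kernel (\<lambda>y. r *\<^sub>R y)"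

text \<open>\<open>pot r\<close> is the potential operator for which \<open>u = avg r u + pot r (- \<Delta> u)\<close>; writing
  it as an integral over \<open>[0, 1]\<close> and the unit ball avoids the singular fundamental solution.\<close>

definition pot :: "real \<Rightarrow> ('a::euclidean_space \<Rightarrow> real) \<Rightarrow> 'a \<Rightarrow> real" where
  "pot r = kop (cbox (0, - One) (1, One)) (pot_kernel r) (pot_shift r)"

lemma pot_box_iff: "(t::real, y) \<in> cbox (0, - One) (1, One) \<longleftrightarrow> 0 \<le> t \<and> t \<le> 1 \<and> y \<in> cbox (- One) One"
  by (simp add: cbox_Pair_eq cbox_interval)

lemma bump_mass_pos: "0 < bump_mass TYPE('a::euclidean_space)"
proof -
  let ?C = "cbox (- One) (One::'a)"
  have c: "continuous_on ?C (bump 2)" by (rule continuous_on_bump)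
  have "0 \<le> integral ?C (bump 2)" by (intro integral_nonneg integrable_continuous c bump_nonneg)
  moreover have "integral ?C (bump 2) \<noteq> 0"
  proof
    assume "integral ?C (bump 2) = 0"
    then have h: "(bump 2 has_integral 0) ?C"
      using integrable_integral[OF integrable_continuous[OF c]] by simp
    have "bump 2 (0::'a) = 0"
      by (rule has_integral_0_cbox_imp_0[OF c bump_nonneg h _ cbox_0]) (use mem_box(1)[of 0] in force)
    then show False by (simp add: bump_def)
  qed
  ultimately show ?thesis by (simp add: bump_mass_def)
qed

section \<open>The two operators as smoothing kernels\<close>

lemma avg_cont: "continuous_on S avg_kernel" "continuous_on S (\<lambda>y. r *\<^sub>R y)"
  using bump_mass_pos by (auto intro!: continuous_intros continuous_on_bump simp: less_le)

lemma avg_kernel_nonneg: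
  fixes y :: "'a::euclidean_space"
  shows "0 \<le> avg_kernel y"
  using bump_mass_pos[where 'a='a] bump_nonneg[of 2 y] by simp

lemma pot_cont:
  "continuous_on S (pot_kernel r :: real \<times> 'a::euclidean_space \<Rightarrow> real)"
  "continuous_on S (pot_shift r :: real \<times> 'a \<Rightarrow> 'a)"
proof -
  have "continuous_on S (\<lambda>x. bump 3 (snd x :: 'a))"
    by (rule continuous_on_compose2[OF continuous_on_bump[of UNIV]]) (auto intro: continuous_intros)
  then show "continuous_on S (pot_kernel r :: real \<times> 'a \<Rightarrow> real)"
    unfolding split_beta using bump_mass_pos[where 'a='a]
    by (intro continuous_intros) auto
  show "continuous_on S (pot_shift r :: real \<times> 'a \<Rightarrow> 'a)"
    unfolding split_beta by (intro continuous_intros)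
qed

lemma pot_kernel_nonneg:
  fixes q :: "real \<times> 'a::euclidean_space"
  shows "q \<in> cbox (0, - One) (1, One) \<Longrightarrow> 0 \<le> pot_kernel r q"
  using bump_mass_pos[where 'a='a]
  by (cases q) (auto simp: pot_box_iff intro!: divide_nonneg_pos mult_nonneg_nonneg bump_nonneg)

lemma pot_shift_cube: "q \<in> cbox (0, - One) (1, One) \<Longrightarrow> x + pot_shift r q \<in> cube x r"
  by (cases q) (auto simp: pot_box_iff intro!: cube_scale)

lemma inner_bump_le: "\<bar>(y \<bullet> v) * bump (Suc m) y\<bar> \<le> norm v"
proof (cases "norm y \<le> 1")
  case True
  have "\<bar>y \<bullet> v\<bar> * bump (Suc m) y \<le> (norm y * norm v) * 1"
    by (intro mult_mono Cauchy_Schwarz_ineq2 bump_le_1 bump_nonneg) simp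
  also have "\<dots> \<le> (1 * norm v) * 1" using True by (intro mult_right_mono) auto
  finally show ?thesis by (simp add: abs_mult bump_nonneg)
next
  case False
  then show ?thesis by (simp add: bump_eq_0)
qed

text \<open>The y-derivative of p (x + r y) is r times that of p, whence 1 / r; the 4 is 2 times the
  exponent of \<open>bump 2\<close>.\<close>

lemma smoothing_avg:
  fixes r :: real
  assumes "r > 0"
  shows "smoothing_kernel (- One) (One::'a::euclidean_space) avg_kernel (\<lambda>y. r *\<^sub>R y)
    (\<lambda>v y. 4 / (r * bump_mass TYPE('a)) * ((y \<bullet> v) * bump 1 y)) (4 / (r * bump_mass TYPE('a)))"
proof
  let ?m = "bump_mass TYPE('a)"
  have m: "?m > 0" by (rule bump_mass_pos)
  show "continuous_on (cbox (- One) One) (\<lambda>y::'a. 4 / (r * ?m) * ((y \<bullet> v) * bump 1 y))" for v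
    by (intro continuous_intros continuous_on_bump)
  show B: "0 \<le> 4 / (r * ?m)" using m assms by simp
  show "\<bar>4 / (r * ?m) * ((y \<bullet> v) * bump 1 y)\<bar> \<le> 4 / (r * ?m) * norm v" for y v :: 'a
    unfolding abs_mult[of "4 / (r * ?m)"] abs_of_nonneg[OF B] One_nat_def
    by (rule mult_left_mono[OF inner_bump_le B])
  show "kop (cbox (- One) One) avg_kernel (\<lambda>y. r *\<^sub>R y) (pd v p) x =
      kop (cbox (- One) One) (\<lambda>y. 4 / (r * ?m) * ((y \<bullet> v) * bump 1 y)) (\<lambda>y. r *\<^sub>R y) p x"
    if p: "real_polynomial_function p" for p :: "'a \<Rightarrow> real" and v x
  proof -
    have pC: "Ck_on 1 UNIV p" by (rule Ck_on_polynomial[OF p])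
    let ?g = "\<lambda>y. p (x + r *\<^sub>R y)"
    have g: "Ck_on 1 UNIV ?g" using Ck_on_affine[OF open_UNIV pC, of x r] by simp
    have pg: "pd v ?g y = r * pd v p (x + r *\<^sub>R y)" for y
      using pC by (intro pd_affine(1)) auto
    have "integral (cbox (- One) One) (\<lambda>y. bump 2 y * pd v ?g y)
        = integral (cbox (- One) One) (\<lambda>y. 4 * (y \<bullet> v) * bump 1 y * ?g y)"
      using integral_bump_by_parts[OF open_UNIV _ g, where j=0] by (simp add: numeral_2_eq_2)
    then have "integral (cbox (- One) One) (\<lambda>y. (1 / (r * ?m)) * (bump 2 y * pd v ?g y))
        = integral (cbox (- One) One) (\<lambda>y. (1 / (r * ?m)) * (4 * (y \<bullet> v) * bump 1 y * ?g y))"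
      by simp
    then show ?thesis
      unfolding kop_def pg using assms by (simp add: mult_ac)
  qed
qed (use avg_cont in auto)

text \<open>The y-derivative of p (x + r t y) carries a factor r t, and the kernel contains exactly
  this factor. It cancels without dividing by t, so the new kernel is independent of t and bounded
  up to t = 0.\<close>

lemma smoothing_pot:
  fixes r :: real
  assumes "r > 0"
  shows "smoothing_kernel (0, - One) (1, One::'a::euclidean_space) (pot_kernel r) (pot_shift r)
    (\<lambda>v (t, y). r / bump_mass TYPE('a) * ((y \<bullet> v) * bump 2 y)) (r / bump_mass TYPE('a))"
proof
  let ?m = "bump_mass TYPE('a)"
  let ?\<kappa>' = "\<lambda>v (t::real, y::'a). r / ?m * ((y \<bullet> v) * bump 2 y)"
  have m: "?m > 0" by (rule bump_mass_pos)
  have "continuous_on S (\<lambda>x. bump 2 (snd x :: 'a))" for S :: "(real \<times> 'a) set"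
    by (rule continuous_on_compose2[OF continuous_on_bump[of UNIV]]) (auto intro: continuous_intros)
  then show ck': "continuous_on (cbox (0, - One) (1, One)) (?\<kappa>' v)" for v
    unfolding split_beta by (intro continuous_intros)
  show B: "0 \<le> r / ?m" using m assms by simp
  show "\<bar>?\<kappa>' v q\<bar> \<le> r / ?m * norm v" for q v
    unfolding split_beta abs_mult[of "r / ?m"] abs_of_nonneg[OF B] numeral_2_eq_2
    by (rule mult_left_mono[OF inner_bump_le B])
  show "kop (cbox (0, - One) (1, One)) (pot_kernel r) (pot_shift r) (pd v p) x =
      kop (cbox (0, - One) (1, One)) (?\<kappa>' v) (pot_shift r) p x"
    if p: "real_polynomial_function p" for p :: "'a \<Rightarrow> real" and v x
  proof -
    have pC: "Ck_on 1 UNIV p" by (rule Ck_on_polynomial[OF p])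
    then have cp: "continuous_on UNIV p" "continuous_on UNIV (pd v p)"
      using Ck_on_continuous_on[OF pC] by auto
    have "integral (cbox (- One) One) (\<lambda>y. pot_kernel r (t, y) * pd v p (x + pot_shift r (t, y)))
        = integral (cbox (- One) One) (\<lambda>y. ?\<kappa>' v (t, y) * p (x + pot_shift r (t, y)))" for t
    proof -
      let ?g = "\<lambda>y. p (x + (r * t) *\<^sub>R y)"
      have g: "Ck_on 1 UNIV ?g" using Ck_on_affine[OF open_UNIV pC, of x "r * t"] by simp
      have pg: "pd v ?g y = r * t * pd v p (x + (r * t) *\<^sub>R y)" for y
        using pC by (intro pd_affine(1)) auto
      have "integral (cbox (- One) One) (\<lambda>y. bump 3 y * pd v ?g y)
          = integral (cbox (- One) One) (\<lambda>y. 6 * (y \<bullet> v) * bump 2 y * ?g y)"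
        using integral_bump_by_parts[OF open_UNIV _ g, where j=1] by (simp add: numeral_3_eq_3 numeral_2_eq_2)
      then have "integral (cbox (- One) One) (\<lambda>y. (r / (6 * ?m)) * (bump 3 y * pd v ?g y))
          = integral (cbox (- One) One) (\<lambda>y. (r / (6 * ?m)) * (6 * (y \<bullet> v) * bump 2 y * ?g y))"
        by (simp only: integral_mult_right)
      moreover have "(r / (6 * ?m)) * (bump 3 y * pd v ?g y)
          = pot_kernel r (t, y) * pd v p (x + pot_shift r (t, y))" for y
        unfolding pg by (simp add: power2_eq_square)
      moreover have "(r / (6 * ?m)) * (6 * (y \<bullet> v) * bump 2 y * ?g y)
          = ?\<kappa>' v (t, y) * p (x + pot_shift r (t, y))" for y
        by simp
      ultimately show ?thesis by (simp only:)
    qed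
    then show ?thesis
      unfolding kop_def
        integral_prod_continuous[OF kop_integrand_continuous[OF pot_cont cp(2) UNIV_I]]
        integral_prod_continuous[OF kop_integrand_continuous[OF ck' pot_cont(2) cp(1) UNIV_I]]
      by (simp only:)
  qed
qed (use pot_cont in auto)

section \<open>Order and linearity properties of the two operators\<close>

lemma avg_const: "avg r (\<lambda>_. c) x = c" for x :: "'a::euclidean_space"
proof -
  have "avg r (\<lambda>_. c) x = (c / bump_mass TYPE('a)) * integral (cbox (- One) One) (bump 2 :: 'a \<Rightarrow> real)"
    unfolding avg_def kop_def integral_mult_right[symmetric] by (simp add: mult_ac)
  then show ?thesis using bump_mass_pos[where 'a='a] by (simp add: bump_mass_def)
qed

lemma avg_mono:
  assumes "continuous_on (cube x r) w" "continuous_on (cube x r) w'" "\<And>y. y \<in> cube x r \<Longrightarrow> w y \<le> w' y"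
  shows "avg r w x \<le> avg r w' x"
  unfolding avg_def
  by (rule kop_mono[OF avg_cont assms(1,2)]) (auto intro: cubeI assms(3) avg_kernel_nonneg)

lemma pot_mono:
  assumes "continuous_on (cube x r) w" "continuous_on (cube x r) w'" "\<And>y. y \<in> cube x r \<Longrightarrow> w y \<le> w' y"
  shows "pot r w x \<le> pot r w' x"
  unfolding pot_def
  by (rule kop_mono[OF pot_cont assms(1,2) pot_shift_cube pot_kernel_nonneg assms(3)[OF pot_shift_cube]])

lemma avg_add:
  assumes "continuous_on (cube x r) w" "continuous_on (cube x r) w'"
  shows "avg r (\<lambda>y. w y + w' y) x = avg r w x + avg r w' x"
  unfolding avg_def by (rule kop_add[OF avg_cont assms]) (rule cubeI)

lemma avg_diff:
  assumes "continuous_on (cube x r) w" "continuous_on (cube x r) w'"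
  shows "avg r (\<lambda>y. w y - w' y) x = avg r w x - avg r w' x"
  unfolding avg_def by (rule kop_diff[OF avg_cont assms]) (rule cubeI)

lemma pot_diff:
  assumes "continuous_on (cube x r) w" "continuous_on (cube x r) w'"
  shows "pot r (\<lambda>y. w y - w' y) x = pot r w x - pot r w' x"
  unfolding pot_def by (rule kop_diff[OF pot_cont assms]) (rule pot_shift_cube)

lemma avg_cmult: "avg r (\<lambda>y. c * w y) x = c * avg r w x"
  unfolding avg_def by (rule kop_cmult)

lemma pot_cmult: "pot r (\<lambda>y. c * w y) x = c * pot r w x"
  unfolding pot_def by (rule kop_cmult)

lemma avg_cong: "(\<And>y. y \<in> cube x r \<Longrightarrow> w y = w' y) \<Longrightarrow> avg r w x = avg r w' x"
  unfolding avg_def by (rule kop_cong) (simp add: cubeI)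

lemma pot_pos:
  fixes x :: "'a::euclidean_space"
  assumes "r > 0" "continuous_on (cube x r) w" "\<And>y. y \<in> cube x r \<Longrightarrow> 0 < w y"
  shows "0 < pot r w x"
proof -
  let ?C = "cbox (0, - One) (1, One::'a)"
  let ?h = "\<lambda>q. pot_kernel r q * w (x + pot_shift r q)"
  have c: "continuous_on ?C ?h"
    by (rule kop_integrand_continuous[OF pot_cont assms(2) pot_shift_cube])
  have nn: "0 \<le> ?h q" if "q \<in> ?C" for q
    using pot_kernel_nonneg[OF that] assms(3)[OF pot_shift_cube[OF that]] by (intro mult_nonneg_nonneg) auto
  have "0 \<le> integral ?C ?h" by (intro integral_nonneg integrable_continuous c nn)
  moreover have "integral ?C ?h \<noteq> 0"
  proof
    assume "integral ?C ?h = 0"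
    then have h: "(?h has_integral 0) ?C"
      using integrable_integral[OF integrable_continuous[OF c]] by simp
    have ne: "box (0::real, - One) (1, One::'a) \<noteq> {}"
      by (auto simp: box_ne_empty Basis_prod_def)
    have nn': "0 \<le> ?h q" if "q \<in> box (0, - One) (1, One::'a)" for q
      using nn that box_subset_cbox by blast
    \<comment> \<open>A nonnegative continuous integrand with zero integral vanishes on the closed
      box. At t = 1, y = 0 the kernel is r^2 / (6 mass) > 0 and \<open>w\<close> is taken at the
      centre.\<close>
    have "?h (1, 0) = 0"
      by (rule has_integral_0_cbox_imp_0[OF c nn' h ne]) (simp_all add: pot_box_iff cbox_0)
    then show False
      using assms(1) assms(3)[of x] center_in_cube[of x r] bump_mass_pos[where 'a='a] by (auto simp: bump_def)
  qed
  ultimately show ?thesis by (simp add: pot_def kop_def)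
qed

text \<open>The fundamental theorem of calculus along the rays t -> x + r t y gives u (x + r y) - u
  x as an integral of first derivatives. Weighting with \<open>bump 2\<close>, exchanging the
  integrals and integrating by parts in y turns these into the Laplacian.\<close>

theorem avg_pot_representation:
  fixes u :: "'a::euclidean_space \<Rightarrow> real"
  assumes S: "open S" and u: "Ck_on 2 S u" and r: "r > 0" and xS: "cube x r \<subseteq> S"
  shows "u x = avg r u x + pot r (\<lambda>y. - laplacian u y) x"
proof -
  let ?C = "cbox (- One) (One::'a)"
  let ?m = "bump_mass TYPE('a)"
  have m: "?m > 0" by (rule bump_mass_pos)
  have u2: "Ck_on (Suc (Suc 0)) S u" using u by (simp add: numeral_2_eq_2)
  have cu: "continuous_on S u" by (rule Ck_on_continuous_on[OF u])
  have ud: "u differentiable (at z)" if "z \<in> S" for z using u2 that by auto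
  have cpd: "continuous_on S (pd v u)" for v using Ck_on_continuous_on[OF Ck_on_pd[OF u2]] .
  have zS: "x + (r * t) *\<^sub>R y \<in> S" if "t \<in> {0..1}" "y \<in> ?C" for t y
    using cube_scale[OF that(2)] that(1) xS by auto
  have pdy: "pd y u z = (\<Sum>i\<in>Basis. (y \<bullet> i) * pd i u z)" if "z \<in> S" for y z
    by (rule pd_as_sum[OF ud[OF that]])
  define \<Phi> where "\<Phi> t y = bump 2 y * (r * (\<Sum>i\<in>Basis. (y \<bullet> i) * pd i u (x + (r * t) *\<^sub>R y)))" for t y
  have c\<Phi>: "continuous_on (cbox (0, - One) (1, One)) (\<lambda>(t, y). \<Phi> t y)"
    unfolding \<Phi>_def split_beta
    by (intro continuous_intros continuous_on_compose2[OF continuous_on_bump[of UNIV]]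
        continuous_on_compose2[OF cpd]) (auto simp: pot_box_iff intro!: zS)
  have FTC: "integral (cbox 0 1) (\<lambda>t. \<Phi> t y) = bump 2 y * (u (x + r *\<^sub>R y) - u x)" if y: "y \<in> ?C" for y
  proof -
    have "((\<lambda>t. bump 2 y * u (x + (r * t) *\<^sub>R y)) has_vector_derivative \<Phi> t y) (at t within {0..1})"
      if t: "t \<in> {0..1}" for t
    proof -
      have "((\<lambda>t. x + (r * t) *\<^sub>R y) has_derivative (\<lambda>s. (r * s) *\<^sub>R y)) (at t)"
        by (auto intro!: derivative_eq_intros)
      from has_derivative_compose[OF this has_derivative_frechet[OF ud[OF zS[OF t y]]]]
      have "((\<lambda>t. bump 2 y * u (x + (r * t) *\<^sub>R y)) has_derivative
          (\<lambda>s. bump 2 y * pd ((r * s) *\<^sub>R y) u (x + (r * t) *\<^sub>R y))) (at t)"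
        by (rule has_derivative_mult_right)
      moreover have "bump 2 y * pd ((r * s) *\<^sub>R y) u (x + (r * t) *\<^sub>R y) = s *\<^sub>R \<Phi> t y" for s
        unfolding \<Phi>_def
        using linear_cmul[OF has_derivative_linear[OF has_derivative_frechet[OF ud[OF zS[OF t y]]]], of "r * s" y]
          pdy[OF zS[OF t y], of y] by simp
      ultimately show ?thesis
        by (simp add: has_vector_derivative_def has_derivative_at_withinI)
    qed
    from fundamental_theorem_of_calculus[OF zero_le_one this] show ?thesis
      by (auto dest!: integral_unique simp: right_diff_distrib cbox_interval)
  qed
  \<comment> \<open>In each coordinate direction \<open>bump 2\<close> times y is, up to the factor
    -6, a derivative of \<open>bump 3\<close>; summing over the basis assembles the
    Laplacian.\<close>
  have IBP: "integral ?C (\<Phi> t)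
      = integral ?C (\<lambda>y. r\<^sup>2 * t * bump 3 y / 6 * laplacian u (x + (r * t) *\<^sub>R y))" if t: "t \<in> {0..1}" for t
  proof -
    let ?T = "{y. x + (r * t) *\<^sub>R y \<in> S}"
    have T: "open ?T" "cball 0 1 \<subseteq> ?T"
      using open_affine_vimage[OF S] zS[OF t norm_le_1_in_cbox] by auto
    have yT: "y \<in> ?T" if "y \<in> ?C" for y using zS[OF t that] by simp
    have cg: "continuous_on ?C (\<lambda>y. pd i u (x + (r * t) *\<^sub>R y))" for i
      by (rule continuous_on_compose2[OF cpd]) (auto intro!: continuous_intros zS t)
    have cgg: "continuous_on ?C (\<lambda>y. pd i (pd i u) (x + (r * t) *\<^sub>R y))" for i
      by (rule continuous_on_compose2[OF Ck_on_continuous_on[OF Ck_on_pd[OF Ck_on_pd[OF u2]]]])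
        (auto intro!: continuous_intros zS t)
    have i: "integral ?C (\<lambda>y. bump 2 y * (r * ((y \<bullet> i) * pd i u (x + (r * t) *\<^sub>R y))))
        = integral ?C (\<lambda>y. r\<^sup>2 * t * bump 3 y / 6 * pd i (pd i u) (x + (r * t) *\<^sub>R y))" for i
    proof -
      let ?g = "\<lambda>y. pd i u (x + (r * t) *\<^sub>R y)"
      have "Ck_on 1 S (pd i u)" using Ck_on_pd[OF u2] by simp
      then have g: "Ck_on 1 ?T ?g" by (rule Ck_on_affine[OF S])
      have pg: "pd i ?g y = r * t * pd i (pd i u) (x + (r * t) *\<^sub>R y)" if "y \<in> ?C" for y
        using u2 zS[OF t that] by (intro pd_affine(1)) auto
      have "integral ?C (\<lambda>y. bump 3 y * (r * t * pd i (pd i u) (x + (r * t) *\<^sub>R y)))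
          = integral ?C (\<lambda>y. bump 3 y * pd i ?g y)"
        by (intro integral_cong) (simp add: pg)
      also have "\<dots> = integral ?C (\<lambda>y. 6 * (y \<bullet> i) * bump 2 y * ?g y)"
        using integral_bump_by_parts[OF T g, where j=1] by (simp add: numeral_3_eq_3 numeral_2_eq_2)
      finally have "(r / 6) * integral ?C (\<lambda>y. bump 3 y * (r * t * pd i (pd i u) (x + (r * t) *\<^sub>R y)))
          = (r / 6) * integral ?C (\<lambda>y. 6 * (y \<bullet> i) * bump 2 y * ?g y)" by simp
      then show ?thesis
        unfolding integral_mult_right[symmetric] by (auto simp: mult_ac power2_eq_square)
    qed
    have "integral ?C (\<Phi> t)
        = (\<Sum>i\<in>Basis. integral ?C (\<lambda>y. bump 2 y * (r * ((y \<bullet> i) * pd i u (x + (r * t) *\<^sub>R y)))))"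
      unfolding \<Phi>_def sum_distrib_left
      by (intro integral_sum integrable_continuous continuous_intros continuous_on_bump cg) auto
    also have "\<dots> = (\<Sum>i\<in>Basis. integral ?C (\<lambda>y. r\<^sup>2 * t * bump 3 y / 6 * pd i (pd i u) (x + (r * t) *\<^sub>R y)))"
      by (simp only: i)
    also have "\<dots> = integral ?C (\<lambda>y. r\<^sup>2 * t * bump 3 y / 6 * laplacian u (x + (r * t) *\<^sub>R y))"
      unfolding laplacian_def sum_distrib_left
      by (intro integral_sum[symmetric] integrable_continuous continuous_intros continuous_on_bump cgg) auto
    finally show ?thesis .
  qed
  have cbu: "continuous_on ?C (\<lambda>y. u (x + r *\<^sub>R y))"
    by (rule continuous_on_compose2[OF cu]) (use zS[of 1] in \<open>auto intro!: continuous_intros\<close>)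
  have "?m * (avg r u x - u x) = integral ?C (\<lambda>y. bump 2 y * u (x + r *\<^sub>R y)) - integral ?C (\<lambda>y. bump 2 y * u x)"
    using m by (simp add: avg_def kop_def right_diff_distrib bump_mass_def)
  also have "\<dots> = integral ?C (\<lambda>y. bump 2 y * (u (x + r *\<^sub>R y) - u x))"
    unfolding right_diff_distrib
    by (intro integral_diff[symmetric] integrable_continuous continuous_intros continuous_on_bump cbu)
  also have "\<dots> = integral ?C (\<lambda>y. integral (cbox 0 1) (\<lambda>t. \<Phi> t y))"
    by (intro integral_cong) (simp only: FTC)
  also have "\<dots> = integral (cbox 0 1) (\<lambda>t. integral ?C (\<Phi> t))"
    using integral_swap_continuous[OF c\<Phi>] by simp
  also have "\<dots> = integral (cbox 0 1) (\<lambda>t. integral ?C (\<lambda>y. r\<^sup>2 * t * bump 3 y / 6 * laplacian u (x + (r * t) *\<^sub>R y)))"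
    by (rule integral_cong) (simp only: IBP cbox_interval)
  also have "\<dots> = ?m * integral (cbox 0 1) (\<lambda>t. integral ?C (\<lambda>y. pot_kernel r (t, y) * laplacian u (x + pot_shift r (t, y))))"
    unfolding integral_mult_right[symmetric] using m by (simp add: mult_ac)
  also have "integral (cbox 0 1) (\<lambda>t. integral ?C (\<lambda>y. pot_kernel r (t, y) * laplacian u (x + pot_shift r (t, y))))
      = pot r (laplacian u) x"
    unfolding pot_def kop_def
    by (rule integral_prod_continuous[symmetric], rule kop_integrand_continuous[OF pot_cont])
      (use continuous_on_laplacian[OF S u] pot_shift_cube xS in blast)+
  finally have "avg r u x - u x = pot r (laplacian u) x" using m by simp
  moreover have "pot r (\<lambda>y. - laplacian u y) x = - pot r (laplacian u) x"
    using pot_cmult[of r "-1" "laplacian u" x] by simp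
  ultimately show ?thesis by simp
qed

section \<open>The maximum principle\<close>

lemma polynomial_inner_self: "real_polynomial_function (\<lambda>x::'a::euclidean_space. x \<bullet> x)"
proof -
  have "real_polynomial_function (\<lambda>x::'a. \<Sum>i\<in>Basis. (x \<bullet> i) * (x \<bullet> i))"
    by (intro real_polynomial_function_sum real_polynomial_function.intros(4)
        real_polynomial_function.intros(1) bounded_linear_inner_left) auto
  then show ?thesis by (simp add: euclidean_inner[symmetric])
qed

lemma pd_inner_self: "pd v (\<lambda>x. x \<bullet> x) x = 2 * (x \<bullet> v)"
  by (rule pd_eqI) (auto intro!: derivative_eq_intros simp: inner_commute)

lemma inner_left_differentiable: "(\<lambda>x. x \<bullet> e) differentiable (at x)"
  by (intro bounded_linear_imp_differentiable bounded_linear_inner_left)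

lemma pd_inner_left: "pd v (\<lambda>x. x \<bullet> e) x = v \<bullet> e"
  by (rule pd_eqI) (auto intro!: derivative_eq_intros)

lemma laplacian_inner_self: "laplacian (\<lambda>x::'a. x \<bullet> x) x = 2 * DIM('a::euclidean_space)"
proof -
  have "pd i (pd i (\<lambda>x::'a. x \<bullet> x)) x = 2" if "i \<in> Basis" for i :: 'a
    unfolding pd_inner_self using that
    by (subst pd_cmult) (auto simp: pd_inner_left inner_left_differentiable)
  then show ?thesis by (simp add: laplacian_def)
qed

lemma eventually_cube_subset:
  assumes "open S" "x \<in> S"
  shows "\<forall>\<^sub>F r in at_right 0. cube x r \<subseteq> S"
proof -
  obtain r0 where "0 < r0" "\<And>r. 0 \<le> r \<Longrightarrow> r \<le> r0 \<Longrightarrow> cube x r \<subseteq> S"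
    using cube_subset_open[OF assms] by metis
  then show ?thesis
    unfolding eventually_at_right_field by (metis less_imp_le)
qed

text \<open>|x|^2 has Laplacian 2 N > 0, so its potential term is negative; this supplies the
  strictness in the maximum principle.\<close>

lemma avg_inner_self_gt:
  fixes x :: "'a::euclidean_space"
  assumes "r > 0" shows "x \<bullet> x < avg r (\<lambda>x. x \<bullet> x) x"
proof -
  have "x \<bullet> x = avg r (\<lambda>x. x \<bullet> x) x + pot r (\<lambda>y. - laplacian (\<lambda>x. x \<bullet> x) y) x"
    by (rule avg_pot_representation[OF open_UNIV _ assms])
      (auto intro: Ck_on_polynomial polynomial_inner_self)
  also have "(\<lambda>y::'a. - laplacian (\<lambda>x. x \<bullet> x) y) = (\<lambda>y. (- 2 * real DIM('a)) * 1)"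
    by (simp add: laplacian_inner_self)
  also have "pot r (\<lambda>y. (- 2 * real DIM('a)) * 1) x = (- 2 * real DIM('a)) * pot r (\<lambda>y. 1) x"
    by (rule pot_cmult)
  also have "\<dots> < 0"
    using pot_pos[OF assms, of x "\<lambda>_. 1"] by (simp add: mult_less_0_iff)
  finally show ?thesis by simp
qed

text \<open>\<open>d\<close> is only continuous, so no second derivative test applies. A small
  multiple of |x|^2 makes the submean inequality strict, which is impossible at an interior maximum,
  where the average cannot exceed the value.\<close>

theorem maximum_principle:
  fixes S :: "'a::euclidean_space set"
  assumes S: "open S" "bounded S" and d: "continuous_on (closure S) d"
    and bd: "\<And>x. x \<in> frontier S \<Longrightarrow> d x \<le> 0"
    and sub: "\<And>x. x \<in> S \<Longrightarrow> \<forall>\<^sub>F r in at_right 0. d x \<le> avg r d x"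
    and x1: "x1 \<in> S"
  shows "d x1 \<le> 0"
proof (rule ccontr)
  assume "\<not> d x1 \<le> 0"
  then have pos: "d x1 > 0" by simp
  have comp: "compact (closure S)" using S by simp
  obtain R0 where R0: "\<forall>x\<in>closure S. norm x \<le> R0"
    using compact_imp_bounded[OF comp] bounded_iff by blast
  define R where "R = R0\<^sup>2 + 1"
  have R: "x \<bullet> x \<le> R" if "x \<in> closure S" for x
    using R0 that power_mono[of "norm x" R0 2] by (auto simp: R_def dot_square_norm)
  have Rpos: "R > 0" by (simp add: R_def add_nonneg_pos)
  \<comment> \<open>With this choice the perturbation is at most epsilon * R = d x1 / 2 on the
    closure, so the perturbed maximum cannot sit on the boundary, where \<open>d\<close> is at most
    0.\<close>
  define \<epsilon> where "\<epsilon> = d x1 / (2 * R)"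
  have \<epsilon>: "\<epsilon> > 0" using pos Rpos by (simp add: \<epsilon>_def)
  define h where "h x = d x + \<epsilon> * (x \<bullet> x)" for x
  have ch: "continuous_on (closure S) h"
    unfolding h_def by (intro continuous_intros d)
  obtain x0 where x0: "x0 \<in> closure S" "\<And>y. y \<in> closure S \<Longrightarrow> h y \<le> h x0"
    using continuous_attains_sup[OF comp _ ch] x1 closure_subset by blast
  have "x0 \<in> S"
  proof (rule ccontr)
    assume "x0 \<notin> S"
    then have "x0 \<in> frontier S" using x0(1) S(1) by (simp add: frontier_def interior_open)
    then have "h x0 \<le> \<epsilon> * R"
      using add_mono[OF bd mult_left_mono[OF R[OF x0(1)], of \<epsilon>]] \<epsilon> by (simp add: h_def)
    also have "\<dots> < d x1" using pos Rpos by (simp add: \<epsilon>_def)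
    also have "\<dots> \<le> h x1" using \<epsilon> by (simp add: h_def)
    also have "\<dots> \<le> h x0" using x0(2) x1 closure_subset by blast
    finally show False by simp
  qed
  have "\<forall>\<^sub>F r in at_right 0. d x0 \<le> avg r d x0 \<and> cube x0 r \<subseteq> S \<and> 0 < r"
    by (intro eventually_conj sub[OF \<open>x0 \<in> S\<close>] eventually_cube_subset[OF S(1) \<open>x0 \<in> S\<close>]
        eventually_at_right_less)
  then obtain r where r: "d x0 \<le> avg r d x0" "cube x0 r \<subseteq> S" "0 < r"
    using eventually_happens trivial_limit_at_right_real by blast
  then have rc: "cube x0 r \<subseteq> closure S" using closure_subset by blast
  have cd: "continuous_on (cube x0 r) d" using d rc continuous_on_subset by blast
  have "h x0 < avg r d x0 + \<epsilon> * avg r (\<lambda>x. x \<bullet> x) x0"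
    using r(1) avg_inner_self_gt[OF r(3), of x0] \<epsilon> unfolding h_def
    by (intro add_le_less_mono mult_strict_left_mono)
  also have "\<dots> = avg r h x0"
    unfolding h_def avg_cmult[symmetric]
    by (rule avg_add[symmetric]) (intro continuous_intros cd)+
  also have "\<dots> \<le> avg r (\<lambda>_. h x0) x0"
    using rc x0(2) by (intro avg_mono continuous_on_subset[OF ch]) auto
  also have "\<dots> = h x0" by (rule avg_const)
  finally show False by simp
qed

lemma maximum_principle_classical:
  fixes S :: "'a::euclidean_space set"
  assumes S: "open S" "bounded S" and d: "continuous_on (closure S) d" "Ck_on 2 S d"
    and bd: "\<And>x. x \<in> frontier S \<Longrightarrow> d x \<le> 0"
    and sub: "\<And>x. x \<in> S \<Longrightarrow> 0 \<le> laplacian d x"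
    and x1: "x1 \<in> S"
  shows "d x1 \<le> 0"
proof (rule maximum_principle[OF S d(1) bd _ x1])
  fix x assume x: "x \<in> S"
  show "\<forall>\<^sub>F r in at_right 0. d x \<le> avg r d x"
    using eventually_cube_subset[OF S(1) x] eventually_at_right_less[of 0]
  proof eventually_elim
    case (elim r)
    have c: "continuous_on (cube x r) (laplacian d)"
      using continuous_on_laplacian[OF S(1) d(2)] elim(1) continuous_on_subset by blast
    have "pot r (\<lambda>y. - laplacian d y) x \<le> pot r (\<lambda>y. 0 * 1) x"
      using elim(1) sub by (intro pot_mono continuous_intros c) auto
    also have "\<dots> = 0" using pot_cmult[of r 0 "\<lambda>_. 1" x] by simp
    finally show ?case
      using avg_pot_representation[OF S(1) d(2) elim(2,1)] by simp
  qed
qed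

section \<open>Harmonic polynomials\<close>

lemma polynomial_differentiable:
  "real_polynomial_function p \<Longrightarrow> p differentiable (at x)" for p :: "'a::euclidean_space \<Rightarrow> real"
  by (rule Ck_on_differentiable[OF Ck_on_polynomial UNIV_I])

lemma polynomial_pd:
  fixes p :: "'a::euclidean_space \<Rightarrow> real"
  assumes "real_polynomial_function p" shows "real_polynomial_function (pd v p)"
  using assms
proof induction
  case (linear f)
  have "pd v f = (\<lambda>x. f v)"
    using pd_eqI[OF bounded_linear_imp_has_derivative[OF linear]] by auto
  then show ?case by auto
next
  case (add f g)
  have "pd v (\<lambda>x. f x + g x) = (\<lambda>x. pd v f x + pd v g x)"
    using add by (auto intro!: pd_add polynomial_differentiable)
  then show ?case using add by auto
next
  case (mult f g)
  have "pd v (\<lambda>x. f x * g x) = (\<lambda>x. f x * pd v g x + pd v f x * g x)"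
    using mult by (auto intro!: pd_mult polynomial_differentiable)
  then show ?case using mult by auto
qed auto

lemma polynomial_pd_commute:
  fixes p :: "'a::euclidean_space \<Rightarrow> real"
  assumes "real_polynomial_function p" shows "pd v (pd w p) = pd w (pd v p)"
  using assms
proof induction
  case (linear f)
  have "pd v f = (\<lambda>x. f v)" for v
    using pd_eqI[OF bounded_linear_imp_has_derivative[OF linear]] by auto
  then show ?case by auto
next
  case (add f g)
  note d = polynomial_differentiable
  have e: "pd v (\<lambda>x. f x + g x) = (\<lambda>x. pd v f x + pd v g x)" for v
    using add by (auto intro!: pd_add d)
  have "pd v (\<lambda>x. pd w f x + pd w g x) = (\<lambda>x. pd v (pd w f) x + pd v (pd w g) x)" for v w
    using add by (auto intro!: pd_add d polynomial_pd)
  then show ?case unfolding e using add.IH[THEN fun_cong] by simp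
next
  case (mult f g)
  note d = polynomial_differentiable
  have e: "pd v (\<lambda>x. f x * g x) = (\<lambda>x. f x * pd v g x + pd v f x * g x)" for v
    using mult by (auto intro!: pd_mult d)
  have "pd v (\<lambda>x. f x * pd w g x + pd w f x * g x)
      = (\<lambda>x. (f x * pd v (pd w g) x + pd v f x * pd w g x) + (pd w f x * pd v g x + pd v (pd w f) x * g x))" for v w
    using mult
    by (intro ext, subst pd_add, (auto intro!: d polynomial_pd)[2],
        subst pd_mult, (auto intro!: d polynomial_pd)[2],
        subst pd_mult, (auto intro!: d polynomial_pd)[2]) simp
  then show ?case unfolding e using mult.IH[THEN fun_cong] by (simp add: algebra_simps)
qed auto

lemma pd_sum:
  "(\<And>i. i \<in> I \<Longrightarrow> g i differentiable (at x)) \<Longrightarrow> pd v (\<lambda>x. \<Sum>i\<in>I. g i x) x = (\<Sum>i\<in>I. pd v (g i) x)"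
  by (intro pd_eqI has_derivative_sum has_derivative_frechet)

text \<open>Homogeneity is expressed by Euler's identity.\<close>

definition homogeneous_harmonic :: "nat \<Rightarrow> ('a::euclidean_space \<Rightarrow> real) \<Rightarrow> bool" where
  "homogeneous_harmonic k h \<longleftrightarrow>
     real_polynomial_function h \<and> (\<forall>x. laplacian h x = 0) \<and> (\<forall>x. pd x h x = k * h x)"

text \<open>Euler's identity of degree 0 at t x says that t times the radial derivative vanishes;
  the mean value theorem on [0, 1] provides a point with t > 0.\<close>

lemma homogeneous_harmonic_0_const:
  assumes "homogeneous_harmonic 0 h" shows "h x = h 0"
proof -
  have hd: "h differentiable (at y)" for y
    using assms by (simp add: homogeneous_harmonic_def polynomial_differentiable)
  have der: "((\<lambda>t. h (t *\<^sub>R x)) has_real_derivative pd x h (t *\<^sub>R x)) (at t)" for t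
  proof -
    have "((\<lambda>t. t *\<^sub>R x) has_derivative (\<lambda>s. s *\<^sub>R x)) (at t)"
      by (auto intro!: derivative_eq_intros)
    from has_derivative_compose[OF this has_derivative_frechet[OF hd]]
    have "((\<lambda>t. h (t *\<^sub>R x)) has_derivative (\<lambda>s. pd (s *\<^sub>R x) h (t *\<^sub>R x))) (at t)" .
    moreover have "pd (s *\<^sub>R x) h (t *\<^sub>R x) = pd x h (t *\<^sub>R x) * s" for s
      using linear_cmul[OF has_derivative_linear[OF has_derivative_frechet[OF hd]]] by simp
    ultimately show ?thesis by (simp add: has_field_derivative_def)
  qed
  obtain z where z: "0 < z" "h (1 *\<^sub>R x) - h (0 *\<^sub>R x) = (1 - 0) * pd x h (z *\<^sub>R x)"
    using MVT2[of 0 1 "\<lambda>t. h (t *\<^sub>R x)" "\<lambda>t. pd x h (t *\<^sub>R x)"] der by auto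
  have "z * pd x h (z *\<^sub>R x) = pd (z *\<^sub>R x) h (z *\<^sub>R x)"
    using linear_cmul[OF has_derivative_linear[OF has_derivative_frechet[OF hd]]] by simp
  also have "\<dots> = 0" using assms by (simp add: homogeneous_harmonic_def)
  finally show ?thesis using z by simp
qed

text \<open>The truncated subtraction is harmless: for k = 0 the polynomial is constant and its
  derivative is 0, which is homogeneous of every degree. Otherwise Euler's identity is
  differentiated.\<close>

lemma homogeneous_harmonic_pd:
  assumes "homogeneous_harmonic k h" shows "homogeneous_harmonic (k - 1) (pd e h)"
proof -
  note d = polynomial_differentiable
  have h: "real_polynomial_function h" "\<And>x. laplacian h x = 0" "\<And>x. pd x h x = k * h x"
    using assms by (auto simp: homogeneous_harmonic_def)
  note rp = polynomial_pd[OF h(1)]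
  show ?thesis
  proof (cases "k = 0")
    case True
    then have "h = (\<lambda>x. h 0)" using homogeneous_harmonic_0_const assms by blast
    then have "pd e h = (\<lambda>x. 0)" by (metis frechet_derivative_const)
    then show ?thesis
      using real_polynomial_function.intros(2)[of "0::real"]
      by (simp add: True homogeneous_harmonic_def laplacian_def)
  next
    case False
    have "laplacian (pd e h) x = 0" for x
    proof -
      have "pd i (pd i (pd e h)) x = pd e (pd i (pd i h)) x" for i
        by (rule trans[OF arg_cong[where f="\<lambda>g. pd i g x", OF polynomial_pd_commute[OF h(1)]]
              fun_cong[OF polynomial_pd_commute[OF rp]]])
      then have "laplacian (pd e h) x = (\<Sum>i\<in>Basis. pd e (pd i (pd i h)) x)"
        unfolding laplacian_def by (simp only:)
      also have "\<dots> = pd e (laplacian h) x"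
        unfolding laplacian_def[abs_def]
        by (intro pd_sum[symmetric] d polynomial_pd h)
      also have "laplacian h = (\<lambda>x. 0)" using h(2) by auto
      finally show ?thesis by simp
    qed
    moreover have "pd x (pd e h) x = real (k - 1) * pd e h x" for x
    proof -
      have "k * pd e h x = pd e (\<lambda>x. k * h x) x"
        by (rule pd_cmult[symmetric]) (rule d[OF h(1)])
      also have "(\<lambda>x. k * h x) = (\<lambda>x. \<Sum>i\<in>Basis. (x \<bullet> i) * pd i h x)"
        using pd_as_sum[OF d[OF h(1)]] h(3) by metis
      also have "pd e (\<lambda>x. \<Sum>i\<in>Basis. (x \<bullet> i) * pd i h x) x
          = (\<Sum>i\<in>Basis. pd e (\<lambda>x. (x \<bullet> i) * pd i h x) x)"
        by (intro pd_sum d real_polynomial_function.intros(4) rp real_polynomial_function.intros(1)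
            bounded_linear_inner_left)
      also have "\<dots> = (\<Sum>i\<in>Basis. (x \<bullet> i) * pd i (pd e h) x + (e \<bullet> i) * pd i h x)"
      proof (rule sum.cong[OF refl])
        fix i
        have "pd e (\<lambda>x. (x \<bullet> i) * pd i h x) x = (x \<bullet> i) * pd e (pd i h) x + pd e (\<lambda>x. x \<bullet> i) x * pd i h x"
          by (rule pd_mult[OF inner_left_differentiable d[OF rp]])
        also have "pd e (pd i h) x = pd i (pd e h) x"
          by (rule fun_cong[OF polynomial_pd_commute[OF h(1)]])
        finally show "pd e (\<lambda>x. (x \<bullet> i) * pd i h x) x = (x \<bullet> i) * pd i (pd e h) x + (e \<bullet> i) * pd i h x"
          by (simp only: pd_inner_left)
      qed
      also have "\<dots> = pd x (pd e h) x + pd e h x"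
        unfolding sum.distrib using pd_as_sum[where x=x and v=x, OF d[OF rp[of e]]] pd_as_sum[where x=x and v=e, OF d[OF h(1)]] by simp
      finally show ?thesis using False by (simp add: of_nat_diff algebra_simps)
    qed
    ultimately show ?thesis using rp by (simp add: homogeneous_harmonic_def)
  qed
qed

lemma laplacian_inner_self_mult:
  fixes q :: "'a::euclidean_space \<Rightarrow> real"
  assumes "real_polynomial_function q"
  shows "laplacian (\<lambda>x. (x \<bullet> x) * q x) x
    = (x \<bullet> x) * laplacian q x + 2 * DIM('a) * q x + 4 * pd x q x"
proof -
  have "pd x q x = (\<Sum>i\<in>Basis. (x \<bullet> i) * pd i q x)"
    by (rule pd_as_sum[OF polynomial_differentiable[OF assms]])
  then show ?thesis
    unfolding laplacian_mult[OF open_UNIV UNIV_I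
        Ck_on_polynomial[OF polynomial_inner_self]
        Ck_on_polynomial[OF assms]] laplacian_inner_self pd_inner_self
    by (simp add: sum_distrib_left mult_ac)
qed

text \<open>Multiplication by a coordinate destroys harmonicity: the Laplacian of x_e h is twice the
  e-derivative of h. A multiple of |x|^2 times that derivative has the same degree and corrects the
  defect.\<close>

lemma homogeneous_harmonic_coordinate:
  fixes h :: "'a::euclidean_space \<Rightarrow> real"
  assumes "homogeneous_harmonic k h" and e: "e \<in> Basis"
  obtains c where "homogeneous_harmonic (k + 1) (\<lambda>x. (x \<bullet> e) * h x - c * ((x \<bullet> x) * pd e h x))"
proof -
  note d = polynomial_differentiable
  note cr = Ck_on_polynomial
  have h: "real_polynomial_function h" "\<And>x. laplacian h x = 0" "\<And>x. pd x h x = k * h x"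
    using assms by (auto simp: homogeneous_harmonic_def)
  let ?g = "pd e h"
  have g: "real_polynomial_function ?g" "\<And>x. laplacian ?g x = 0" "\<And>x. pd x ?g x = real (k - 1) * ?g x"
    using homogeneous_harmonic_pd[OF assms(1), of e] by (auto simp: homogeneous_harmonic_def)
  have g0: "?g x = 0" if "k = 0" for x
  proof -
    have "h = (\<lambda>x. h 0)" using homogeneous_harmonic_0_const assms(1) that by blast
    then show ?thesis by (metis frechet_derivative_const)
  qed
  \<comment> \<open>The Laplacian of |x|^2 g for harmonic g of degree k - 1 is (2 N + 4 (k - 1)) g,
    which must equal 2 g after multiplication by c.\<close>
  define c where "c = 1 / (real DIM('a) + 2 * real (k - 1))"
  have cpos: "real DIM('a) + 2 * real (k - 1) > 0" by (simp add: add_pos_nonneg)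
  then have cpos0: "c \<noteq> 0" by (simp add: c_def)
  have re: "real_polynomial_function (\<lambda>x::'a. x \<bullet> e)"
    by (intro real_polynomial_function.intros(1) bounded_linear_inner_left)
  note rx = polynomial_inner_self
  have r1: "real_polynomial_function (\<lambda>x. (x \<bullet> e) * h x)"
    and r2: "real_polynomial_function (\<lambda>x. (x \<bullet> x) * ?g x)"
    by (intro real_polynomial_function.intros(4) re h g rx)+
  have r3: "real_polynomial_function (\<lambda>x. c * ((x \<bullet> x) * ?g x))"
    by (intro real_polynomial_function.intros(4) real_polynomial_function.intros(2) rx g)
  have l1: "laplacian (\<lambda>x. (x \<bullet> e) * h x) x = 2 * ?g x" for x
  proof -
    have "laplacian (\<lambda>x::'a. x \<bullet> e) x = 0"
      by (simp add: laplacian_def pd_inner_left)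
    moreover have "(\<Sum>i\<in>Basis. (i \<bullet> e) * pd i h x) = ?g x"
      using pd_as_sum[where x=x and v=e, OF d[OF h(1)]] by (simp add: inner_commute)
    ultimately show ?thesis
      by (subst laplacian_mult[OF open_UNIV UNIV_I cr[OF re] cr[OF h(1)]]) (simp add: h pd_inner_left)
  qed
  have l2: "laplacian (\<lambda>x. (x \<bullet> x) * ?g x) x = 2 * (1 / c) * ?g x" for x
    unfolding laplacian_inner_self_mult[OF g(1)] g c_def using cpos by (simp add: algebra_simps)
  have lap: "laplacian (\<lambda>x. (x \<bullet> e) * h x - c * ((x \<bullet> x) * ?g x)) x = 0" for x
    using cpos0
    by (subst laplacian_diff[OF open_UNIV UNIV_I cr[OF r1] cr[OF r3]],
        subst laplacian_cmult[OF open_UNIV UNIV_I cr[OF r2]])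
      (simp add: l1 l2)
  have eul: "pd x (\<lambda>x. (x \<bullet> e) * h x - c * ((x \<bullet> x) * ?g x)) x
      = real (k + 1) * ((x \<bullet> e) * h x - c * ((x \<bullet> x) * ?g x))" for x
  proof -
    have "pd x (\<lambda>x. (x \<bullet> e) * h x) x = real (k + 1) * ((x \<bullet> e) * h x)"
      by (subst pd_mult[OF d[OF re] d[OF h(1)]]) (simp add: h pd_inner_left algebra_simps)
    moreover have "pd x (\<lambda>x. (x \<bullet> x) * ?g x) x = real (k + 1) * ((x \<bullet> x) * ?g x)"
      using g0[of x] by (subst pd_mult[OF d[OF rx] d[OF g(1)]])
        (cases k; simp add: g pd_inner_self algebra_simps)
    ultimately show ?thesis
      by (subst pd_diff[OF d[OF r1] d[OF r3]], subst pd_cmult[OF d[OF r2]]) (simp add: algebra_simps)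
  qed
  have "real_polynomial_function (\<lambda>x. (x \<bullet> e) * h x - c * ((x \<bullet> x) * ?g x))"
    using real_polynomial_function_diff[OF r1 r3] .
  then show ?thesis using that[of c] lap eul by (simp add: homogeneous_harmonic_def)
qed

text \<open>Sums of even powers of |x| times homogeneous harmonic polynomials: the Fischer
  decomposition. Both the Poisson equation and harmonic extension from a sphere can be solved
  summand by summand in this form.\<close>

inductive fischer :: "('a::euclidean_space \<Rightarrow> real) \<Rightarrow> bool" where
  base: "homogeneous_harmonic k h \<Longrightarrow> fischer (\<lambda>x. (x \<bullet> x) ^ m * h x)"
| add: "fischer p \<Longrightarrow> fischer q \<Longrightarrow> fischer (\<lambda>x. p x + q x)"

lemma homogeneous_harmonic_cmult:
  assumes "homogeneous_harmonic k h" shows "homogeneous_harmonic k (\<lambda>x. c * h x)"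
proof -
  have h: "real_polynomial_function h" using assms by (simp add: homogeneous_harmonic_def)
  show ?thesis
    using assms
    by (auto simp: homogeneous_harmonic_def pd_cmult polynomial_differentiable
        laplacian_cmult[OF open_UNIV UNIV_I Ck_on_polynomial[OF h]])
qed

lemma fischer_cmult: "fischer p \<Longrightarrow> fischer (\<lambda>x. c * p x)"
proof (induction rule: fischer.induct)
  case (base k h m)
  from fischer.base[OF homogeneous_harmonic_cmult[OF this]] show ?case
    by (simp add: mult_ac)
next
  case (add p q)
  then show ?case using fischer.add by (simp add: distrib_left)
qed

lemma polynomial_power_mult:
  "real_polynomial_function h \<Longrightarrow> real_polynomial_function (\<lambda>x::'a::euclidean_space. (x \<bullet> x) ^ m * h x)"
  by (intro real_polynomial_function.intros(4) real_polynomial_function_power polynomial_inner_self)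

text \<open>x_e h is split into its harmonic correction and c |x|^2 times a derivative of h, which
  is again harmonic; the extra |x|^2 is absorbed into the power.\<close>

lemma fischer_coordinate: "fischer p \<Longrightarrow> e \<in> Basis \<Longrightarrow> fischer (\<lambda>x. (x \<bullet> e) * p x)"
proof (induction rule: fischer.induct)
  case (base k h m)
  obtain c where c: "homogeneous_harmonic (k + 1) (\<lambda>x. (x \<bullet> e) * h x - c * ((x \<bullet> x) * pd e h x))"
    using homogeneous_harmonic_coordinate[OF base] .
  from fischer.add[OF fischer.base[OF c, of m]
      fischer_cmult[OF fischer.base[OF homogeneous_harmonic_pd[OF base(1), of e], of "Suc m"], of c]]
  show ?case by (simp add: algebra_simps)
next
  case (add p q)
  then show ?case using fischer.add by (simp add: distrib_left)
qed

lemma fischer_0: "fischer (\<lambda>x. 0)"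
  using fischer.base[of 0 "\<lambda>_. 0" 0] by (simp add: homogeneous_harmonic_def laplacian_def real_polynomial_function.intros(2))

lemma fischer_sum: "(\<And>i. i \<in> I \<Longrightarrow> fischer (g i)) \<Longrightarrow> fischer (\<lambda>x. \<Sum>i\<in>I. g i x)"
  by (induction I rule: infinite_finite_induct) (auto intro: fischer_0 fischer.add)

lemma real_polynomial_imp_fischer:
  fixes p :: "'a::euclidean_space \<Rightarrow> real"
  assumes "real_polynomial_function p" shows "fischer p"
proof -
  \<comment> \<open>The claim is strengthened to invariance of \<open>fischer\<close> under
    multiplication by p. In this form products compose and linear factors reduce to coordinates;
    finally q = 1.\<close>
  have "fischer q \<Longrightarrow> fischer (\<lambda>x. p x * q x)" for q
    using assms
  proof (induction arbitrary: q)
    case (linear f)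
    have fx: "f x = (\<Sum>i\<in>Basis. (x \<bullet> i) * f i)" for x
    proof -
      have l: "linear f" using linear(1) by (rule bounded_linear.linear)
      have "f x = f (\<Sum>i\<in>Basis. (x \<bullet> i) *\<^sub>R i)" by (simp add: euclidean_representation)
      then show ?thesis
        using linear_sum[OF l, of "\<lambda>i. (x \<bullet> i) *\<^sub>R i" Basis] linear_cmul[OF l] by simp
    qed
    have eq: "(\<lambda>x. f x * q x) = (\<lambda>x. \<Sum>i\<in>Basis. f i * ((x \<bullet> i) * q x))"
    proof
      fix x show "f x * q x = (\<Sum>i\<in>Basis. f i * ((x \<bullet> i) * q x))"
        by (subst fx) (simp add: sum_distrib_right sum_distrib_left mult_ac)
    qed
    show ?case
      unfolding eq by (intro fischer_sum fischer_cmult fischer_coordinate linear(2))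
  next
    case (const c)
    then show ?case by (rule fischer_cmult)
  next
    case (add f g)
    then show ?case using fischer.add[OF add.IH(1) add.IH(2)] by (simp add: distrib_right)
  next
    case (mult f g)
    then show ?case by (simp add: mult.assoc)
  qed
  moreover have "fischer (\<lambda>x::'a. 1)"
    using fischer.base[of 0 "\<lambda>_. 1" 0]
    by (simp add: homogeneous_harmonic_def laplacian_def real_polynomial_function.intros(2))
  ultimately show ?thesis by fastforce
qed

text \<open>Positivity of the constant is the point: it is divided by in
  \<open>fischer_poisson\<close>.\<close>

lemma laplacian_power_harmonic:
  fixes h :: "'a::euclidean_space \<Rightarrow> real"
  assumes "homogeneous_harmonic k h"
  obtains c where "c > 0" "\<And>x. laplacian (\<lambda>x. (x \<bullet> x) ^ Suc m * h x) x = c * ((x \<bullet> x) ^ m * h x)"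
proof -
  have h: "real_polynomial_function h" "\<And>x. laplacian h x = 0" "\<And>x. pd x h x = k * h x"
    using assms by (auto simp: homogeneous_harmonic_def)
  note d = polynomial_differentiable
  note rp = polynomial_power_mult[OF h(1)]
  have eul: "pd x (\<lambda>x. (x \<bullet> x) ^ m * h x) x = real (2 * m + k) * ((x \<bullet> x) ^ m * h x)" for m x
  proof (induction m)
    case (Suc m)
    have "pd x (\<lambda>x. (x \<bullet> x) * ((x \<bullet> x) ^ m * h x)) x = real (2 * Suc m + k) * ((x \<bullet> x) * ((x \<bullet> x) ^ m * h x))"
      by (subst pd_mult[OF d[OF polynomial_inner_self] d[OF rp]])
        (simp only: Suc.IH pd_inner_self, simp add: algebra_simps)
    then show ?case by (simp add: mult_ac)
  qed (simp add: h)
  have step: "laplacian (\<lambda>x. (x \<bullet> x) ^ Suc m * h x) x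
      = (x \<bullet> x) * laplacian (\<lambda>x. (x \<bullet> x) ^ m * h x) x
        + (2 * real DIM('a) + 4 * real (2 * m + k)) * ((x \<bullet> x) ^ m * h x)" for m x
    using laplacian_inner_self_mult[OF rp[of m], of x] unfolding eul power_Suc mult.assoc
    by (simp add: distrib_right)
  \<comment> \<open>Multiplying by |x|^2 avoids the exponent m - 1, so that m = 0 fits the same
    formula with c = 0.\<close>
  have "\<exists>c\<ge>0. \<forall>x. (x \<bullet> x) * laplacian (\<lambda>x. (x \<bullet> x) ^ m * h x) x = c * ((x \<bullet> x) ^ m * h x)" for m
  proof (induction m)
    case 0
    then show ?case by (intro exI[of _ 0]) (simp add: h)
  next
    case (Suc m)
    then obtain c where c: "c \<ge> 0"
      "\<And>x. (x \<bullet> x) * laplacian (\<lambda>x. (x \<bullet> x) ^ m * h x) x = c * ((x \<bullet> x) ^ m * h x)" by blast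
    show ?case
      using c(1) unfolding step c(2)
      by (intro exI[of _ "c + (2 * real DIM('a) + 4 * real (2 * m + k))"]) (auto simp: algebra_simps)
  qed
  then obtain c where c: "c \<ge> 0"
    "\<And>x. (x \<bullet> x) * laplacian (\<lambda>x. (x \<bullet> x) ^ m * h x) x = c * ((x \<bullet> x) ^ m * h x)" by metis
  let ?c = "c + (2 * real DIM('a) + 4 * real (2 * m + k))"
  have "0 < real DIM('a)" by simp
  then have "0 < ?c" using c(1) by linarith
  moreover have "laplacian (\<lambda>x. (x \<bullet> x) ^ Suc m * h x) x = ?c * ((x \<bullet> x) ^ m * h x)" for x
    unfolding step c(2) by (rule distrib_right[symmetric])
  ultimately show ?thesis by (rule that)
qed

lemma fischer_poisson:
  "fischer p \<Longrightarrow> \<exists>P. real_polynomial_function P \<and> (\<forall>x. laplacian P x = p x)"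
proof (induction rule: fischer.induct)
  case (base k h m)
  obtain c where c: "c > 0" "\<And>x. laplacian (\<lambda>x. (x \<bullet> x) ^ Suc m * h x) x = c * ((x \<bullet> x) ^ m * h x)"
    using laplacian_power_harmonic[OF base] by blast
  have r: "real_polynomial_function (\<lambda>x. (x \<bullet> x) ^ Suc m * h x)"
    using base by (intro polynomial_power_mult) (simp add: homogeneous_harmonic_def)
  show ?case
    by (intro exI[of _ "\<lambda>x. (1 / c) * ((x \<bullet> x) ^ Suc m * h x)"] conjI allI real_polynomial_function.intros(4)[OF real_polynomial_function.intros(2) r])
      (subst laplacian_cmult[OF open_UNIV UNIV_I Ck_on_polynomial[OF r]], use c in simp)
next
  case (add p q)
  then obtain P Q where P: "real_polynomial_function P" "\<And>x. laplacian P x = p x"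
    and Q: "real_polynomial_function Q" "\<And>x. laplacian Q x = q x" by blast
  show ?case
    by (intro exI[of _ "\<lambda>x. P x + Q x"] conjI allI real_polynomial_function.intros(3) P Q)
      (subst laplacian_add[OF open_UNIV UNIV_I], auto intro: Ck_on_polynomial P Q simp: P Q)
qed

text \<open>On the sphere of radius \<rho> the factor |x|^(2 m) is the constant \<rho>^(2 m);
  replacing it by this constant leaves a harmonic polynomial.\<close>

lemma fischer_harmonic_extension:
  "fischer p \<Longrightarrow> \<exists>H. real_polynomial_function H \<and> (\<forall>x. laplacian H x = 0) \<and> (\<forall>x. norm x = \<rho> \<longrightarrow> H x = p x)"
proof (induction rule: fischer.induct)
  case (base k h m)
  from homogeneous_harmonic_cmult[OF this, of "(\<rho>\<^sup>2) ^ m"] show ?case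
    by (intro exI[of _ "\<lambda>x. (\<rho>\<^sup>2) ^ m * h x"]) (simp add: homogeneous_harmonic_def dot_square_norm)
next
  case (add p q)
  then obtain P Q where P: "real_polynomial_function P" "\<And>x. laplacian P x = 0" "\<And>x. norm x = \<rho> \<Longrightarrow> P x = p x"
    and Q: "real_polynomial_function Q" "\<And>x. laplacian Q x = 0" "\<And>x. norm x = \<rho> \<Longrightarrow> Q x = q x" by blast
  have "laplacian (\<lambda>x. P x + Q x) x = 0" for x
    by (subst laplacian_add[OF open_UNIV UNIV_I]) (auto intro: Ck_on_polynomial P Q simp: P Q)
  then show ?case
    using P(1,3) Q(1,3) by (intro exI[of _ "\<lambda>x. P x + Q x"]) auto
qed

text \<open>s = H - P, where P has Laplacian qb and the harmonic H corrects the boundary values to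
  qa + P.\<close>

lemma polynomial_poisson_ball:
  fixes qa qb :: "'a::euclidean_space \<Rightarrow> real"
  assumes "real_polynomial_function qa" "real_polynomial_function qb"
  obtains s where "real_polynomial_function s" "\<And>x. - laplacian s x = qb x" "\<And>x. norm x = \<rho> \<Longrightarrow> s x = qa x"
proof -
  note cr = Ck_on_polynomial
  obtain P where P: "real_polynomial_function P" "\<And>x. laplacian P x = qb x"
    using fischer_poisson[OF real_polynomial_imp_fischer[OF assms(2)]] by blast
  obtain H where H: "real_polynomial_function H" "\<And>x. laplacian H x = 0" "\<And>x. norm x = \<rho> \<Longrightarrow> H x = qa x + P x"
    using fischer_harmonic_extension[OF real_polynomial_imp_fischer[OF real_polynomial_function.intros(3)[OF assms(1) P(1)]]]
    by blast
  have "- laplacian (\<lambda>x. H x - P x) x = qb x" for x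
    by (subst laplacian_diff[OF open_UNIV UNIV_I cr[OF H(1)] cr[OF P(1)]]) (simp add: H P)
  then show ?thesis
    using real_polynomial_function_diff[OF H(1) P(1)] H(3) by (intro that[of "\<lambda>x. H x - P x"]) auto
qed

section \<open>The Poisson problem on a ball\<close>

text \<open>Comparison with the paraboloid \<alpha> + \<beta> (\<rho>^2 - |x|^2): adding \<beta>
  |x|^2 raises the Laplacian by 2 N \<beta>, which is at least \<beta>.\<close>

lemma polynomial_ball_upper_estimate:
  fixes s :: "'a::euclidean_space \<Rightarrow> real"
  assumes s: "real_polynomial_function s" and "\<rho> > 0" "0 \<le> \<beta>"
    and bd: "\<And>x. norm x = \<rho> \<Longrightarrow> s x \<le> \<alpha>"
    and lap: "\<And>x. norm x \<le> \<rho> \<Longrightarrow> - \<beta> \<le> laplacian s x"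
    and x: "norm x \<le> \<rho>"
  shows "s x \<le> \<alpha> + \<beta> * \<rho>\<^sup>2"
proof (cases "norm x = \<rho>")
  case True
  then show ?thesis using bd[OF True] assms(3) by (simp add: add_increasing2)
next
  case False
  note cr = Ck_on_polynomial
  let ?q = "\<lambda>x::'a. \<beta> * (x \<bullet> x)" and ?c = "- \<alpha> - \<beta> * \<rho>\<^sup>2"
  have q: "real_polynomial_function ?q" "real_polynomial_function (\<lambda>x. ?q x + ?c)"
    by (intro real_polynomial_function.intros polynomial_inner_self)+
  have d: "real_polynomial_function (\<lambda>x. s x + (?q x + ?c))"
    by (intro real_polynomial_function.intros(3) s q)
  have "laplacian (\<lambda>x. s x + (?q x + ?c)) y = laplacian s y + 2 * real DIM('a) * \<beta>" for y
    unfolding laplacian_add[OF open_UNIV UNIV_I cr[OF s] cr[OF q(2)]]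
      laplacian_add[OF open_UNIV UNIV_I cr[OF q(1)] Ck_on_const]
      laplacian_cmult[OF open_UNIV UNIV_I cr[OF polynomial_inner_self]]
    by (simp add: laplacian_inner_self laplacian_def[of "\<lambda>_. ?c"])
  moreover have "\<beta> * 1 \<le> \<beta> * (2 * real DIM('a))"
    using assms(3) DIM_positive[where 'a='a] by (intro mult_left_mono) linarith+
  ultimately have L: "0 \<le> laplacian (\<lambda>x. s x + (?q x + ?c)) y" if "y \<in> ball 0 \<rho>" for y
    using lap[of y] that by (simp add: mult.commute)
  have "s x + (?q x + ?c) \<le> 0"
  proof (rule maximum_principle_classical[of "ball 0 \<rho>", OF _ _ _ _ _ L])
    show "x \<in> ball 0 \<rho>" using False x by simp
    show "Ck_on 2 (ball 0 \<rho>) (\<lambda>x. s x + (?q x + ?c))"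
      by (rule Ck_on_subset[OF cr[OF d]]) simp
    show "continuous_on (closure (ball 0 \<rho>)) (\<lambda>x. s x + (?q x + ?c))"
      by (rule Ck_on_continuous_on[OF Ck_on_subset[OF cr[OF d, of 0]]]) simp
    fix y :: 'a assume "y \<in> frontier (ball 0 \<rho>)"
    then have "norm y = \<rho>" using \<open>\<rho> > 0\<close> by (simp add: frontier_ball)
    then show "s y + (?q y + ?c) \<le> 0" using bd by (simp add: dot_square_norm)
  qed auto
  moreover have "0 \<le> ?q x" using assms(3) by simp
  ultimately show ?thesis by linarith
qed

lemma polynomial_ball_estimate:
  fixes s :: "'a::euclidean_space \<Rightarrow> real"
  assumes s: "real_polynomial_function s" and "\<rho> > 0" "0 \<le> \<beta>"
    and bd: "\<And>x. norm x = \<rho> \<Longrightarrow> \<bar>s x\<bar> \<le> \<alpha>"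
    and lap: "\<And>x. norm x \<le> \<rho> \<Longrightarrow> \<bar>laplacian s x\<bar> \<le> \<beta>"
    and x: "norm x \<le> \<rho>"
  shows "\<bar>s x\<bar> \<le> \<alpha> + \<beta> * \<rho>\<^sup>2"
proof -
  have m: "real_polynomial_function (\<lambda>x. -1 * s x)" "laplacian (\<lambda>x. -1 * s x) y = -1 * laplacian s y" for y
    by (intro real_polynomial_function.intros s)
      (rule laplacian_cmult[OF open_UNIV UNIV_I Ck_on_polynomial[OF s]])
  have "s x \<le> \<alpha> + \<beta> * \<rho>\<^sup>2"
    by (rule polynomial_ball_upper_estimate[OF s assms(2,3) _ _ x]) (use bd lap in \<open>force simp: abs_le_iff\<close>)+
  moreover have "-1 * s x \<le> \<alpha> + \<beta> * \<rho>\<^sup>2"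
    by (rule polynomial_ball_upper_estimate[OF m(1) assms(2,3) _ _ x])
      (use bd lap in \<open>force simp: abs_le_iff m(2)[simplified]\<close>)+
  ultimately show ?thesis by (simp add: abs_le_iff)
qed

lemma avg_tendsto:
  assumes "\<And>n. continuous_on S (w n)" "cube x r \<subseteq> S"
    "\<And>n y. y \<in> S \<Longrightarrow> \<bar>w n y\<bar> \<le> W" "\<And>y. y \<in> S \<Longrightarrow> (\<lambda>n. w n y) \<longlonglongrightarrow> w' y"
  shows "(\<lambda>n. avg r (w n) x) \<longlonglongrightarrow> avg r w' x"
  unfolding avg_def
  by (rule kop_tendsto[OF avg_cont assms(1) subsetD[OF assms(2) cubeI] assms(3,4)])

lemma pot_tendsto:
  assumes "\<And>n. continuous_on S (w n)" "cube x r \<subseteq> S"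
    "\<And>n y. y \<in> S \<Longrightarrow> \<bar>w n y\<bar> \<le> W" "\<And>y. y \<in> S \<Longrightarrow> (\<lambda>n. w n y) \<longlonglongrightarrow> w' y"
  shows "(\<lambda>n. pot r (w n) x) \<longlonglongrightarrow> pot r w' x"
  unfolding pot_def
  by (rule kop_tendsto[OF pot_cont assms(1) subsetD[OF assms(2) pot_shift_cube] assms(3,4)])

text \<open>Continuous data are approximated by polynomials. The solution is a uniform limit and may
  lack second derivatives when \<open>b\<close> is merely continuous, so the equation is expressed
  through \<open>avg\<close> and \<open>pot\<close>, which pass to the limit.\<close>

lemma poisson_ball_0:
  fixes a b :: "'a::euclidean_space \<Rightarrow> real"
  assumes \<rho>: "\<rho> > 0" and a: "continuous_on (cball 0 \<rho>) a" and b: "continuous_on (cball 0 \<rho>) b"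
  obtains h where "continuous_on (cball 0 \<rho>) h" "\<And>x. norm x = \<rho> \<Longrightarrow> h x = a x"
    "\<And>x r. 0 < r \<Longrightarrow> cube x r \<subseteq> ball 0 \<rho> \<Longrightarrow> h x = avg r h x + pot r b x"
proof -
  let ?B = "cball (0::'a) \<rho>"
  note cr = Ck_on_polynomial
  obtain qa where qa: "\<And>n. real_polynomial_function (qa n)" "\<And>n x. x \<in> ?B \<Longrightarrow> \<bar>a x - qa n x\<bar> < 1 / Suc n"
    using polynomial_approximation[OF compact_cball a] by blast
  obtain qb where qb: "\<And>n. real_polynomial_function (qb n)" "\<And>n x. x \<in> ?B \<Longrightarrow> \<bar>b x - qb n x\<bar> < 1 / Suc n"
    using polynomial_approximation[OF compact_cball b] by blast
  have "\<exists>s. real_polynomial_function s \<and> (\<forall>x. - laplacian s x = qb n x) \<and> (\<forall>x. norm x = \<rho> \<longrightarrow> s x = qa n x)" for n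
    by (rule polynomial_poisson_ball[OF qa(1)[of n] qb(1)[of n], of \<rho>]) blast
  then obtain s where s: "\<And>n. real_polynomial_function (s n)" "\<And>n x. - laplacian (s n) x = qb n x"
      "\<And>n x. norm x = \<rho> \<Longrightarrow> s n x = qa n x"
    by metis
  have cs: "continuous_on T (s n)" for T n
    using Ck_on_continuous_on[OF Ck_on_subset[OF cr[OF s(1), of 0]]] by blast
  have cqb: "continuous_on T (qb n)" for T n
    using Ck_on_continuous_on[OF Ck_on_subset[OF cr[OF qb(1), of 0]]] by blast
  let ?e = "\<lambda>m n. 1 / real (Suc m) + 1 / real (Suc n)"
  have ls: "laplacian (s n) x = - qb n x" for n x using s(2)[of n x] by simp
  \<comment> \<open>Boundary values and Laplacians of the difference are both bounded by the sum of
    the two approximation errors.\<close>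
  have diff: "\<bar>s m x - s n x\<bar> \<le> ?e m n + ?e m n * \<rho>\<^sup>2" if "x \<in> ?B" for m n x
  proof (rule polynomial_ball_estimate[OF real_polynomial_function_diff[OF s(1) s(1)] \<rho>])
    fix y :: 'a
    show "\<bar>s m y - s n y\<bar> \<le> ?e m n" if "norm y = \<rho>"
      using qa(2)[of y m] qa(2)[of y n] that by (simp add: s(3) abs_le_iff abs_less_iff)
    show "\<bar>laplacian (\<lambda>x. s m x - s n x) y\<bar> \<le> ?e m n" if "norm y \<le> \<rho>"
      using qb(2)[of y m] qb(2)[of y n] that
      unfolding laplacian_diff[OF open_UNIV UNIV_I cr[OF s(1)] cr[OF s(1)]]
      by (simp add: ls abs_le_iff abs_less_iff)
  qed (use that in auto)
  have "uniformly_Cauchy_on ?B s"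
    unfolding uniformly_Cauchy_on_def
  proof (intro allI impI)
    fix e :: real assume "e > 0"
    have "(\<lambda>n. 2 * (1 + \<rho>\<^sup>2) * (1 / real (Suc n))) \<longlonglongrightarrow> 0"
      using tendsto_mult_right_zero[OF LIMSEQ_inverse_real_of_nat] by (simp add: inverse_eq_divide)
    then have "\<forall>\<^sub>F n in sequentially. 2 * (1 + \<rho>\<^sup>2) * (1 / real (Suc n)) < e"
      using \<open>e > 0\<close> order_tendstoD(2) by blast
    then obtain M where M: "2 * (1 + \<rho>\<^sup>2) * (1 / real (Suc M)) < e"
      by (auto simp: eventually_sequentially)
    show "\<exists>M. \<forall>x\<in>?B. \<forall>m\<ge>M. \<forall>n\<ge>M. dist (s m x) (s n x) < e"
    proof (intro exI[of _ M] ballI allI impI)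
      fix x m n assume x: "x \<in> ?B" and mn: "M \<le> m" "M \<le> n"
      have "?e m n \<le> 2 * (1 / real (Suc M))"
        using mn frac_le[of 1 1 "real (Suc M)" "real (Suc m)"] frac_le[of 1 1 "real (Suc M)" "real (Suc n)"] by simp
      then have "?e m n * (1 + \<rho>\<^sup>2) \<le> 2 * (1 / real (Suc M)) * (1 + \<rho>\<^sup>2)"
        by (intro mult_right_mono) auto
      also have "\<dots> < e" using M by (simp only: mult_ac)
      finally have "?e m n * (1 + \<rho>\<^sup>2) < e" .
      then show "dist (s m x) (s n x) < e"
        using diff[OF x, of m n] unfolding dist_real_def distrib_left mult_1_right by linarith
    qed
  qed
  then obtain h where h: "uniform_limit ?B s h sequentially"
    using Cauchy_uniformly_convergent uniformly_convergent_on_def by blast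
  have hl: "(\<lambda>n. s n x) \<longlonglongrightarrow> h x" if "x \<in> ?B" for x
    using tendsto_uniform_limitI[OF h that] .
  have ch: "continuous_on ?B h"
    by (rule uniform_limit_theorem[OF _ h]) (auto intro!: always_eventually cs)
  have approx: "(\<lambda>n. q n x) \<longlonglongrightarrow> g x"
    if "\<And>n. \<bar>g x - q n x\<bar> < 1 / Suc n" for q :: "nat \<Rightarrow> 'a \<Rightarrow> real" and g x
  proof (rule LIM_zero_cancel, rule Lim_null_comparison)
    show "\<forall>\<^sub>F n in sequentially. norm (q n x - g x) \<le> inverse (real (Suc n))"
      using that by (intro always_eventually allI) (simp add: abs_minus_commute inverse_eq_divide less_imp_le)
    show "(\<lambda>n. inverse (real (Suc n))) \<longlonglongrightarrow> 0" by (rule LIMSEQ_inverse_real_of_nat)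
  qed
  have one: "1 / real (Suc n) \<le> 1" for n by simp
  obtain Ca where Ca: "0 \<le> Ca" "\<And>x. x \<in> ?B \<Longrightarrow> \<bar>a x\<bar> \<le> Ca"
    using continuous_on_compact_bound[OF compact_cball a] by blast
  obtain Cb where Cb: "0 \<le> Cb" "\<And>x. x \<in> ?B \<Longrightarrow> \<bar>b x\<bar> \<le> Cb"
    using continuous_on_compact_bound[OF compact_cball b] by blast
  have qb_bd: "\<bar>qb n x\<bar> \<le> Cb + 1" if "x \<in> ?B" for n x
    using qb(2)[OF that, of n] Cb(2)[OF that] one[of n] by linarith
  have s_bd: "\<bar>s n x\<bar> \<le> (Ca + 1) + (Cb + 1) * \<rho>\<^sup>2" if "x \<in> ?B" for n x
  proof (rule polynomial_ball_estimate[OF s(1) \<rho>])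
    fix y :: 'a
    show "\<bar>s n y\<bar> \<le> Ca + 1" if "norm y = \<rho>"
    proof -
      have y: "y \<in> ?B" using that by simp
      show ?thesis using qa(2)[OF y, of n] Ca(2)[OF y] one[of n] unfolding s(3)[OF that] by linarith
    qed
    show "\<bar>laplacian (s n) y\<bar> \<le> Cb + 1" if "norm y \<le> \<rho>"
      using qb_bd[of y n] that by (simp add: ls)
  qed (use that Cb in auto)
  have "h x = avg r h x + pot r b x" if r: "0 < r" and c: "cube x r \<subseteq> ball 0 \<rho>" for x r
  proof -
    have c': "cube x r \<subseteq> ?B" using c by auto
    have "s n x = avg r (s n) x + pot r (qb n) x" for n
      using avg_pot_representation[OF open_UNIV cr[OF s(1), of 2 n] r, of x] by (simp add: s(2))
    moreover have "(\<lambda>n. qb n y) \<longlonglongrightarrow> b y" if "y \<in> ?B" for y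
      by (intro approx qb(2) that)
    then have "(\<lambda>n. avg r (s n) x + pot r (qb n) x) \<longlonglongrightarrow> avg r h x + pot r b x"
      by (intro tendsto_add avg_tendsto[where S="?B", OF cs c' s_bd hl]
          pot_tendsto[where S="?B", OF cqb c' qb_bd])
    ultimately have "(\<lambda>n. s n x) \<longlonglongrightarrow> avg r h x + pot r b x" by simp
    moreover have "x \<in> ?B" using c' center_in_cube by blast
    ultimately show ?thesis using LIMSEQ_unique[OF hl] by blast
  qed
  moreover have "h x = a x" if "norm x = \<rho>" for x
  proof -
    have x: "x \<in> ?B" using that by simp
    have "(\<lambda>n. qa n x) \<longlonglongrightarrow> a x" by (intro approx qa(2) x)
    then show ?thesis using LIMSEQ_unique[OF hl[OF x]] s(3)[OF that] by simp
  qed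
  ultimately show ?thesis using that ch by blast
qed

lemma avg_translate: "avg r (\<lambda>y. w (y + c)) x = avg r w (x + c)"
  by (simp add: avg_def kop_def add_ac)

lemma pot_translate: "pot r (\<lambda>y. w (y + c)) x = pot r w (x + c)"
  by (simp add: pot_def kop_def add_ac)

lemma poisson_ball:
  fixes a b :: "'a::euclidean_space \<Rightarrow> real"
  assumes \<rho>: "\<rho> > 0" and a: "continuous_on (cball c \<rho>) a" and b: "continuous_on (cball c \<rho>) b"
  obtains h where "continuous_on (cball c \<rho>) h" "\<And>x. x \<in> sphere c \<rho> \<Longrightarrow> h x = a x"
    "\<And>x r. 0 < r \<Longrightarrow> cube x r \<subseteq> ball c \<rho> \<Longrightarrow> h x = avg r h x + pot r b x"
proof -
  have t: "y + c \<in> cball c \<rho>" if "y \<in> cball 0 \<rho>" for y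
    using that by (simp add: dist_norm)
  have "continuous_on (cball 0 \<rho>) (\<lambda>y. a (y + c))" "continuous_on (cball 0 \<rho>) (\<lambda>y. b (y + c))"
    by (rule continuous_on_compose2[OF a] continuous_on_compose2[OF b]; use t in \<open>auto intro!: continuous_intros\<close>)+
  from poisson_ball_0[OF \<rho> this] obtain h where h: "continuous_on (cball 0 \<rho>) h"
    "\<And>x. norm x = \<rho> \<Longrightarrow> h x = a (x + c)"
    "\<And>x r. 0 < r \<Longrightarrow> cube x r \<subseteq> ball 0 \<rho> \<Longrightarrow> h x = avg r h x + pot r (\<lambda>y. b (y + c)) x" by blast
  show ?thesis
  proof (rule that[of "\<lambda>x. h (x - c)"])
    show "continuous_on (cball c \<rho>) (\<lambda>x. h (x - c))"
      by (rule continuous_on_compose2[OF h(1)])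
        (auto intro!: continuous_intros simp: dist_norm norm_minus_commute)
    show "h (x - c) = a x" if "x \<in> sphere c \<rho>" for x
      using h(2)[of "x - c"] that by (simp add: dist_norm norm_minus_commute)
    show "h (x - c) = avg r (\<lambda>x. h (x - c)) x + pot r b x" if "0 < r" "cube x r \<subseteq> ball c \<rho>" for x r
    proof -
      have "cube (x - c) r \<subseteq> ball 0 \<rho>"
      proof
        fix y assume "y \<in> cube (x - c) r"
        then have "y + c \<in> cube x r" by (auto simp: cube_def)
        then show "y \<in> ball 0 \<rho>" using that(2) by (auto simp: dist_norm)
      qed
      from h(3)[OF that(1) this] show ?thesis
        using avg_translate[of r h "- c" x] pot_translate[of r b c "x - c"] by simp
    qed
  qed
qed

section \<open>Comparison and balayage\<close>

text \<open>The inequality - Laplacian a \<le> b in averaged form, meaningful for continuous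
  \<open>a\<close>. Only small radii are involved, and how small may depend on the point, which
  keeps the notion local.\<close>

definition subsolution :: "'a::euclidean_space set \<Rightarrow> ('a \<Rightarrow> real) \<Rightarrow> ('a \<Rightarrow> real) \<Rightarrow> bool" where
  "subsolution S a b \<longleftrightarrow> (\<forall>x\<in>S. \<forall>\<^sub>F r in at_right 0. a x \<le> avg r a x + pot r b x)"

definition supersolution :: "'a::euclidean_space set \<Rightarrow> ('a \<Rightarrow> real) \<Rightarrow> ('a \<Rightarrow> real) \<Rightarrow> bool" where
  "supersolution S a b \<longleftrightarrow> (\<forall>x\<in>S. \<forall>\<^sub>F r in at_right 0. avg r a x + pot r b x \<le> a x)"

lemma subsolution_mono:
  assumes "open S" "subsolution S a b" "continuous_on S b" "continuous_on S b'" "\<And>x. x \<in> S \<Longrightarrow> b x \<le> b' x"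
  shows "subsolution S a b'"
  unfolding subsolution_def
proof
  fix x assume x: "x \<in> S"
  show "\<forall>\<^sub>F r in at_right 0. a x \<le> avg r a x + pot r b' x"
    using bspec[OF assms(2)[unfolded subsolution_def] x] eventually_cube_subset[OF assms(1) x]
  proof eventually_elim
    case (elim r)
    have "pot r b x \<le> pot r b' x"
      using assms elim(2) by (intro pot_mono) (auto intro: continuous_on_subset)
    then show ?case using elim(1) by simp
  qed
qed

lemma comparison:
  assumes S: "open S" "bounded S"
    and d: "continuous_on (closure S) d1" "continuous_on (closure S) d2"
    and b: "continuous_on S b1" "continuous_on S b2" "\<And>x. x \<in> S \<Longrightarrow> b1 x \<le> b2 x"
    and sub: "subsolution S d1 b1" and sup: "supersolution S d2 b2"
    and bd: "\<And>x. x \<in> frontier S \<Longrightarrow> d1 x \<le> d2 x" and x: "x \<in> S"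
  shows "d1 x \<le> d2 x"
proof -
  have "d1 x - d2 x \<le> 0"
  proof (rule maximum_principle[OF S _ _ _ x])
    show "continuous_on (closure S) (\<lambda>x. d1 x - d2 x)" by (intro continuous_intros d)
    show "d1 y - d2 y \<le> 0" if "y \<in> frontier S" for y using bd[OF that] by simp
    fix y assume y: "y \<in> S"
    show "\<forall>\<^sub>F r in at_right 0. d1 y - d2 y \<le> avg r (\<lambda>x. d1 x - d2 x) y"
      using bspec[OF sub[unfolded subsolution_def] y] bspec[OF sup[unfolded supersolution_def] y]
        eventually_cube_subset[OF S(1) y]
    proof eventually_elim
      case (elim r)
      have "pot r b1 y \<le> pot r b2 y"
        using b elim(3) by (intro pot_mono) (auto intro: continuous_on_subset)
      moreover have "avg r (\<lambda>x. d1 x - d2 x) y = avg r d1 y - avg r d2 y"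
        using d elim(3) closure_subset by (intro avg_diff) (blast intro: continuous_on_subset)+
      ultimately show ?case using elim(1,2) by simp
    qed
  qed
  then show ?thesis by simp
qed

text \<open>Perron's Poisson modification: inside the ball \<open>a\<close> is replaced by the
  Poisson solution with boundary values \<open>a\<close>. The last conclusion lets the supersolution
  have a larger right-hand side \<open>b'\<close>, because in the iteration \<open>b\<close> itself
  still lies below its final bound.\<close>

lemma balayage:
  fixes a b :: "'a::euclidean_space \<Rightarrow> real"
  assumes \<Omega>: "open \<Omega>" and \<rho>: "\<rho> > 0" "cball c \<rho> \<subseteq> \<Omega>"
    and a: "continuous_on \<Omega> a" and b: "continuous_on \<Omega> b" and sub: "subsolution \<Omega> a b"
  obtains a' where "continuous_on \<Omega> a'" "subsolution \<Omega> a' b" "\<And>x. x \<in> \<Omega> \<Longrightarrow> a x \<le> a' x"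
    "\<And>x r. 0 < r \<Longrightarrow> cube x r \<subseteq> ball c \<rho> \<Longrightarrow> a' x = avg r a' x + pot r b x"
    "\<And>v b' x. continuous_on \<Omega> v \<Longrightarrow> continuous_on \<Omega> b' \<Longrightarrow> supersolution \<Omega> v b' \<Longrightarrow>
      (\<And>y. y \<in> \<Omega> \<Longrightarrow> b y \<le> b' y) \<Longrightarrow> (\<And>y. y \<in> \<Omega> \<Longrightarrow> a y \<le> v y) \<Longrightarrow> x \<in> \<Omega> \<Longrightarrow> a' x \<le> v x"
proof -
  let ?B = "ball c \<rho>"
  have B: "?B \<subseteq> \<Omega>" "closure ?B = cball c \<rho>" "frontier ?B = sphere c \<rho>" "open ?B" "bounded ?B"
    using \<rho> by (auto simp: frontier_ball)
  obtain h where h: "continuous_on (cball c \<rho>) h" "\<And>x. x \<in> sphere c \<rho> \<Longrightarrow> h x = a x"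
    "\<And>x r. 0 < r \<Longrightarrow> cube x r \<subseteq> ball c \<rho> \<Longrightarrow> h x = avg r h x + pot r b x"
    using poisson_ball[OF \<rho>(1) continuous_on_subset[OF a \<rho>(2)] continuous_on_subset[OF b \<rho>(2)]] by blast
  have hev: "\<forall>\<^sub>F r in at_right 0. h x = avg r h x + pot r b x" if "x \<in> ?B" for x
    using eventually_cube_subset[OF B(4) that] eventually_at_right_less[of 0]
    by eventually_elim (rule h(3))
  have hsub: "subsolution ?B h b" and hsup: "supersolution ?B h b"
    unfolding subsolution_def supersolution_def
    by (auto intro: eventually_mono[OF hev])
  have ab: "a x \<le> h x" if "x \<in> ?B" for x
    by (rule comparison[where ?b1.0 = b, OF B(4,5) _ _ _ _ _ _ hsup _ that])
      (use B h(1,2) a b \<rho> sub in \<open>auto intro: continuous_on_subset simp: subsolution_def\<close>)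
  define a' where "a' x = (if x \<in> cball c \<rho> then h x else a x)" for x
  have a'h: "a' x = h x" if "x \<in> cball c \<rho>" for x using that by (simp add: a'_def)
  have a'a: "a' x = a x" if "x \<notin> ?B" for x
    using that h(2)[of x] by (auto simp: a'_def)
  have ca': "continuous_on \<Omega> a'"
  proof -
    have e: "\<Omega> = cball c \<rho> \<union> (\<Omega> - ?B)" using \<rho> by auto
    have "continuous_on (cball c \<rho> \<union> (\<Omega> - ?B)) (\<lambda>x. if x \<in> cball c \<rho> then h x else a x)"
    proof (rule continuous_on_cases_local)
      show "closedin (top_of_set (cball c \<rho> \<union> (\<Omega> - ?B))) (cball c \<rho>)"
        by (rule closed_subset) auto
      show "closedin (top_of_set (cball c \<rho> \<union> (\<Omega> - ?B))) (\<Omega> - ?B)"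
        unfolding e[symmetric] by (subst Diff_eq, rule closedin_closed_Int) (simp add: closed_Compl)
      show "continuous_on (\<Omega> - ?B) a" using a by (rule continuous_on_subset) auto
      fix x assume "x \<in> cball c \<rho> \<and> x \<notin> cball c \<rho> \<or> x \<in> \<Omega> - ?B \<and> x \<in> cball c \<rho>"
      then show "h x = a x" using h(2) by (auto simp: sphere_def)
    qed (rule h(1))
    then show ?thesis unfolding e[symmetric] a'_def[abs_def] .
  qed
  have mono: "a x \<le> a' x" for x
    using ab[of x] a'a[of x] a'h[of x] by (cases "x \<in> ?B") auto
  have eq: "a' x = avg r a' x + pot r b x" if "0 < r" "cube x r \<subseteq> ?B" for x r
  proof -
    have "x \<in> ?B" using that center_in_cube by blast
    moreover have "avg r a' x = avg r h x"
      using that(2) by (intro avg_cong a'h) auto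
    ultimately show ?thesis using h(3)[OF that] a'h[of x] by simp
  qed
  have sub': "subsolution \<Omega> a' b"
    unfolding subsolution_def
  proof
    fix x assume x: "x \<in> \<Omega>"
    show "\<forall>\<^sub>F r in at_right 0. a' x \<le> avg r a' x + pot r b x"
    proof (cases "x \<in> ?B")
      case True
      show ?thesis
        using eventually_cube_subset[OF B(4) True] eventually_at_right_less[of 0]
        by eventually_elim (use eq in force)
    next
      \<comment> \<open>Off the open ball \<open>a'\<close> agrees with \<open>a\<close> at the
        point while its average is at least that of \<open>a\<close>, so the inequality can only
        improve.\<close>
      case False
      show ?thesis
        using eventually_cube_subset[OF \<Omega> x] bspec[OF sub[unfolded subsolution_def] x]
      proof eventually_elim
        case (elim r)
        have "avg r a x \<le> avg r a' x"
          using elim(1) a ca' mono by (intro avg_mono) (auto intro: continuous_on_subset)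
        then show ?case using elim(2) a'a[OF False] by simp
      qed
    qed
  qed
  have bound: "a' x \<le> v x"
    if v: "continuous_on \<Omega> v" "continuous_on \<Omega> b'" "supersolution \<Omega> v b'"
      "\<And>y. y \<in> \<Omega> \<Longrightarrow> b y \<le> b' y" "\<And>y. y \<in> \<Omega> \<Longrightarrow> a y \<le> v y" "x \<in> \<Omega>" for v b' x
  proof (cases "x \<in> ?B")
    case True
    have "h x \<le> v x"
      by (rule comparison[OF B(4,5) _ _ _ _ _ hsub _ _ True, of v b'])
        (use B h(1,2) v b \<rho> in \<open>auto intro: continuous_on_subset simp: supersolution_def subset_iff\<close>)
    then show ?thesis using a'h[of x] True by simp
  qed (use v a'a in auto)
  show ?thesis
    by (rule that[of a', OF ca' sub' mono eq]) (assumption | rule bound)+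
qed

text \<open>Subtracting \<open>avg_pot_representation\<close> leaves pot r (b + Laplacian a) = 0 at
  x for small r. Were b + Laplacian a nonzero at x, it would keep its sign on small cubes,
  contradicting \<open>pot_pos\<close>.\<close>

lemma laplacian_of_representation:
  fixes a b :: "'a::euclidean_space \<Rightarrow> real"
  assumes S: "open S" "Ck_on 2 S a" "continuous_on S b" and x: "x \<in> S"
    and rep: "\<forall>\<^sub>F r in at_right 0. a x = avg r a x + pot r b x"
  shows "laplacian a x = - b x"
proof -
  define g where "g y = b y + laplacian a y" for y
  have cl: "continuous_on S (laplacian a)" by (rule continuous_on_laplacian[OF S(1,2)])
  have cg: "continuous_on S g" unfolding g_def by (intro continuous_intros S cl)
  have g0: "\<forall>\<^sub>F r in at_right 0. pot r g x = 0"
    using rep eventually_cube_subset[OF S(1) x] eventually_at_right_less[of 0]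
  proof eventually_elim
    case (elim r)
    have c: "continuous_on (cube x r) b" "continuous_on (cube x r) (laplacian a)"
      using elim S(3) cl continuous_on_subset by blast+
    have "pot r (\<lambda>y. b y - (- laplacian a y)) x = pot r b x - pot r (\<lambda>y. - laplacian a y) x"
      by (intro pot_diff c continuous_intros)
    then show ?case
      using elim(1) avg_pot_representation[OF S(1,2) elim(3,2)] by (simp add: g_def[abs_def])
  qed
  \<comment> \<open>Taking k = 1 and k = -1 excludes both signs at once.\<close>
  have pos: False if "k * g x > 0" for k
  proof -
    define T where "T = S \<inter> (\<lambda>y. k * g y) -` {0<..}"
    have "open T"
      unfolding T_def by (rule continuous_open_preimage[OF _ S(1)]) (auto intro!: continuous_intros cg)
    moreover have "x \<in> T" using that x by (simp add: T_def)
    ultimately have "\<forall>\<^sub>F r in at_right 0. cube x r \<subseteq> T \<and> 0 < r \<and> pot r g x = 0"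
      by (intro eventually_conj eventually_cube_subset eventually_at_right_less g0)
    then obtain r where r: "cube x r \<subseteq> T" "0 < r" "pot r g x = 0"
      using eventually_happens trivial_limit_at_right_real by blast
    have "0 < pot r (\<lambda>y. k * g y) x"
    proof (rule pot_pos[OF r(2)])
      show "continuous_on (cube x r) (\<lambda>y. k * g y)"
        using r(1) by (intro continuous_intros continuous_on_subset[OF cg]) (auto simp: T_def)
    qed (use r(1) in \<open>auto simp: T_def\<close>)
    then show False using r(3) by (simp add: pot_cmult)
  qed
  have "g x = 0" using pos[of 1] pos[of "-1"] by (cases "g x" "0::real" rule: linorder_cases) auto
  then show ?thesis by (simp add: g_def)
qed

section \<open>Solutions below a supersolution\<close>

abbreviation avg_lip :: "real \<Rightarrow> 'a::euclidean_space itself \<Rightarrow> real" where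
  "avg_lip r _ \<equiv> 4 / (r * bump_mass TYPE('a)) * measure lborel (cbox (- One) (One::'a))"

abbreviation pot_lip :: "real \<Rightarrow> 'a::euclidean_space itself \<Rightarrow> real" where
  "pot_lip r _ \<equiv> r / bump_mass TYPE('a) * measure lborel (cbox (0::real, - One) (1, One::'a))"

text \<open>The constant is the bound of the differentiated kernel in \<open>smoothing_avg\<close>
  times the volume of the box; \<open>pot_lip\<close> arises in the same way.\<close>

lemma avg_Lipschitz:
  fixes S :: "'a::euclidean_space set"
  assumes "r > 0" "continuous_on S w" "open V" "convex V" "x \<in> V" "y \<in> V"
    "\<And>z. z \<in> V \<Longrightarrow> cube z r \<subseteq> S" "\<And>z. z \<in> S \<Longrightarrow> \<bar>w z\<bar> \<le> W" "0 \<le> W"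
  shows "\<bar>avg r w x - avg r w y\<bar> \<le> avg_lip r TYPE('a) * W * norm (x - y)"
  unfolding avg_def
  by (rule smoothing_kernel.kop_Lipschitz[OF smoothing_avg[OF assms(1)] assms(2-6)
        subsetD[OF assms(7) cubeI] assms(8,9)])

lemma pot_Lipschitz:
  fixes S :: "'a::euclidean_space set"
  assumes "r > 0" "continuous_on S w" "open V" "convex V" "x \<in> V" "y \<in> V"
    "\<And>z. z \<in> V \<Longrightarrow> cube z r \<subseteq> S" "\<And>z. z \<in> S \<Longrightarrow> \<bar>w z\<bar> \<le> W" "0 \<le> W"
  shows "\<bar>pot r w x - pot r w y\<bar> \<le> pot_lip r TYPE('a) * W * norm (x - y)"
  unfolding pot_def
  by (rule smoothing_kernel.kop_Lipschitz[OF smoothing_pot[OF assms(1)] assms(2-6)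
        subsetD[OF assms(7) pot_shift_cube] assms(8,9)])

lemma Ck_on_avg:
  assumes "r > 0" "open S" "Ck_on k S w" "open V" "\<And>x. x \<in> V \<Longrightarrow> cube x r \<subseteq> S"
  shows "Ck_on (Suc k) V (avg r w)"
  unfolding avg_def
  by (rule smoothing_kernel.Ck_on_kop[OF smoothing_avg[OF assms(1)] assms(2-4)])
    (use assms(5) cubeI in blast)

lemma Ck_on_pot:
  assumes "r > 0" "open S" "Ck_on k S w" "open V" "\<And>x. x \<in> V \<Longrightarrow> cube x r \<subseteq> S"
  shows "Ck_on (Suc k) V (pot r w)"
  unfolding pot_def
  by (rule smoothing_kernel.Ck_on_kop[OF smoothing_pot[OF assms(1)] assms(2-4)])
    (use assms(5) pot_shift_cube in blast)

lemma countable_ball_cover: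
  fixes \<Omega> :: "'a::euclidean_space set"
  assumes "open \<Omega>" "\<Omega> \<noteq> {}"
  obtains c \<rho> where "\<And>n. \<rho> n > 0" "\<And>n. cball (c n) (\<rho> n) \<subseteq> \<Omega>" "\<Omega> = (\<Union>n::nat. ball (c n) (\<rho> n))"
proof -
  let ?F = "{ball c \<rho> |c \<rho>. \<rho> > 0 \<and> cball c \<rho> \<subseteq> \<Omega>}"
  obtain F' where F': "F' \<subseteq> ?F" "countable F'" "\<Union>F' = \<Union>?F"
    by (rule Lindelof[of ?F]) auto
  have U: "\<Union>?F = \<Omega>"
  proof
    show "\<Omega> \<subseteq> \<Union>?F"
    proof
      fix x assume "x \<in> \<Omega>"
      then obtain e where "e > 0" "cball x e \<subseteq> \<Omega>" using assms(1) open_contains_cball by blast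
      then show "x \<in> \<Union>?F" by (intro UnionI[of "ball x e"]) auto
    qed
  qed force
  then have "F' \<noteq> {}" using F'(3) assms(2) by auto
  then have r: "range (from_nat_into F') = F'" using F'(2) by (simp add: range_from_nat_into)
  have "\<exists>c \<rho>. from_nat_into F' n = ball c \<rho> \<and> \<rho> > 0 \<and> cball c \<rho> \<subseteq> \<Omega>" for n
    using from_nat_into[OF \<open>F' \<noteq> {}\<close>, of n] F'(1) by blast
  then obtain c \<rho> where c: "\<And>n. from_nat_into F' n = ball (c n) (\<rho> n)" "\<And>n. \<rho> n > 0" "\<And>n. cball (c n) (\<rho> n) \<subseteq> \<Omega>"
    by metis
  have "\<Omega> = (\<Union>n. ball (c n) (\<rho> n))"
    using U F'(3) r c(1) by auto
  then show ?thesis using that c by blast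
qed

text \<open>A domain with only openness available offers no solvable Dirichlet problem, so the
  equations are solved on balls and the bounds by \<open>v\<close> and \<open>z\<close> keep the
  increasing iterates finite. Regularity of \<open>F\<close> is required only in composition with
  functions valued in [0, V], so \<open>F\<close> may be singular beyond V.\<close>

theorem solution_below_supersolution:
  fixes \<Omega> :: "'a::euclidean_space set" and F :: "real \<Rightarrow> real"
  assumes \<Omega>: "open \<Omega>" "\<Omega> \<noteq> {}"
    and v: "continuous_on \<Omega> v" "\<And>x. x \<in> \<Omega> \<Longrightarrow> v x \<in> {0..V}"
    and z: "continuous_on \<Omega> z" "\<And>x. x \<in> \<Omega> \<Longrightarrow> 0 \<le> z x"
    and super: "supersolution \<Omega> v z" "supersolution \<Omega> z (\<lambda>x. F (v x))"
    and F: "continuous_on {0..V} F" "\<And>s t. 0 \<le> s \<Longrightarrow> s \<le> t \<Longrightarrow> t \<le> V \<Longrightarrow> F s \<le> F t" "0 \<le> F 0"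
    and F_Ck: "\<And>k g. Ck_on k \<Omega> g \<Longrightarrow> (\<And>x. x \<in> \<Omega> \<Longrightarrow> g x \<in> {0..V}) \<Longrightarrow> Ck_on k \<Omega> (\<lambda>x. F (g x))"
  obtains a b where "\<And>k. Ck_on k \<Omega> a" "\<And>k. Ck_on k \<Omega> b"
    "\<And>x. x \<in> \<Omega> \<Longrightarrow> 0 \<le> a x \<and> a x \<le> v x" "\<And>x. x \<in> \<Omega> \<Longrightarrow> 0 \<le> b x \<and> b x \<le> z x"
    "\<And>x. x \<in> \<Omega> \<Longrightarrow> laplacian a x = - b x" "\<And>x. x \<in> \<Omega> \<Longrightarrow> laplacian b x = - F (a x)"
proof -
  obtain c \<rho> where ball: "\<And>n. \<rho> n > 0" "\<And>n. cball (c n) (\<rho> n) \<subseteq> \<Omega>" "\<Omega> = (\<Union>n::nat. ball (c n) (\<rho> n))"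
    by (rule countable_ball_cover[OF \<Omega>]) (rule that)
  \<comment> \<open>The first component of \<open>prod_decode\<close> takes every value infinitely
    often, so every ball is swept infinitely often.\<close>
  define j where "j n = fst (prod_decode n)" for n
  have cF: "continuous_on \<Omega> (\<lambda>x. F (g x))" if "continuous_on \<Omega> g" "\<And>x. x \<in> \<Omega> \<Longrightarrow> g x \<in> {0..V}" for g
    using F_Ck[of 0 g] that by simp
  define I where "I p \<longleftrightarrow> (case p of (a, b) \<Rightarrow>
      continuous_on \<Omega> a \<and> continuous_on \<Omega> b \<and> (\<forall>x\<in>\<Omega>. 0 \<le> a x \<and> a x \<le> v x) \<and> (\<forall>x\<in>\<Omega>. 0 \<le> b x \<and> b x \<le> z x) \<and>
      subsolution \<Omega> a b \<and> subsolution \<Omega> b (\<lambda>x. F (a x)))" for p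
  \<comment> \<open>Both components are swept on the same ball with the old pair on the right-hand
    side, hence the index shift in the equations.\<close>
  define Q where "Q n p p' \<longleftrightarrow> (case p of (a, b) \<Rightarrow> case p' of (a', b') \<Rightarrow>
      (\<forall>x\<in>\<Omega>. a x \<le> a' x \<and> b x \<le> b' x) \<and>
      (\<forall>x r. 0 < r \<longrightarrow> cube x r \<subseteq> ball (c (j n)) (\<rho> (j n)) \<longrightarrow>
        a' x = avg r a' x + pot r b x \<and> b' x = avg r b' x + pot r (\<lambda>x. F (a x)) x))" for n p p'
  obtain x0 where "x0 \<in> \<Omega>" using \<Omega>(2) by blast
  then have V0: "0 \<le> V" using v(2)[of x0] by simp
  have pot0: "pot r (\<lambda>_. 0) x = 0" for r and x :: 'a
    using pot_cmult[of r 0 "\<lambda>_. 0" x] by simp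
  have "\<exists>p. \<forall>n. I (p n) \<and> Q n (p n) (p (Suc n))"
  proof (rule dependent_nat_choice)
    have s0: "subsolution \<Omega> (\<lambda>_. 0) (\<lambda>_. 0)"
      by (simp add: subsolution_def pot0 avg_const)
    moreover have "subsolution \<Omega> (\<lambda>_. 0) (\<lambda>_. F 0)"
      by (rule subsolution_mono[OF \<Omega>(1) s0]) (use F in auto)
    ultimately have "I (\<lambda>_. 0, \<lambda>_. 0)" using v z by (auto simp: I_def)
    then show "\<exists>p. I p" by blast
  next
    fix p n assume "I p"
    then obtain a b where p: "p = (a, b)" and ab: "continuous_on \<Omega> a" "continuous_on \<Omega> b"
      "\<And>x. x \<in> \<Omega> \<Longrightarrow> 0 \<le> a x \<and> a x \<le> v x" "\<And>x. x \<in> \<Omega> \<Longrightarrow> 0 \<le> b x \<and> b x \<le> z x"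
      "subsolution \<Omega> a b" "subsolution \<Omega> b (\<lambda>x. F (a x))"
      by (cases p) (auto simp: I_def)
    have aV: "a x \<in> {0..V}" if "x \<in> \<Omega>" for x using ab(3)[OF that] v(2)[OF that] by auto
    have cFa: "continuous_on \<Omega> (\<lambda>x. F (a x))" by (rule cF[OF ab(1) aV])
    obtain a' where a': "continuous_on \<Omega> a'" "subsolution \<Omega> a' b" "\<And>x. x \<in> \<Omega> \<Longrightarrow> a x \<le> a' x"
      "\<And>x r. 0 < r \<Longrightarrow> cube x r \<subseteq> ball (c (j n)) (\<rho> (j n)) \<Longrightarrow> a' x = avg r a' x + pot r b x"
      "\<And>x. x \<in> \<Omega> \<Longrightarrow> a' x \<le> v x"
    proof (rule balayage[OF \<Omega>(1) ball(1)[of "j n"] ball(2) ab(1,2,5)], goal_cases)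
      case (1 a')
      show ?case
        by (rule 1(1)[OF 1(2-5)]) (use 1(6)[OF v(1) z(1) super(1)] ab(3,4) in auto)
    qed
    obtain b' where b': "continuous_on \<Omega> b'" "subsolution \<Omega> b' (\<lambda>x. F (a x))" "\<And>x. x \<in> \<Omega> \<Longrightarrow> b x \<le> b' x"
      "\<And>x r. 0 < r \<Longrightarrow> cube x r \<subseteq> ball (c (j n)) (\<rho> (j n)) \<Longrightarrow> b' x = avg r b' x + pot r (\<lambda>x. F (a x)) x"
      "\<And>x. x \<in> \<Omega> \<Longrightarrow> b' x \<le> z x"
    proof (rule balayage[OF \<Omega>(1) ball(1)[of "j n"] ball(2) ab(2) cFa ab(6)], goal_cases)
      case (1 b')
      have "F (a y) \<le> F (v y)" if "y \<in> \<Omega>" for y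
        using ab(3)[OF that] v(2)[OF that] by (intro F(2)) auto
      then show ?case
        by (intro 1(1)[OF 1(2-5)]) (use 1(6)[OF z(1) cF[OF v] super(2)] ab(3,4) in auto)
    qed
    have a'V: "a' x \<in> {0..V}" if "x \<in> \<Omega>" for x
      using aV[OF that] a'(3,5)[OF that] v(2)[OF that] by auto
    \<comment> \<open>The sweep used the old right-hand sides; since these only increase, and
      \<open>F\<close> is increasing, the subsolution property persists for the new pair.\<close>
    have "subsolution \<Omega> a' b'"
      by (rule subsolution_mono[OF \<Omega>(1) a'(2) ab(2) b'(1,3)])
    moreover have "subsolution \<Omega> b' (\<lambda>x. F (a' x))"
    proof (rule subsolution_mono[OF \<Omega>(1) b'(2) cFa cF[OF a'(1) a'V]])
      show "F (a x) \<le> F (a' x)" if "x \<in> \<Omega>" for x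
        using aV[OF that] a'V[OF that] a'(3)[OF that] by (intro F(2)) auto
    qed
    moreover have "0 \<le> a' x \<and> a' x \<le> v x" "0 \<le> b' x \<and> b' x \<le> z x" if "x \<in> \<Omega>" for x
      using a'(3,5)[OF that] b'(3,5)[OF that] ab(3,4)[OF that] by linarith+
    ultimately have "I (a', b')"
      unfolding I_def prod.case using a'(1) b'(1) by blast
    moreover have "Q n p (a', b')"
      unfolding Q_def p prod.case using a'(3,4) b'(3,4) by blast
    ultimately show "\<exists>p'. I p' \<and> Q n p p'" by blast
  qed
  then obtain p where p: "\<And>n. I (p n)" "\<And>n. Q n (p n) (p (Suc n))" by blast
  define an where "an n = fst (p n)" for n
  define bn where "bn n = snd (p n)" for n
  have pn: "p n = (an n, bn n)" for n by (simp add: an_def bn_def)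
  have an: "continuous_on \<Omega> (an n)" "x \<in> \<Omega> \<Longrightarrow> 0 \<le> an n x \<and> an n x \<le> v x"
    and bn: "continuous_on \<Omega> (bn n)" "x \<in> \<Omega> \<Longrightarrow> 0 \<le> bn n x \<and> bn n x \<le> z x" for n x
    using p(1)[of n] by (auto simp: pn I_def)
  have anV: "an n x \<in> {0..V}" if "x \<in> \<Omega>" for n x using an(2)[OF that, of n] v(2)[OF that] by auto
  have mono: "an n x \<le> an (Suc n) x" "bn n x \<le> bn (Suc n) x" if "x \<in> \<Omega>" for n x
    using p(2)[of n] that by (auto simp: pn Q_def)
  have rep: "an (Suc n) x = avg r (an (Suc n)) x + pot r (bn n) x"
    "bn (Suc n) x = avg r (bn (Suc n)) x + pot r (\<lambda>x. F (an n x)) x"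
    if "0 < r" "cube x r \<subseteq> ball (c (j n)) (\<rho> (j n))" for n x r
    using p(2)[of n] that by (auto simp: pn Q_def)
  define a where "a x = lim (\<lambda>n. an n x)" for x
  define b where "b x = lim (\<lambda>n. bn n x)" for x
  have lim: "(\<lambda>n. f n x) \<longlonglongrightarrow> lim (\<lambda>n. f n x)"
    if "\<And>n. f n x \<le> f (Suc n) x" "\<And>n. 0 \<le> f n x \<and> f n x \<le> M" for f :: "nat \<Rightarrow> 'a \<Rightarrow> real" and x M
  proof -
    have "Bseq (\<lambda>n. f n x)" using that(2) by (intro BseqI'[of _ M]) auto
    then have "convergent (\<lambda>n. f n x)"
      by (rule Bseq_mono_convergent) (simp add: lift_Suc_mono_le[of "\<lambda>n. f n x", OF that(1)])
    then show ?thesis by (simp add: convergent_LIMSEQ_iff)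
  qed
  have alim: "(\<lambda>n. an n x) \<longlonglongrightarrow> a x" and blim: "(\<lambda>n. bn n x) \<longlonglongrightarrow> b x" if "x \<in> \<Omega>" for x
    unfolding a_def b_def using mono[OF that] an(2)[OF that] bn(2)[OF that] by (intro lim; blast)+
  have a_bd: "0 \<le> a x \<and> a x \<le> v x" and b_bd: "0 \<le> b x \<and> b x \<le> z x" if "x \<in> \<Omega>" for x
    using LIMSEQ_le_const[OF alim[OF that]] LIMSEQ_le_const2[OF alim[OF that]]
      LIMSEQ_le_const[OF blim[OF that]] LIMSEQ_le_const2[OF blim[OF that]] an(2)[OF that] bn(2)[OF that]
    by blast+
  have aV: "a x \<in> {0..V}" if "x \<in> \<Omega>" for x using a_bd[OF that] v(2)[OF that] by auto
  have Flim: "(\<lambda>n. F (an n x)) \<longlonglongrightarrow> F (a x)" if "x \<in> \<Omega>" for x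
    using continuous_on_tendsto_compose[OF F(1) alim[OF that] aV[OF that]] anV[OF that] by simp
  have Fbd: "\<bar>F (an n x)\<bar> \<le> F V" if "x \<in> \<Omega>" for n x
    using F(2)[of 0 "an n x"] F(2)[of "an n x" V] F(3) anV[OF that, of n] by auto
  have cFan: "continuous_on \<Omega> (\<lambda>x. F (an n x))" for n by (rule cF[OF an(1) anV])
  \<comment> \<open>For fixed m these are the stages at which ball m is swept. The limits of the
    full sequences may be computed along them.\<close>
  have sub: "filterlim (\<lambda>i. prod_encode (m, i)) sequentially sequentially" for m
    by (rule filterlim_at_top_mono[OF filterlim_ident]) (simp add: le_prod_encode_2)
  have subS: "filterlim (\<lambda>i. Suc (prod_encode (m, i))) sequentially sequentially" for m
    using filterlim_compose[OF filterlim_Suc sub] .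
  have jm: "j (prod_encode (m, i)) = m" for m i by (simp add: j_def)
  have repm: "an (Suc (prod_encode (m, i))) x = avg r (an (Suc (prod_encode (m, i)))) x + pot r (bn (prod_encode (m, i))) x"
    "bn (Suc (prod_encode (m, i))) x = avg r (bn (Suc (prod_encode (m, i)))) x
      + pot r (\<lambda>x. F (an (prod_encode (m, i)) x)) x"
    if "0 < r" "cube x r \<subseteq> ball (c m) (\<rho> m)" for m i x r
    using rep[of r x "prod_encode (m, i)"] that by (simp_all add: jm)
  \<comment> \<open>One radius r serves all centres in a neighbourhood, so that the representation
    can be differentiated in the centre.\<close>
  have local: "\<exists>e>0. \<exists>r>0. ball x e \<subseteq> \<Omega> \<and> continuous_on (ball x e) a \<and> continuous_on (ball x e) b \<and>
      (\<forall>y\<in>ball x e. cube y r \<subseteq> \<Omega> \<and> (\<forall>s. 0 < s \<longrightarrow> s \<le> r \<longrightarrow>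
        a y = avg s a y + pot s b y \<and> b y = avg s b y + pot s (\<lambda>y. F (a y)) y))" if x: "x \<in> \<Omega>" for x
  proof -
    obtain m where m: "x \<in> ball (c m) (\<rho> m)" using x ball(3) by blast
    let ?C = "cball (c m) (\<rho> m)"
    have CS: "?C \<subseteq> \<Omega>" by (rule ball(2))
    obtain e r where er: "0 < e" "0 < r" "ball x e \<subseteq> ball (c m) (\<rho> m)"
      "\<And>y s. y \<in> ball x e \<Longrightarrow> 0 \<le> s \<Longrightarrow> s \<le> r \<Longrightarrow> cube y s \<subseteq> ball (c m) (\<rho> m)"
      using cube_subset_open_uniform[OF open_ball m] by metis
    have be: "ball x e \<subseteq> \<Omega>" using er(3) CS ball_subset_cball by (metis subset_trans)
    obtain Z where Z: "0 \<le> Z" "\<And>y. y \<in> ?C \<Longrightarrow> \<bar>z y\<bar> \<le> Z"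
      using continuous_on_compact_bound[OF compact_cball continuous_on_subset[OF z(1) CS]] by blast
    have bdan: "\<bar>an n y\<bar> \<le> V" and bdbn: "\<bar>bn n y\<bar> \<le> Z" and bdF: "\<bar>F (an n y)\<bar> \<le> F V" if "y \<in> ?C" for n y
      using anV[of y n] bn(2)[of y n] Z(2)[OF that] Fbd[of y n] that CS by auto
    have con: "continuous_on ?C (an n)" "continuous_on ?C (bn n)" "continuous_on ?C (\<lambda>x. F (an n x))" for n
      using an(1) bn(1) cFan CS continuous_on_subset by blast+
    have FV: "0 \<le> F V" using F(2)[of 0 V] F(3) V0 by simp
    have cubeC: "cube y s \<subseteq> ?C" if "y \<in> ball x e" "0 \<le> s" "s \<le> r" for y s
      using er(4)[OF that] by auto
    \<comment> \<open>Stated for a generic pair to cover both components: \<open>f\<close> is the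
      swept one and \<open>f'\<close> its right-hand side. After a sweep the iterates obey a
      Lipschitz bound with a constant independent of i, which the pointwise limit inherits.\<close>
    have lip: "continuous_on (ball x e) g"
      if rp: "\<And>i y. y \<in> ball x e \<Longrightarrow> f (Suc (prod_encode (m, i))) y
          = avg r (f (Suc (prod_encode (m, i)))) y + pot r (f' (prod_encode (m, i))) y"
        and cf: "\<And>n. continuous_on ?C (f n)" "\<And>n. continuous_on ?C (f' n)"
        and bf: "\<And>n y. y \<in> ?C \<Longrightarrow> \<bar>f n y\<bar> \<le> W" "\<And>n y. y \<in> ?C \<Longrightarrow> \<bar>f' n y\<bar> \<le> W'" "0 \<le> W" "0 \<le> W'"
        and fl: "\<And>y. y \<in> \<Omega> \<Longrightarrow> (\<lambda>n. f n y) \<longlonglongrightarrow> g y" for f f' g W W'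
    proof -
      let ?L1 = "avg_lip r TYPE('a)" and ?L2 = "pot_lip r TYPE('a)"
      let ?L = "?L1 * W + ?L2 * W'"
      have L0: "0 \<le> ?L"
        using bf er(2) bump_mass_pos[where 'a='a]
        by (intro add_nonneg_nonneg mult_nonneg_nonneg measure_nonneg) auto
      have step: "\<bar>f (Suc (prod_encode (m, i))) y - f (Suc (prod_encode (m, i))) y'\<bar> \<le> ?L * norm (y - y')"
        if "y \<in> ball x e" "y' \<in> ball x e" for y y' i
      proof -
        have "\<bar>avg r (f (Suc (prod_encode (m, i)))) y - avg r (f (Suc (prod_encode (m, i)))) y'\<bar> \<le> ?L1 * W * norm (y - y')"
          by (rule avg_Lipschitz[OF er(2) cf(1) open_ball convex_ball that cubeC bf(1) bf(3)]) (use er(2) in auto)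
        moreover have "\<bar>pot r (f' (prod_encode (m, i))) y - pot r (f' (prod_encode (m, i))) y'\<bar> \<le> ?L2 * W' * norm (y - y')"
          by (rule pot_Lipschitz[OF er(2) cf(2) open_ball convex_ball that cubeC bf(2) bf(4)]) (use er(2) in auto)
        ultimately show ?thesis
          unfolding rp[OF that(1)] rp[OF that(2)] distrib_right by linarith
      qed
      have "\<bar>g y - g y'\<bar> \<le> ?L * norm (y - y')" if yy: "y \<in> ball x e" "y' \<in> ball x e" for y y'
      proof (rule LIMSEQ_le_const2)
        have "y \<in> \<Omega>" "y' \<in> \<Omega>" using subsetD[OF be] yy by blast+
        then show "(\<lambda>i. \<bar>f (Suc (prod_encode (m, i))) y - f (Suc (prod_encode (m, i))) y'\<bar>) \<longlonglongrightarrow> \<bar>g y - g y'\<bar>"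
          by (intro tendsto_intros filterlim_compose[OF fl subS])
      qed (use step[OF yy] in blast)
      then have "?L-lipschitz_on (ball x e) g"
        using L0 by (intro lipschitz_onI) (simp_all add: dist_norm)
      then show ?thesis by (rule lipschitz_on_continuous_on)
    qed
    have ca: "continuous_on (ball x e) a"
      by (rule lip[OF repm(1) con(1,2) bdan bdbn V0 Z(1) alim]) (use er in auto)
    have cb: "continuous_on (ball x e) b"
      by (rule lip[OF repm(2) con(2,3) bdbn bdF Z(1) FV blim]) (use er in auto)
    have eqs: "a y = avg s a y + pot s b y \<and> b y = avg s b y + pot s (\<lambda>y. F (a y)) y"
      if ys: "y \<in> ball x e" "0 < s" "s \<le> r" for y s
    proof -
      have cu: "cube y s \<subseteq> ?C" "cube y s \<subseteq> ball (c m) (\<rho> m)" using cubeC[of y s] er(4)[of y s] ys by auto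
      have y\<Omega>: "y \<in> \<Omega>" using subsetD[OF be] ys by blast
      have l1: "(\<lambda>i. avg s (an (Suc (prod_encode (m, i)))) y + pot s (bn (prod_encode (m, i))) y) \<longlonglongrightarrow> avg s a y + pot s b y"
        using CS by (intro tendsto_add avg_tendsto[where S="?C", OF con(1) cu(1) bdan] pot_tendsto[where S="?C", OF con(2) cu(1) bdbn]
            filterlim_compose[OF alim subS] filterlim_compose[OF blim sub]) auto
      have l2: "(\<lambda>i. avg s (bn (Suc (prod_encode (m, i)))) y + pot s (\<lambda>x. F (an (prod_encode (m, i)) x)) y)
          \<longlonglongrightarrow> avg s b y + pot s (\<lambda>y. F (a y)) y"
        using CS by (intro tendsto_add avg_tendsto[where S="?C", OF con(2) cu(1) bdbn] pot_tendsto[where S="?C", OF con(3) cu(1) bdF]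
            filterlim_compose[OF blim subS] filterlim_compose[OF Flim sub]) auto
      show ?thesis
        using LIMSEQ_unique[OF filterlim_compose[OF alim[OF y\<Omega>] subS] l1[folded repm(1)[OF ys(2) cu(2)]]]
          LIMSEQ_unique[OF filterlim_compose[OF blim[OF y\<Omega>] subS] l2[folded repm(2)[OF ys(2) cu(2)]]] by simp
    qed
    have "cube y r \<subseteq> \<Omega>" if "y \<in> ball x e" for y using cubeC[OF that, of r] er(2) CS by auto
    then show ?thesis
      using er(1,2) be ca cb eqs by blast
  qed
  \<comment> \<open>Bootstrapping: both sides of a = avg r a + pot r b, and of the companion
    equation, gain a derivative, so \<open>a\<close> and \<open>b\<close> must be raised
    together.\<close>
  have Ck: "Ck_on k \<Omega> a \<and> Ck_on k \<Omega> b" for k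
  proof (induction k)
    case 0
    have "\<exists>V. open V \<and> x \<in> V \<and> Ck_on 0 V a \<and> Ck_on 0 V b" if x: "x \<in> \<Omega>" for x
    proof -
      obtain e where "e > 0" "continuous_on (ball x e) a" "continuous_on (ball x e) b"
        using local[OF x] by blast
      then show ?thesis by (intro exI[of _ "ball x e"]) simp
    qed
    then show ?case using Ck_on_local[of \<Omega> 0] by meson
  next
    case (Suc k)
    then have k: "Ck_on k \<Omega> a" "Ck_on k \<Omega> b" by auto
    have kF: "Ck_on k \<Omega> (\<lambda>x. F (a x))" by (rule F_Ck[OF k(1) aV])
    have "\<exists>V. open V \<and> x \<in> V \<and> Ck_on (Suc k) V a \<and> Ck_on (Suc k) V b" if x: "x \<in> \<Omega>" for x
    proof -
      obtain e r where er: "e > 0" "r > 0" "\<And>y. y \<in> ball x e \<Longrightarrow> cube y r \<subseteq> \<Omega>"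
        "\<And>y. y \<in> ball x e \<Longrightarrow> a y = avg r a y + pot r b y"
        "\<And>y. y \<in> ball x e \<Longrightarrow> b y = avg r b y + pot r (\<lambda>y. F (a y)) y"
        using local[OF x] by (metis order_refl)
      have "Ck_on (Suc k) (ball x e) (\<lambda>y. avg r a y + pot r b y)"
        by (intro Ck_on_add open_ball Ck_on_avg[OF er(2) \<Omega>(1) k(1)] Ck_on_pot[OF er(2) \<Omega>(1) k(2)] er(3))
      then have "Ck_on (Suc k) (ball x e) a"
        by (subst Ck_on_cong[OF open_ball er(4)])
      moreover have "Ck_on (Suc k) (ball x e) (\<lambda>y. avg r b y + pot r (\<lambda>y. F (a y)) y)"
        by (intro Ck_on_add open_ball Ck_on_avg[OF er(2) \<Omega>(1) k(2)] Ck_on_pot[OF er(2) \<Omega>(1) kF] er(3))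
      then have "Ck_on (Suc k) (ball x e) b"
        by (subst Ck_on_cong[OF open_ball er(5)])
      ultimately show ?thesis using er(1) by (intro exI[of _ "ball x e"]) auto
    qed
    then show ?case using Ck_on_local[of \<Omega> "Suc k"] by meson
  qed
  have ev: "\<forall>\<^sub>F s in at_right 0. a x = avg s a x + pot s b x \<and> b x = avg s b x + pot s (\<lambda>y. F (a y)) x" if x: "x \<in> \<Omega>" for x
  proof -
    obtain e r where "e > 0" "r > 0" and *: "\<forall>y\<in>ball x e. \<forall>s. 0 < s \<longrightarrow> s \<le> r \<longrightarrow>
        a y = avg s a y + pot s b y \<and> b y = avg s b y + pot s (\<lambda>y. F (a y)) y"
      using local[OF x] by blast
    then show ?thesis
      unfolding eventually_at_right_field by (intro exI[of _ r]) (auto simp: less_imp_le)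
  qed
  show ?thesis
  proof (rule that[of a b])
    show "Ck_on k \<Omega> a" "Ck_on k \<Omega> b" for k using Ck by auto
    show "laplacian a x = - b x" if "x \<in> \<Omega>" for x
      by (rule laplacian_of_representation[OF \<Omega>(1) _ _ that])
        (use Ck[of 2] Ck[of 0] eventually_mono[OF ev[OF that]] in auto)
    show "laplacian b x = - F (a x)" if "x \<in> \<Omega>" for x
      by (rule laplacian_of_representation[OF \<Omega>(1) _ _ that])
        (use Ck[of 2] Ck[of 0] F_Ck[of 0 a] aV eventually_mono[OF ev[OF that]] in auto)
  qed (use a_bd b_bd in auto)
qed

section \<open>The inequality for test functions and its closure\<close>

text \<open>Bridges the Sobolev definitions, which integrate over \<open>lebesgue_on\<close>, and
  the calculus on the whole space, which uses \<open>lborel\<close>.\<close>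

lemma lebesgue_on_lborel:
  fixes g :: "'a::euclidean_space \<Rightarrow> real"
  assumes "open \<Omega>" "integrable lborel g" "\<And>x. x \<notin> \<Omega> \<Longrightarrow> g x = 0"
  shows "integrable (lebesgue_on \<Omega>) g" "(LINT x|lebesgue_on \<Omega>. g x) = (LINT x|lborel. g x)"
proof -
  have \<Omega>: "\<Omega> \<inter> space lebesgue \<in> sets lebesgue" using assms(1) by auto
  have e: "(\<lambda>x. indicator \<Omega> x *\<^sub>R g x) = g"
  proof
    show "indicator \<Omega> x *\<^sub>R g x = g x" for x by (cases "x \<in> \<Omega>") (simp_all add: assms(3))
  qed
  show "integrable (lebesgue_on \<Omega>) g"
    unfolding integrable_restrict_space[OF \<Omega>] e by (rule integrable_completion[THEN iffD2, OF _ assms(2)]) (use assms(2) in auto)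
  show "(LINT x|lebesgue_on \<Omega>. g x) = (LINT x|lborel. g x)"
    unfolding integral_restrict_space[OF \<Omega>] e by (rule integral_completion) (use assms(2) in auto)
qed

lemma inverse_Ck:
  assumes "open S" "Ck_on k S g" "\<And>x. x \<in> S \<Longrightarrow> 0 < g x"
  shows "Ck_on k S (\<lambda>x. inverse (g x))"
proof -
  \<comment> \<open>The multiples of powers of 1 / t form a class closed under differentiation, as
    \<open>Ck_on_compose\<close> asks.\<close>
  let ?H = "{h. \<exists>c n. h = (\<lambda>t::real. c * inverse t ^ n)}"
  have "\<exists>h'\<in>?H. \<forall>t\<in>{0<..}. (h has_real_derivative h' t) (at t)" if hH: "h \<in> ?H" for h
  proof -
    obtain c n where h: "h = (\<lambda>t. c * inverse t ^ n)" using hH by blast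
    have "(h has_real_derivative (- c * n) * inverse t ^ Suc n) (at t)" if "t > 0" for t
    proof -
      have "(inverse has_real_derivative - (inverse t ^ Suc (Suc 0))) (at t)"
        by (rule DERIV_inverse) (use that in simp)
      from DERIV_cmult[OF DERIV_power[OF this, of n], of c] show ?thesis
        unfolding h by (rule DERIV_cong) (cases n; simp)
    qed
    then show ?thesis by (intro bexI[of _ "\<lambda>t. (- c * n) * inverse t ^ Suc n"] ballI) blast+
  qed
  moreover have "inverse \<in> ?H" by (auto intro!: exI[of _ 1])
  ultimately show ?thesis
    using Ck_on_compose[OF assms(1,2), of inverse ?H "{0<..}"] assms(3) by auto
qed

lemma Ck_on_test_function_mult:
  fixes h :: "'a::euclidean_space \<Rightarrow> real"
  assumes "open S" "compact K" "K \<subseteq> S" "Ck_on k S h" "Ck_on k UNIV \<psi>" "\<And>x. x \<notin> K \<Longrightarrow> \<psi> x = 0"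
  shows "Ck_on k UNIV (\<lambda>x. \<psi> x * h x)"
proof (rule Ck_on_local)
  fix x :: 'a
  have "Ck_on k S (\<lambda>x. \<psi> x * h x)"
    by (intro Ck_on_mult assms(1,4) Ck_on_subset[OF assms(5)]) auto
  moreover have o: "open (- K)" using assms(2) by (simp add: compact_imp_closed open_Compl)
  moreover have "Ck_on k (- K) (\<lambda>x. \<psi> x * h x)"
  proof -
    have "\<psi> x * h x = 0" if "x \<in> - K" for x using assms(6) that by simp
    then show ?thesis
      using Ck_on_cong[OF o, of "\<lambda>x. \<psi> x * h x" "\<lambda>_. 0" k] Ck_on_const[of k "- K" 0] by blast
  qed
  ultimately show "\<exists>V. open V \<and> x \<in> V \<and> Ck_on k V (\<lambda>x. \<psi> x * h x)"
    using assms(1,3) by (cases "x \<in> K") blast+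
qed

lemma norm_grad_sq: "(norm (grad g x))\<^sup>2 = (\<Sum>i\<in>Basis. (pd i g x)\<^sup>2)"
proof -
  have "grad g x \<bullet> i = pd i g x" if "i \<in> Basis" for i
    unfolding grad_def using that by (simp add: inner_sum_left inner_Basis if_distrib cong: if_cong)
  then show ?thesis
    unfolding power2_norm_eq_inner euclidean_inner[of "grad g x" "grad g x"] by (simp add: power2_eq_square)
qed

text \<open>Here \<open>V\<close> is the vector field \<open>\<psi>\<^sup>2 \<nabla>U / U\<close>, whose divergence integrates to \<open>0\<close>.\<close>

lemma picone_pointwise:
  fixes U \<psi> :: "'a::euclidean_space \<Rightarrow> real"
  assumes \<Omega>: "open \<Omega>" and U: "Ck_on 2 \<Omega> U" "\<And>x. x \<in> \<Omega> \<Longrightarrow> 0 < U x" and \<psi>: "test_function \<Omega> \<psi>"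
  obtains V where "\<And>i. i \<in> Basis \<Longrightarrow> integrable lborel (pd i (V i))"
    "\<And>i. i \<in> Basis \<Longrightarrow> (LINT x|lborel. pd i (V i) x) = 0"
    "\<And>x. x \<in> \<Omega> \<Longrightarrow> (- laplacian U x / U x) * (\<psi> x)\<^sup>2 \<le> (norm (grad \<psi> x))\<^sup>2 - (\<Sum>i\<in>Basis. pd i (V i) x)"
    "\<And>x i. i \<in> Basis \<Longrightarrow> x \<notin> \<Omega> \<Longrightarrow> pd i (V i) x = 0"
proof -
  obtain K where K: "compact K" "K \<subseteq> \<Omega>" "\<And>x. x \<notin> K \<Longrightarrow> \<psi> x = 0"
    using \<psi> by (auto simp: test_function_def)
  have \<psi>C: "Ck_on 1 UNIV \<psi>" using \<psi> by (auto simp: test_function_def smooth_on_def)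
  have \<psi>d: "\<psi> differentiable (at x)" for x using \<psi>C by simp
  have U2: "Ck_on (Suc (Suc 0)) \<Omega> U" using U(1) by (simp add: numeral_2_eq_2)
  have U1: "Ck_on 1 \<Omega> U" using Ck_on_mono[OF U2, of 1] by simp
  \<comment> \<open>The field is written with one factor psi outside: the rest is C^1 only on
    \<Omega>, and the outer factor extends the product by zero to the whole space.\<close>
  define V where "V i x = \<psi> x * (\<psi> x * (pd i U x * inverse (U x)))" for i x
  have inn: "Ck_on 1 \<Omega> (\<lambda>x. \<psi> x * (pd i U x * inverse (U x)))" for i
    using Ck_on_pd[OF U2] by (intro Ck_on_mult \<Omega> inverse_Ck U1 U(2) Ck_on_subset[OF \<psi>C]) auto
  have V1: "Ck_on 1 UNIV (V i)" for i
    unfolding V_def[abs_def] by (rule Ck_on_test_function_mult[OF \<Omega> K(1,2) inn \<psi>C K(3)])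
  have V0: "V i x = 0" if "x \<notin> K" for i x using K(3)[OF that] by (simp add: V_def)
  have pV: "pd i (V i) x = 2 * \<psi> x * pd i \<psi> x * pd i U x / U x
      + (\<psi> x)\<^sup>2 * pd i (pd i U) x / U x - (\<psi> x)\<^sup>2 * (pd i U x)\<^sup>2 / (U x)\<^sup>2" if x: "x \<in> \<Omega>" for i x
  proof -
    have Ud: "(U has_derivative (\<lambda>v. pd v U x)) (at x)"
      using U2 x by (intro has_derivative_frechet) auto
    have dUd: "(pd i U has_derivative (\<lambda>v. pd v (pd i U) x)) (at x)"
      using U2 x by (intro has_derivative_frechet) auto
    have "(V i has_derivative (\<lambda>v. 2 * \<psi> x * pd v \<psi> x * pd i U x / U x
      + (\<psi> x)\<^sup>2 * pd v (pd i U) x / U x - (\<psi> x)\<^sup>2 * (pd i U x) * pd v U x / (U x)\<^sup>2)) (at x)"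
      unfolding V_def[abs_def] using U(2)[OF x]
      by (auto intro!: derivative_eq_intros has_derivative_frechet[OF \<psi>d] Ud dUd
          simp: fun_eq_iff power2_eq_square field_simps)
    from pd_eqI[OF this] show ?thesis by (simp add: power2_eq_square mult_ac)
  qed
  show ?thesis
  proof (rule that[of V])
    fix i :: 'a
    show "integrable lborel (pd i (V i))" "(LINT x|lborel. pd i (V i) x) = 0"
      by (rule integral_pd_compact_support[OF V1 K(1)], rule V0, assumption)+
    show "pd i (V i) x = 0" if "x \<notin> \<Omega>" for x
      by (rule integral_pd_compact_support(3)[OF V1 K(1)], rule V0) (use that K(2) in blast)+
  next
    fix x assume x: "x \<in> \<Omega>"
    have "(\<Sum>i\<in>Basis. pd i (V i) x) \<le> (\<Sum>i\<in>Basis. (pd i \<psi> x)\<^sup>2 + (\<psi> x)\<^sup>2 * pd i (pd i U) x / U x)"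
    proof (rule sum_mono)
      fix i :: 'a
      \<comment> \<open>Picone's identity: the gap between the two sides is the square of the i-th
        component of grad psi - psi grad U / U.\<close>
      have "0 \<le> (pd i \<psi> x - \<psi> x * pd i U x / U x)\<^sup>2" by simp
      then show "pd i (V i) x \<le> (pd i \<psi> x)\<^sup>2 + (\<psi> x)\<^sup>2 * pd i (pd i U) x / U x"
        unfolding pV[OF x] by (simp add: power2_diff power_mult_distrib power_divide mult_ac)
    qed
    also have "\<dots> = (norm (grad \<psi> x))\<^sup>2 + (laplacian U x / U x) * (\<psi> x)\<^sup>2"
      by (simp add: sum.distrib norm_grad_sq laplacian_def sum_divide_distrib sum_distrib_left sum_distrib_right mult_ac)
    finally show "(- laplacian U x / U x) * (\<psi> x)\<^sup>2 \<le> (norm (grad \<psi> x))\<^sup>2 - (\<Sum>i\<in>Basis. pd i (V i) x)"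
      by simp
  qed
qed

lemma test_function_grad_integrable:
  fixes \<psi> :: "'a::euclidean_space \<Rightarrow> real"
  assumes "test_function \<Omega> \<psi>"
  shows "integrable lborel (\<lambda>x. (norm (grad \<psi> x))\<^sup>2)" "\<And>x. x \<notin> \<Omega> \<Longrightarrow> grad \<psi> x = 0"
    "continuous_on UNIV (grad \<psi>)" "integrable lborel (\<lambda>x. (\<psi> x)\<^sup>2)" "\<And>x. x \<notin> \<Omega> \<Longrightarrow> \<psi> x = 0"
    "continuous_on UNIV \<psi>"
proof -
  obtain K where K: "compact K" "K \<subseteq> \<Omega>" "\<And>x. x \<notin> K \<Longrightarrow> \<psi> x = 0"
    using assms by (auto simp: test_function_def)
  have C: "Ck_on 1 UNIV \<psi>" using assms by (auto simp: test_function_def smooth_on_def)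
  show c: "continuous_on UNIV (grad \<psi>)"
    unfolding grad_def[abs_def] using C by (auto intro!: continuous_intros)
  show c': "continuous_on UNIV \<psi>" by (rule Ck_on_continuous_on[OF C])
  have g0: "grad \<psi> x = 0" if "x \<notin> K" for x
    using integral_pd_compact_support(3)[OF C K(1,3)] that by (simp add: grad_def)
  show "grad \<psi> x = 0" "\<psi> x = 0" if "x \<notin> \<Omega>" for x using g0 K that by auto
  show "integrable lborel (\<lambda>x. (norm (grad \<psi> x))\<^sup>2)"
    by (rule integrable_compact_support[OF K(1)])
      (auto intro!: continuous_intros continuous_on_subset[OF c] simp: g0)
  show "integrable lborel (\<lambda>x. (\<psi> x)\<^sup>2)"
    by (rule integrable_compact_support[OF K(1)])
      (auto intro!: continuous_intros continuous_on_subset[OF c'] simp: K)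
qed

lemma system_test_inequality:
  fixes U W \<psi> :: "'a::euclidean_space \<Rightarrow> real"
  assumes \<Omega>: "open \<Omega>" and U: "Ck_on 2 \<Omega> U" "\<And>x. x \<in> \<Omega> \<Longrightarrow> 0 < U x"
    and W: "Ck_on 2 \<Omega> W" "\<And>x. x \<in> \<Omega> \<Longrightarrow> 0 < W x"
    and eqU: "\<And>x. x \<in> \<Omega> \<Longrightarrow> - laplacian U x = W x"
    and eqW: "\<And>x. x \<in> \<Omega> \<Longrightarrow> (g x)\<^sup>2 * U x \<le> - laplacian W x"
    and g: "continuous_on \<Omega> g" and \<psi>: "test_function \<Omega> \<psi>"
  shows "integrable (lebesgue_on \<Omega>) (\<lambda>x. g x * (\<psi> x)\<^sup>2)"
    "(LINT x|lebesgue_on \<Omega>. g x * (\<psi> x)\<^sup>2) \<le> (LINT x|lebesgue_on \<Omega>. (norm (grad \<psi> x))\<^sup>2)"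
proof -
  obtain K where K: "compact K" "K \<subseteq> \<Omega>" "\<And>x. x \<notin> K \<Longrightarrow> \<psi> x = 0"
    using \<psi> by (auto simp: test_function_def)
  obtain V where V: "\<And>i. i \<in> Basis \<Longrightarrow> integrable lborel (pd i (V i))"
    "\<And>i. i \<in> Basis \<Longrightarrow> (LINT x|lborel. pd i (V i) x) = 0"
    "\<And>x. x \<in> \<Omega> \<Longrightarrow> (- laplacian U x / U x) * (\<psi> x)\<^sup>2 \<le> (norm (grad \<psi> x))\<^sup>2 - (\<Sum>i\<in>Basis. pd i (V i) x)"
    "\<And>x i. i \<in> Basis \<Longrightarrow> x \<notin> \<Omega> \<Longrightarrow> pd i (V i) x = 0"
    using picone_pointwise[OF \<Omega> U \<psi>] by blast
  obtain V' where V': "\<And>i. i \<in> Basis \<Longrightarrow> integrable lborel (pd i (V' i))"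
    "\<And>i. i \<in> Basis \<Longrightarrow> (LINT x|lborel. pd i (V' i) x) = 0"
    "\<And>x. x \<in> \<Omega> \<Longrightarrow> (- laplacian W x / W x) * (\<psi> x)\<^sup>2 \<le> (norm (grad \<psi> x))\<^sup>2 - (\<Sum>i\<in>Basis. pd i (V' i) x)"
    "\<And>x i. i \<in> Basis \<Longrightarrow> x \<notin> \<Omega> \<Longrightarrow> pd i (V' i) x = 0"
    using picone_pointwise[OF \<Omega> W \<psi>] by blast
  note t = test_function_grad_integrable[OF \<psi>]
  let ?S = "\<lambda>x. \<Sum>i\<in>Basis. pd i (V i) x" and ?S' = "\<lambda>x. \<Sum>i\<in>Basis. pd i (V' i) x"
  have pw: "g x * (\<psi> x)\<^sup>2 \<le> (norm (grad \<psi> x))\<^sup>2 - (?S x + ?S' x) / 2" for x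
  proof (cases "x \<in> \<Omega>")
    case True
    let ?a = "W x / U x" and ?b = "(g x)\<^sup>2 * U x / W x"
    note pos = U(2)[OF True] W(2)[OF True]
    \<comment> \<open>The arithmetic-geometric mean inequality for W / U and g^2 U / W, whose
      product is g^2, written as a square.\<close>
    have "0 \<le> (W x - g x * U x)\<^sup>2 / (U x * W x)" using pos by simp
    also have "\<dots> = ?a + ?b - 2 * g x"
      using pos by (simp add: power2_eq_square field_simps)
    finally have "2 * g x \<le> ?a + ?b" by simp
    also have "\<dots> \<le> - laplacian U x / U x + - laplacian W x / W x"
      unfolding eqU[OF True] by (intro add_left_mono divide_right_mono eqW[OF True]) (use pos in simp)
    finally have "2 * g x * (\<psi> x)\<^sup>2 \<le> (- laplacian U x / U x + - laplacian W x / W x) * (\<psi> x)\<^sup>2"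
      by (rule mult_right_mono) simp
    from order_trans[OF this[unfolded distrib_right] add_mono[OF V(3)[OF True] V'(3)[OF True]]]
    have "2 * (g x * (\<psi> x)\<^sup>2) \<le> ((norm (grad \<psi> x))\<^sup>2 - ?S x) + ((norm (grad \<psi> x))\<^sup>2 - ?S' x)"
      by (simp only: mult.assoc)
    then show ?thesis by (simp add: field_simps)
  next
    case False
    then show ?thesis using t(2,5) V(4) V'(4) by simp
  qed
  have int1: "integrable lborel (\<lambda>x. g x * (\<psi> x)\<^sup>2)"
    by (rule integrable_compact_support[OF K(1)])
      (use K in \<open>auto intro!: continuous_intros continuous_on_subset[OF g] continuous_on_subset[OF t(6)]\<close>)
  have intS: "integrable lborel ?S" "integrable lborel ?S'"
    using V(1) V'(1) by (intro Bochner_Integration.integrable_sum; blast)+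
  have S0: "(LINT x|lborel. ?S x) = 0" "(LINT x|lborel. ?S' x) = 0"
    using V(1,2) V'(1,2) by (subst Bochner_Integration.integral_sum; simp)+
  have "(LINT x|lborel. g x * (\<psi> x)\<^sup>2) \<le> (LINT x|lborel. (norm (grad \<psi> x))\<^sup>2 - (?S x + ?S' x) / 2)"
    by (rule integral_mono[OF int1 _ pw]) (use t(1) intS in auto)
  also have "\<dots> = (LINT x|lborel. (norm (grad \<psi> x))\<^sup>2)"
    using t(1) intS S0 by simp
  finally show "(LINT x|lebesgue_on \<Omega>. g x * (\<psi> x)\<^sup>2) \<le> (LINT x|lebesgue_on \<Omega>. (norm (grad \<psi> x))\<^sup>2)"
    using lebesgue_on_lborel(2)[OF \<Omega> int1] lebesgue_on_lborel(2)[OF \<Omega> t(1)] t(2,5) by simp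
  show "integrable (lebesgue_on \<Omega>) (\<lambda>x. g x * (\<psi> x)\<^sup>2)"
    using lebesgue_on_lborel(1)[OF \<Omega> int1] t(5) by simp
qed

section \<open>From test functions to the closure\<close>

lemma norm_add_sq_le:
  fixes p q :: "'b::real_normed_vector"
  assumes "\<epsilon> > 0"
  shows "(norm (p + q))\<^sup>2 \<le> (1 + \<epsilon>) * (norm p)\<^sup>2 + (1 + 1 / \<epsilon>) * (norm q)\<^sup>2"
proof -
  have "(norm (p + q))\<^sup>2 \<le> (norm p + norm q)\<^sup>2" by (intro power_mono norm_triangle_ineq) simp
  also have "\<dots> = (1 + \<epsilon>) * (norm p)\<^sup>2 + (1 + 1 / \<epsilon>) * (norm q)\<^sup>2 - (\<epsilon> * norm p - norm q)\<^sup>2 / \<epsilon>"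
    using assms by (simp add: power2_eq_square field_simps)
  also have "\<dots> \<le> (1 + \<epsilon>) * (norm p)\<^sup>2 + (1 + 1 / \<epsilon>) * (norm q)\<^sup>2" using assms by simp
  finally show ?thesis .
qed

text \<open>The weighted triangle inequality is used once for the functions and once for the
  gradients, giving a factor (1 + epsilon)^2. The bound C controls the weighted error by the L^2
  error. The limit n -> infinity is taken before epsilon -> 0, because the error constant blows up
  with 1 / epsilon.\<close>

lemma H1_0_inequality_from_test_functions:
  fixes \<phi> :: "'a::euclidean_space \<Rightarrow> real" and G :: "'a \<Rightarrow> 'a"
  assumes \<Omega>: "open \<Omega>" and g: "continuous_on \<Omega> g" "\<And>x. x \<in> \<Omega> \<Longrightarrow> 0 \<le> g x \<and> g x \<le> C"
    and test: "\<And>\<psi>. test_function \<Omega> \<psi> \<Longrightarrow> integrable (lebesgue_on \<Omega>) (\<lambda>x. g x * (\<psi> x)\<^sup>2) \<and>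
      (LINT x|lebesgue_on \<Omega>. g x * (\<psi> x)\<^sup>2) \<le> (LINT x|lebesgue_on \<Omega>. (norm (grad \<psi> x))\<^sup>2)"
    and \<phi>: "H1_0 \<Omega> \<phi> G"
  shows "(LINT x|lebesgue_on \<Omega>. g x * (\<phi> x)\<^sup>2) \<le> (LINT x|lebesgue_on \<Omega>. (norm (G x))\<^sup>2)"
proof -
  let ?M = "lebesgue_on \<Omega>"
  define C' where "C' = max C 0"
  have gC: "g x \<le> C'" if "x \<in> \<Omega>" for x using g(2)[OF that] by (simp add: C'_def)
  have C0: "0 \<le> C'" by (simp add: C'_def)
  have meas: "\<phi> \<in> borel_measurable ?M" "G \<in> borel_measurable ?M"
    and int: "integrable ?M (\<lambda>x. (\<phi> x)\<^sup>2)" "integrable ?M (\<lambda>x. (norm (G x))\<^sup>2)"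
    using \<phi> by (auto simp: H1_0_def H1_def square_integrable_def)
  obtain \<psi> where \<psi>: "\<And>n. test_function \<Omega> (\<psi> n)"
    and lim: "(\<lambda>n::nat. (LINT x|?M. (\<psi> n x - \<phi> x)\<^sup>2) + (LINT x|?M. (norm (grad (\<psi> n) x - G x))\<^sup>2)) \<longlonglongrightarrow> 0"
    using \<phi> by (auto simp: H1_0_def)
  note t = test_function_grad_integrable[OF \<psi>]
  have gm: "g \<in> borel_measurable ?M"
    using g(1) \<Omega> by (intro continuous_imp_measurable_on_sets_lebesgue) auto
  have cm: "h \<in> borel_measurable ?M" if "continuous_on UNIV h" for h :: "'a \<Rightarrow> 'b::euclidean_space"
    using that \<Omega> by (intro continuous_imp_measurable_on_sets_lebesgue) (auto intro: continuous_on_subset)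
  have i\<psi>: "integrable ?M (\<lambda>x. (\<psi> n x)\<^sup>2)" "integrable ?M (\<lambda>x. (norm (grad (\<psi> n) x))\<^sup>2)" for n
    using lebesgue_on_lborel(1)[OF \<Omega> t(4)[of n]] lebesgue_on_lborel(1)[OF \<Omega> t(1)[of n]] t(2,5) by auto
  have id: "integrable ?M (\<lambda>x. (\<psi> n x - \<phi> x)\<^sup>2)" for n
  proof (rule Bochner_Integration.integrable_bound)
    show "integrable ?M (\<lambda>x. 2 * (\<psi> n x)\<^sup>2 + 2 * (\<phi> x)\<^sup>2)" using i\<psi> int by auto
    show "(\<lambda>x. (\<psi> n x - \<phi> x)\<^sup>2) \<in> borel_measurable ?M" using cm[OF t(6)[of n]] meas by measurable
    show "AE x in ?M. norm ((\<psi> n x - \<phi> x)\<^sup>2) \<le> norm (2 * (\<psi> n x)\<^sup>2 + 2 * (\<phi> x)\<^sup>2)"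
      using norm_add_sq_le[of 1 "\<psi> n _" "- \<phi> _"] by (intro AE_I2) simp
  qed
  have iD: "integrable ?M (\<lambda>x. (norm (grad (\<psi> n) x - G x))\<^sup>2)" for n
  proof (rule Bochner_Integration.integrable_bound)
    show "integrable ?M (\<lambda>x. 2 * (norm (grad (\<psi> n) x))\<^sup>2 + 2 * (norm (G x))\<^sup>2)" using i\<psi> int by auto
    show "(\<lambda>x. (norm (grad (\<psi> n) x - G x))\<^sup>2) \<in> borel_measurable ?M" using cm[OF t(3)[of n]] meas by measurable
    show "AE x in ?M. norm ((norm (grad (\<psi> n) x - G x))\<^sup>2) \<le> norm (2 * (norm (grad (\<psi> n) x))\<^sup>2 + 2 * (norm (G x))\<^sup>2)"
      using norm_add_sq_le[of 1 "grad (\<psi> n) _" "- G _"] by (intro AE_I2) simp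
  qed
  have ig: "integrable ?M (\<lambda>x. g x * (\<phi> x)\<^sup>2)"
  proof (rule Bochner_Integration.integrable_bound)
    show "integrable ?M (\<lambda>x. C' * (\<phi> x)\<^sup>2)" using int by auto
    show "(\<lambda>x. g x * (\<phi> x)\<^sup>2) \<in> borel_measurable ?M" using gm meas by measurable
    show "AE x in ?M. norm (g x * (\<phi> x)\<^sup>2) \<le> norm (C' * (\<phi> x)\<^sup>2)"
      using g(2) gC C0 by (intro AE_I2) (auto simp: abs_mult intro!: mult_right_mono)
  qed
  let ?X = "LINT x|?M. g x * (\<phi> x)\<^sup>2" and ?Y = "LINT x|?M. (norm (G x))\<^sup>2"
  let ?d = "\<lambda>n. LINT x|?M. (\<psi> n x - \<phi> x)\<^sup>2" and ?D = "\<lambda>n. LINT x|?M. (norm (grad (\<psi> n) x - G x))\<^sup>2"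
  have eps: "?X \<le> (1 + \<epsilon>)\<^sup>2 * ?Y" if \<epsilon>: "\<epsilon> > 0" for \<epsilon>
  proof -
    let ?k = "1 + 1 / \<epsilon>"
    have k0: "0 \<le> ?k" using \<epsilon> by simp
    \<comment> \<open>A common bound for the coefficients of both errors, since convergence is given
      only for their sum.\<close>
    let ?A = "?k * C' + (1 + \<epsilon>) * ?k"
    have "?X \<le> (1 + \<epsilon>)\<^sup>2 * ?Y + ?A * (?d n + ?D n)" for n
    proof -
      have "?X \<le> (LINT x|?M. (1 + \<epsilon>) * (g x * (\<psi> n x)\<^sup>2) + (?k * C') * (\<psi> n x - \<phi> x)\<^sup>2)"
      proof (rule integral_mono[OF ig])
        show "integrable ?M (\<lambda>x. (1 + \<epsilon>) * (g x * (\<psi> n x)\<^sup>2) + (?k * C') * (\<psi> n x - \<phi> x)\<^sup>2)"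
          using test[OF \<psi>] id by auto
        fix x assume "x \<in> space ?M"
        then have x: "x \<in> \<Omega>" by simp
        have "g x * (\<phi> x)\<^sup>2 \<le> g x * ((1 + \<epsilon>) * (\<psi> n x)\<^sup>2 + ?k * (\<psi> n x - \<phi> x)\<^sup>2)"
          using norm_add_sq_le[OF \<epsilon>, of "\<psi> n x" "\<phi> x - \<psi> n x"] g(2)[OF x]
          by (intro mult_left_mono) (auto simp: power2_commute)
        also have "\<dots> = (1 + \<epsilon>) * (g x * (\<psi> n x)\<^sup>2) + g x * (?k * (\<psi> n x - \<phi> x)\<^sup>2)"
          by (simp add: algebra_simps)
        also have "\<dots> \<le> (1 + \<epsilon>) * (g x * (\<psi> n x)\<^sup>2) + C' * (?k * (\<psi> n x - \<phi> x)\<^sup>2)"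
          using gC[OF x] k0 by (intro add_left_mono mult_right_mono mult_nonneg_nonneg) auto
        finally show "g x * (\<phi> x)\<^sup>2 \<le> (1 + \<epsilon>) * (g x * (\<psi> n x)\<^sup>2) + (?k * C') * (\<psi> n x - \<phi> x)\<^sup>2"
          by (simp only: mult_ac)
      qed
      also have "\<dots> = (1 + \<epsilon>) * (LINT x|?M. g x * (\<psi> n x)\<^sup>2) + (?k * C') * ?d n"
        using test[OF \<psi>, of n] id[of n] by simp
      also have "\<dots> \<le> (1 + \<epsilon>) * (LINT x|?M. (norm (grad (\<psi> n) x))\<^sup>2) + (?k * C') * ?d n"
        using test[OF \<psi>, of n] \<epsilon> by simp
      also have "(LINT x|?M. (norm (grad (\<psi> n) x))\<^sup>2)
          \<le> (LINT x|?M. (1 + \<epsilon>) * (norm (G x))\<^sup>2 + ?k * (norm (grad (\<psi> n) x - G x))\<^sup>2)"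
      proof (rule integral_mono[OF i\<psi>(2)])
        show "integrable ?M (\<lambda>x. (1 + \<epsilon>) * (norm (G x))\<^sup>2 + ?k * (norm (grad (\<psi> n) x - G x))\<^sup>2)"
          using int iD by auto
        show "(norm (grad (\<psi> n) x))\<^sup>2 \<le> (1 + \<epsilon>) * (norm (G x))\<^sup>2 + ?k * (norm (grad (\<psi> n) x - G x))\<^sup>2" for x
          using norm_add_sq_le[OF \<epsilon>, of "G x" "grad (\<psi> n) x - G x"] by simp
      qed
      also have "\<dots> = (1 + \<epsilon>) * ?Y + ?k * ?D n"
        using int iD by simp
      finally have X: "?X \<le> (1 + \<epsilon>) * ((1 + \<epsilon>) * ?Y + ?k * ?D n) + (?k * C') * ?d n"
        using \<epsilon> by simp
      have d0: "0 \<le> ?d n" "0 \<le> ?D n" by simp_all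
      have "(?k * C') * ?d n \<le> ?A * ?d n" "((1 + \<epsilon>) * ?k) * ?D n \<le> ?A * ?D n"
        using d0 k0 C0 \<epsilon> by (intro mult_right_mono; simp)+
      then show ?thesis using X by (simp add: algebra_simps power2_eq_square)
    qed
    moreover have "(\<lambda>n. (1 + \<epsilon>)\<^sup>2 * ?Y + ?A * (?d n + ?D n)) \<longlonglongrightarrow> (1 + \<epsilon>)\<^sup>2 * ?Y + ?A * 0"
      by (intro tendsto_intros lim)
    ultimately have "?X \<le> (1 + \<epsilon>)\<^sup>2 * ?Y + ?A * 0"
      by (intro LIMSEQ_le_const) auto
    then show ?thesis by simp
  qed
  have "((\<lambda>\<epsilon>. (1 + \<epsilon>)\<^sup>2 * ?Y) \<longlongrightarrow> (1 + 0)\<^sup>2 * ?Y) (at_right 0)"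
    by (intro tendsto_intros)
  then have "?X \<le> (1 + 0)\<^sup>2 * ?Y"
    by (rule tendsto_lowerbound) (auto simp: eventually_at_right_less intro!: eventually_mono[OF eventually_at_right_less[of 0]] eps)
  then show ?thesis by simp
qed

section \<open>The minimal solution\<close>

text \<open>The sign parameter covers both power nonlinearities: 1 for (1 + t)^p and -1 for (1 -
  t)^(-p).\<close>

lemma powr_affine_derivative_closed:
  assumes "h \<in> {h. \<exists>c q. h = (\<lambda>t. c * (1 + \<sigma> * t) powr q)}"
  shows "\<exists>h'\<in>{h. \<exists>c q. h = (\<lambda>t. c * (1 + \<sigma> * t) powr q)}. \<forall>t\<in>{t. 0 < 1 + \<sigma> * t}.
    (h has_real_derivative h' t) (at t)"
proof -
  obtain c q where h: "h = (\<lambda>t. c * (1 + \<sigma> * t) powr q)" using assms by blast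
  have "(h has_real_derivative (c * q * \<sigma>) * (1 + \<sigma> * t) powr (q - 1)) (at t)" if "0 < 1 + \<sigma> * t" for t
    unfolding h using that
    by (auto intro!: derivative_eq_intros simp: powr_diff field_simps)
  then show ?thesis
    by (intro bexI[of _ "\<lambda>t. (c * q * \<sigma>) * (1 + \<sigma> * t) powr (q - 1)"]) blast+
qed

text \<open>Uniform treatment of the three cases. \<open>J\<close> is an open interval on which f is
  smooth, positive, increasing and convex; for (1 + t)^p it omits the endpoint -1 of
  \<open>D\<close>, where smoothness may fail. The last clause places every nonnegative value below
  a value in \<open>D\<close> inside \<open>J\<close>.\<close>

lemma nonlinearity_properties:
  fixes f :: "real \<Rightarrow> real" and D :: "real set" and p :: real
  assumes p: "p > 1"
    and f: "(f = exp \<and> D = UNIV) \<or>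
         (f = (\<lambda>t. (1 + t) powr p) \<and> D = {-1..}) \<or>
         (f = (\<lambda>t. 1 / (1 - t) powr p) \<and> D = {..<1})"
  obtains J H where "f \<in> H" "\<And>h. h \<in> H \<Longrightarrow> \<exists>h'\<in>H. \<forall>t\<in>J. (h has_real_derivative h' t) (at t)"
    "open J" "\<And>s t. s \<in> J \<Longrightarrow> t \<in> J \<Longrightarrow> s \<le> t \<Longrightarrow> deriv f s \<le> deriv f t" "\<And>t. t \<in> J \<Longrightarrow> 0 \<le> deriv f t"
    "\<And>t. t \<in> J \<Longrightarrow> 0 < f t" "\<And>t. t \<in> D \<Longrightarrow> 0 \<le> f t"
    "\<And>s t. 0 \<le> s \<Longrightarrow> s \<le> t \<Longrightarrow> t \<in> D \<Longrightarrow> s \<in> D \<and> s \<in> J"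
proof -
  consider "f = exp" "D = UNIV" | "f = (\<lambda>t. (1 + t) powr p)" "D = {-1..}"
    | "f = (\<lambda>t. 1 / (1 - t) powr p)" "D = {..<1}"
    using f by blast
  then show ?thesis
  proof cases
    case 1
    have d: "deriv f t = exp t" for t
      unfolding 1 by (rule DERIV_imp_deriv) (rule DERIV_exp)
    show ?thesis
      by (rule that[of "{exp}" UNIV]) (auto simp: 1 d[unfolded 1])
  next
    case 2
    let ?H = "{h. \<exists>c q. h = (\<lambda>t. c * (1 + 1 * t) powr q)}" and ?J = "{t::real. 0 < 1 + 1 * t}"
    have d: "deriv f t = p * (1 + t) powr (p - 1)" if "t \<in> ?J" for t
    proof (rule DERIV_imp_deriv)
      show "(f has_real_derivative p * (1 + t) powr (p - 1)) (at t)"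
        unfolding 2 using that by (auto intro!: derivative_eq_intros simp: powr_diff field_simps)
    qed
    show ?thesis
    proof (rule that[of ?H ?J])
      show "f \<in> ?H" unfolding 2 by (intro CollectI exI[of _ 1] exI[of _ p]) simp
      show "\<exists>h'\<in>?H. \<forall>t\<in>?J. (h has_real_derivative h' t) (at t)" if "h \<in> ?H" for h
        by (rule powr_affine_derivative_closed[OF that])
      show "open ?J" by (intro open_Collect_less continuous_intros)
      show "deriv f s \<le> deriv f t" if "s \<in> ?J" "t \<in> ?J" "s \<le> t" for s t
        unfolding d[OF that(1)] d[OF that(2)] using p that by (intro mult_left_mono powr_mono2) auto
      show "0 \<le> deriv f t" if "t \<in> ?J" for t unfolding d[OF that] using p by simp
    qed (auto simp: 2)
  next
    case 3
    let ?H = "{h. \<exists>c q. h = (\<lambda>t. c * (1 + (-1) * t) powr q)}" and ?J = "{t::real. 0 < 1 + (-1) * t}"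
    have f: "f = (\<lambda>t. 1 * (1 + (-1) * t) powr (- p))"
      unfolding 3 by (simp add: powr_minus_divide)
    have d: "deriv f t = p * (1 - t) powr (- p - 1)" if "t \<in> ?J" for t
    proof (rule DERIV_imp_deriv)
      show "(f has_real_derivative p * (1 - t) powr (- p - 1)) (at t)"
        unfolding f using that by (auto intro!: derivative_eq_intros simp: powr_diff field_simps)
    qed
    show ?thesis
    proof (rule that[of ?H ?J])
      show "f \<in> ?H" unfolding f by blast
      show "\<exists>h'\<in>?H. \<forall>t\<in>?J. (h has_real_derivative h' t) (at t)" if "h \<in> ?H" for h
        by (rule powr_affine_derivative_closed[OF that])
      show "open ?J" by (intro open_Collect_less continuous_intros)
      show "deriv f s \<le> deriv f t" if "s \<in> ?J" "t \<in> ?J" "s \<le> t" for s t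
        unfolding d[OF that(1)] d[OF that(2)] using p that by (intro mult_left_mono powr_mono2') auto
      show "0 \<le> deriv f t" if "t \<in> ?J" for t unfolding d[OF that] using p by simp
    qed (auto simp: 3)
  qed
qed

text \<open>Boundary values of Laplacians are prescribed only as limits from inside, whereas the
  maximum principle asks for a continuous function on the closure.\<close>

lemma continuous_on_closure_zero_extension:
  fixes g :: "'a::euclidean_space \<Rightarrow> real"
  assumes \<Omega>: "open \<Omega>" and g: "continuous_on \<Omega> g"
    and lim: "\<And>x. x \<in> frontier \<Omega> \<Longrightarrow> (g \<longlongrightarrow> 0) (at x within \<Omega>)"
  shows "continuous_on (closure \<Omega>) (\<lambda>x. if x \<in> \<Omega> then g x else 0)"
  unfolding continuous_on_def
proof
  fix x assume x: "x \<in> closure \<Omega>"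
  let ?h = "\<lambda>x. if x \<in> \<Omega> then g x else 0"
  show "(?h \<longlongrightarrow> ?h x) (at x within closure \<Omega>)"
  proof (cases "x \<in> \<Omega>")
    case True
    have "continuous_on \<Omega> ?h" using g by (simp cong: continuous_on_cong)
    then have "isCont ?h x" using \<Omega> True continuous_on_eq_continuous_at by blast
    then have "(?h \<longlongrightarrow> ?h x) (at x)" by (simp only: isCont_def)
    then show ?thesis by (rule tendsto_within_subset) simp
  next
    case False
    then have "x \<in> frontier \<Omega>" using x \<Omega> by (simp add: frontier_def interior_open)
    from lim[OF this] have l: "(g \<longlongrightarrow> 0) (at x within \<Omega>)" .
    have "(?h \<longlongrightarrow> 0) (at x within closure \<Omega>)"
    proof (rule tendstoI)
      fix e :: real assume "e > 0"
      then have "\<forall>\<^sub>F y in at x within \<Omega>. dist (g y) 0 < e" using l by (simp add: tendsto_iff)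
      then obtain d where "d > 0" "\<forall>y\<in>\<Omega>. y \<noteq> x \<and> dist y x < d \<longrightarrow> dist (g y) 0 < e"
        unfolding eventually_at by blast
      then show "\<forall>\<^sub>F y in at x within closure \<Omega>. dist (?h y) 0 < e"
        unfolding eventually_at using \<open>e > 0\<close> by (intro exI[of _ d]) auto
    qed
    then show ?thesis using False by simp
  qed
qed

section \<open>Sign information and supersolutions\<close>

lemma frontier_notin_open: "open \<Omega> \<Longrightarrow> x \<in> frontier \<Omega> \<Longrightarrow> x \<notin> \<Omega>"
  by (simp add: frontier_def interior_open)

lemma smooth_on_Ck: "smooth_on S g \<Longrightarrow> Ck_on k S g"
  by (simp add: smooth_on_def)

lemma nonpos_of_subharmonic:
  fixes g :: "'a::euclidean_space \<Rightarrow> real"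
  assumes \<Omega>: "open \<Omega>" "bounded \<Omega>" and g: "Ck_on 2 \<Omega> g"
    and lim: "\<And>x. x \<in> frontier \<Omega> \<Longrightarrow> (g \<longlongrightarrow> 0) (at x within \<Omega>)"
    and lap: "\<And>x. x \<in> \<Omega> \<Longrightarrow> 0 \<le> laplacian g x" and x: "x \<in> \<Omega>"
  shows "g x \<le> 0"
proof -
  let ?h = "\<lambda>x. if x \<in> \<Omega> then g x else 0"
  have "?h x \<le> 0"
  proof (rule maximum_principle_classical[OF \<Omega> _ _ _ _ x])
    show "continuous_on (closure \<Omega>) ?h"
      by (rule continuous_on_closure_zero_extension[OF \<Omega>(1) Ck_on_continuous_on[OF g] lim])
    show "Ck_on 2 \<Omega> ?h"
      by (rule iffD2[OF Ck_on_cong[OF \<Omega>(1)] g]) simp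
    show "?h y \<le> 0" if "y \<in> frontier \<Omega>" for y using frontier_notin_open[OF \<Omega>(1) that] by simp
    fix y assume y: "y \<in> \<Omega>"
    have "laplacian ?h y = laplacian g y" by (rule laplacian_cong[OF \<Omega>(1) y]) simp
    then show "0 \<le> laplacian ?h y" using lap[OF y] by simp
  qed
  then show ?thesis using x by simp
qed

text \<open>The representation writes g as a nonnegative average plus the potential of a strictly
  positive function.\<close>

lemma pos_of_strictly_superharmonic:
  fixes g :: "'a::euclidean_space \<Rightarrow> real"
  assumes \<Omega>: "open \<Omega>" and g: "Ck_on 2 \<Omega> g" "\<And>x. x \<in> \<Omega> \<Longrightarrow> 0 \<le> g x"
    and lap: "\<And>x. x \<in> \<Omega> \<Longrightarrow> laplacian g x < 0" and x: "x \<in> \<Omega>"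
  shows "0 < g x"
proof -
  have "\<forall>\<^sub>F r in at_right 0. cube x r \<subseteq> \<Omega> \<and> 0 < r"
    by (intro eventually_conj eventually_cube_subset \<Omega> x eventually_at_right_less)
  then obtain r where r: "cube x r \<subseteq> \<Omega>" "0 < r"
    using eventually_happens trivial_limit_at_right_real by blast
  have c: "continuous_on (cube x r) g" "continuous_on (cube x r) (\<lambda>y. - laplacian g y)"
    using continuous_on_subset[OF Ck_on_continuous_on[OF g(1)] r(1)]
      continuous_on_subset[OF continuous_on_laplacian[OF \<Omega> g(1)] r(1)]
    by (auto intro: continuous_on_minus)
  have "0 = avg r (\<lambda>_. 0) x" by (simp add: avg_const)
  also have "\<dots> \<le> avg r g x" using r(1) g(2) by (intro avg_mono continuous_intros c) auto
  finally have "0 \<le> avg r g x" .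
  moreover have "0 < pot r (\<lambda>y. - laplacian g y) x"
    by (rule pot_pos[OF r(2) c(2)]) (use lap r(1) in force)
  ultimately show ?thesis using avg_pot_representation[OF \<Omega> g(1) r(2,1)] by simp
qed

lemma supersolution_of_C2:
  fixes g b :: "'a::euclidean_space \<Rightarrow> real"
  assumes \<Omega>: "open \<Omega>" and g: "Ck_on 2 \<Omega> g" and b: "continuous_on \<Omega> b" "\<And>x. x \<in> \<Omega> \<Longrightarrow> b x \<le> - laplacian g x"
  shows "supersolution \<Omega> g b"
  unfolding supersolution_def
proof
  fix x assume x: "x \<in> \<Omega>"
  show "\<forall>\<^sub>F r in at_right 0. avg r g x + pot r b x \<le> g x"
    using eventually_cube_subset[OF \<Omega> x] eventually_at_right_less[of 0]
  proof eventually_elim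
    case (elim r)
    have "pot r b x \<le> pot r (\<lambda>y. - laplacian g y) x"
      using elim(1) b
      by (intro pot_mono continuous_on_minus continuous_on_subset[OF continuous_on_laplacian[OF \<Omega> g]])
        (auto intro: continuous_on_subset)
    then show ?case using avg_pot_representation[OF \<Omega> g elim(2,1)] by simp
  qed
qed

theorem corollary1:
  fixes \<Omega> :: "'a::euclidean_space set"
    and f :: "real \<Rightarrow> real" and D :: "real set"
    and p lam :: real
    and u \<phi> :: "'a \<Rightarrow> real" and G :: "'a \<Rightarrow> 'a"
  assumes "DIM('a) \<ge> 2"
    and "smooth_bounded_domain \<Omega>"
    and "p > 1"
    and "(f = exp \<and> D = UNIV) \<or>
         (f = (\<lambda>t. (1 + t) powr p) \<and> D = {-1..}) \<or>
         (f = (\<lambda>t. 1 / (1 - t) powr p) \<and> D = {..<1})"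
    and "0 < lam" and "ereal lam < extremal_parameter \<Omega> f D"
    and "minimal_navier_solution \<Omega> f D lam u"
    and "H1_0 \<Omega> \<phi> G"
  shows "sqrt lam * (LINT x|lebesgue_on \<Omega>. sqrt (deriv f (u x)) * (\<phi> x)\<^sup>2)
           \<le> (LINT x|lebesgue_on \<Omega>. (norm (G x))\<^sup>2)"
proof -
  obtain J H where fH: "f \<in> H" "\<And>h. h \<in> H \<Longrightarrow> \<exists>h'\<in>H. \<forall>t\<in>J. (h has_real_derivative h' t) (at t)"
    and J: "open J"
    and f'_mono: "\<And>s t. s \<in> J \<Longrightarrow> t \<in> J \<Longrightarrow> s \<le> t \<Longrightarrow> deriv f s \<le> deriv f t"
    and f'_nonneg: "\<And>t. t \<in> J \<Longrightarrow> 0 \<le> deriv f t"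
    and f_pos: "\<And>t. t \<in> J \<Longrightarrow> 0 < f t" and f_nonneg: "\<And>t. t \<in> D \<Longrightarrow> 0 \<le> f t"
    and D: "\<And>s t. 0 \<le> s \<Longrightarrow> s \<le> t \<Longrightarrow> t \<in> D \<Longrightarrow> s \<in> D \<and> s \<in> J"
    by (rule nonlinearity_properties[OF assms(3,4)]) (rule that)
  obtain f1 where f1: "f1 \<in> H" "\<And>t. t \<in> J \<Longrightarrow> (f has_real_derivative f1 t) (at t)"
    using fH by blast
  have f1_deriv: "deriv f t = f1 t" if "t \<in> J" for t
    using f1(2)[OF that] by (rule DERIV_imp_deriv)
  have df: "(f has_real_derivative deriv f t) (at t)" if "t \<in> J" for t
    using f1(2)[OF that] f1_deriv[OF that] by simp
  have \<Omega>: "open \<Omega>" "bounded \<Omega>" "\<Omega> \<noteq> {}"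
    using assms(2) by (auto simp: smooth_bounded_domain_def)
  have f_Ck: "Ck_on k \<Omega> (\<lambda>x. h (g x))" if "Ck_on k \<Omega> g" "\<And>x. x \<in> \<Omega> \<Longrightarrow> g x \<in> J" "h \<in> H" for k h and g :: "'a \<Rightarrow> real"
    using Ck_on_compose[OF \<Omega>(1) that(1,3,2) fH(2)] .
  \<comment> \<open>The maximum principle is applied first to the Laplacian of w, then to - w. At
    this stage the values of w are known only to lie in \<open>D\<close>, so nonnegativity of f on
    \<open>D\<close> is what enters; that they lie in \<open>J\<close> becomes available only after
    w \<ge> 0.\<close>
  have navier: "(\<forall>k. Ck_on k \<Omega> w)" "(\<forall>x\<in>\<Omega>. laplacian w x \<le> 0)" "(\<forall>x\<in>\<Omega>. 0 \<le> w x)"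
    if w: "navier_solution \<Omega> f D \<nu> w" and \<nu>: "0 < \<nu>" for w :: "'a \<Rightarrow> real" and \<nu>
  proof -
    have wC: "Ck_on k \<Omega> w" for k using w by (auto simp: navier_solution_def intro: smooth_on_Ck)
    then show "\<forall>k. Ck_on k \<Omega> w" by simp
    have wD: "w x \<in> D" if "x \<in> \<Omega>" for x
      using w that closure_subset by (auto simp: navier_solution_def)
    have lap: "laplacian w x \<le> 0" if "x \<in> \<Omega>" for x
    proof (rule nonpos_of_subharmonic[OF \<Omega>(1,2) _ _ _ that])
      show "Ck_on 2 \<Omega> (laplacian w)"
        using Ck_on_laplacian[OF \<Omega>(1) wC, of "2"] by simp
      show "(laplacian w \<longlongrightarrow> 0) (at y within \<Omega>)" if "y \<in> frontier \<Omega>" for y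
        using w that by (auto simp: navier_solution_def)
      show "0 \<le> laplacian (laplacian w) y" if "y \<in> \<Omega>" for y
        using w that f_nonneg[OF wD[OF that]] \<nu> by (auto simp: navier_solution_def)
    qed
    then show "\<forall>x\<in>\<Omega>. laplacian w x \<le> 0" by blast
    have "(\<lambda>x. -1 * w x) x \<le> 0" if "x \<in> \<Omega>" for x
    proof (rule maximum_principle_classical[OF \<Omega>(1,2) _ _ _ _ that])
      show "continuous_on (closure \<Omega>) (\<lambda>x. -1 * w x)"
        using w by (auto simp: navier_solution_def intro!: continuous_intros)
      show "Ck_on 2 \<Omega> (\<lambda>x. -1 * w x)" by (rule Ck_on_cmult[OF \<Omega>(1) wC])
      show "-1 * w y \<le> 0" if "y \<in> frontier \<Omega>" for y
        using w that by (auto simp: navier_solution_def)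
      show "0 \<le> laplacian (\<lambda>x. -1 * w x) y" if "y \<in> \<Omega>" for y
        using lap[OF that] unfolding laplacian_cmult[OF \<Omega>(1) that wC] by simp
    qed
    then show "\<forall>x\<in>\<Omega>. 0 \<le> w x" by simp
  qed
  have u: "navier_solution \<Omega> f D lam u" and u_min: "\<And>w. navier_solution \<Omega> f D lam w \<Longrightarrow> AE x in lebesgue_on \<Omega>. u x \<le> w x"
    using assms(7) by (auto simp: minimal_navier_solution_def)
  \<comment> \<open>Being below the supremum yields a solution for some larger parameter; no
    minimality of \<open>v\<close> is claimed.\<close>
  obtain \<mu> v where \<mu>: "lam < \<mu>" and v: "navier_solution \<Omega> f D \<mu> v"
    using assms(6) by (auto simp: extremal_parameter_def less_Sup_iff)
  have \<mu>0: "0 < \<mu>" using \<mu> assms(5) by simp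
  note uN = navier[OF u assms(5)] and vN = navier[OF v \<mu>0]
  have vc: "continuous_on (closure \<Omega>) v" and vD: "\<And>x. x \<in> closure \<Omega> \<Longrightarrow> v x \<in> D"
    and v_bd: "\<And>x. x \<in> frontier \<Omega> \<Longrightarrow> v x = 0" and v_lim: "\<And>x. x \<in> frontier \<Omega> \<Longrightarrow> (laplacian v \<longlongrightarrow> 0) (at x within \<Omega>)"
    and v_eq: "\<And>x. x \<in> \<Omega> \<Longrightarrow> laplacian (laplacian v) x = \<mu> * f (v x)"
    using v by (auto simp: navier_solution_def)
  have u_lim: "\<And>x. x \<in> frontier \<Omega> \<Longrightarrow> (laplacian u \<longlongrightarrow> 0) (at x within \<Omega>)"
    and u_eq: "\<And>x. x \<in> \<Omega> \<Longrightarrow> laplacian (laplacian u) x = lam * f (u x)"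
    using u by (auto simp: navier_solution_def)
  have clne: "closure \<Omega> \<noteq> {}" using \<Omega>(3) by simp
  have "compact (closure \<Omega>)" using \<Omega>(2) by simp
  then obtain xm where xm: "xm \<in> closure \<Omega>" "\<And>y. y \<in> closure \<Omega> \<Longrightarrow> v y \<le> v xm"
    using continuous_attains_sup[OF _ clne vc] by blast
  \<comment> \<open>The maximum is attained, so it belongs to \<open>D\<close>; for 1 / (1 - t)^p
    this keeps [0, V] away from the singularity at 1.\<close>
  define V where "V = v xm"
  have VD: "V \<in> D" using vD[OF xm(1)] by (simp add: V_def)
  have vV: "v x \<in> {0..V}" if "x \<in> \<Omega>" for x
    using xm(2)[of x] that closure_subset vN(3) by (auto simp: V_def)
  have I_J: "t \<in> J" if "t \<in> {0..V}" for t using D[of t V] that VD by auto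
  have f_mono: "f s \<le> f t" if "0 \<le> s" "s \<le> t" "t \<le> V" for s t
  proof (rule DERIV_nonneg_imp_nondecreasing[OF that(2)])
    fix y assume "s \<le> y" "y \<le> t"
    then have "y \<in> J" using that I_J by auto
    then show "\<exists>d. (f has_real_derivative d) (at y) \<and> 0 \<le> d" using df f'_nonneg by blast
  qed
  obtain x0 where "x0 \<in> \<Omega>" using \<Omega>(3) by blast
  then have V0: "0 \<le> V" using vV[of x0] by simp
  have cv: "continuous_on \<Omega> v" using vc closure_subset continuous_on_subset by blast
  have vC: "Ck_on k \<Omega> v" and uC: "Ck_on k \<Omega> u" for k using vN(1) uN(1) by auto
  have lC: "Ck_on k \<Omega> (laplacian v)" "Ck_on k \<Omega> (laplacian u)" for k
    by (intro Ck_on_laplacian \<Omega>(1) vC uC)+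
  have cz: "continuous_on \<Omega> (\<lambda>x. -1 * laplacian v x)"
    by (intro continuous_intros Ck_on_continuous_on[OF lC(1)])
  have cfv: "continuous_on \<Omega> (\<lambda>x. f (v x))"
    by (rule Ck_on_continuous_on[OF f_Ck[OF vC[of 0] _ fH(1)]]) (use vV I_J in blast)
  obtain a b where aC: "\<And>k. Ck_on k \<Omega> a" and bC: "\<And>k. Ck_on k \<Omega> b"
    and a_bd: "\<And>x. x \<in> \<Omega> \<Longrightarrow> 0 \<le> a x \<and> a x \<le> v x"
    and b_bd: "\<And>x. x \<in> \<Omega> \<Longrightarrow> 0 \<le> b x \<and> b x \<le> -1 * laplacian v x"
    and la: "\<And>x. x \<in> \<Omega> \<Longrightarrow> laplacian a x = - b x"
    and lb: "\<And>x. x \<in> \<Omega> \<Longrightarrow> laplacian b x = - (lam * f (a x))"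
  proof (rule solution_below_supersolution[where F="\<lambda>t. lam * f t", OF \<Omega>(1,3) cv vV cz])
    show "supersolution \<Omega> v (\<lambda>x. -1 * laplacian v x)"
      by (rule supersolution_of_C2[OF \<Omega>(1) vC cz]) simp
    \<comment> \<open>Here the larger parameter enters: lambda f(v) is at most mu f(v), the
      bilaplacian of \<open>v\<close>.\<close>
    show "supersolution \<Omega> (\<lambda>x. -1 * laplacian v x) (\<lambda>x. lam * f (v x))"
    proof (rule supersolution_of_C2[OF \<Omega>(1) Ck_on_cmult[OF \<Omega>(1) lC(1)]])
      show "continuous_on \<Omega> (\<lambda>x. lam * f (v x))" by (intro continuous_intros cfv)
      fix x assume x: "x \<in> \<Omega>"
      have "0 \<le> f (v x)" using f_pos[OF I_J[OF vV[OF x]]] by simp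
      then show "lam * f (v x) \<le> - laplacian (\<lambda>x. -1 * laplacian v x) x"
        unfolding laplacian_cmult[OF \<Omega>(1) x lC(1)] v_eq[OF x] using \<mu> by (simp add: mult_right_mono)
    qed
    show "continuous_on {0..V} (\<lambda>t. lam * f t)"
      by (intro continuous_intros continuous_at_imp_continuous_on ballI DERIV_isCont[OF df] I_J)
    show "lam * f s \<le> lam * f t" if "0 \<le> s" "s \<le> t" "t \<le> V" for s t
      using f_mono[OF that] assms(5) by simp
    show "0 \<le> lam * f 0" using f_pos[OF I_J[of 0]] V0 assms(5) by simp
    show "Ck_on k \<Omega> (\<lambda>x. lam * f (g x))" if "Ck_on k \<Omega> g" "\<And>x. x \<in> \<Omega> \<Longrightarrow> g x \<in> {0..V}" for k and g :: "'a \<Rightarrow> real"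
      by (intro Ck_on_cmult \<Omega>(1) f_Ck[OF that(1) _ fH(1)] I_J that(2))
    show "0 \<le> -1 * laplacian v x" if "x \<in> \<Omega>" for x using vN(2) that by simp
  qed (assumption | rule that)+
  \<comment> \<open>The iteration controls \<open>a\<close> only inside \<Omega>, while a solution
    must be continuous on the closure and vanish on the boundary.\<close>
  define a0 where "a0 x = (if x \<in> \<Omega> then a x else 0)" for x
  have la0: "laplacian a0 x = - b x" if "x \<in> \<Omega>" for x
    using laplacian_cong[OF \<Omega>(1) that, of a0 a] la[OF that] by (simp add: a0_def)
  have "navier_solution \<Omega> f D lam a0"
    unfolding navier_solution_def
  proof (intro conjI ballI)
    show "smooth_on \<Omega> a0"
      unfolding smooth_on_def using Ck_on_cong[OF \<Omega>(1), of a0 a] aC by (simp add: a0_def)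
    \<comment> \<open>Squeezed between 0 and \<open>v\<close>. The Laplacian of \<open>a0\<close> is
      treated likewise below, between that of \<open>v\<close> and 0.\<close>
    have "(a \<longlongrightarrow> 0) (at x within \<Omega>)" if x: "x \<in> frontier \<Omega>" for x
    proof (rule tendsto_sandwich)
      show "\<forall>\<^sub>F y in at x within \<Omega>. 0 \<le> a y" "\<forall>\<^sub>F y in at x within \<Omega>. a y \<le> v y"
        using a_bd by (auto simp: eventually_at_filter)
      have "x \<in> closure \<Omega>" using x by (simp add: frontier_def)
      then have "(v \<longlongrightarrow> v x) (at x within closure \<Omega>)" using vc by (simp add: continuous_on_def)
      then show "(v \<longlongrightarrow> 0) (at x within \<Omega>)"
        unfolding v_bd[OF x] by (rule tendsto_within_subset) (rule closure_subset)
    qed simp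
    then show "continuous_on (closure \<Omega>) a0"
      unfolding a0_def by (rule continuous_on_closure_zero_extension[OF \<Omega>(1) Ck_on_continuous_on[OF aC]])
    show "a0 x \<in> D" if "x \<in> closure \<Omega>" for x
      using a_bd[of x] D[of "a x" "v x"] D[of 0 V] vD[OF that] V0 VD by (auto simp: a0_def)
    show "laplacian (laplacian a0) x = lam * f (a0 x)" if x: "x \<in> \<Omega>" for x
    proof -
      have "laplacian (laplacian a0) x = laplacian (\<lambda>x. -1 * b x) x"
        by (rule laplacian_cong[OF \<Omega>(1) x]) (simp add: la0)
      also have "\<dots> = lam * f (a0 x)"
        unfolding laplacian_cmult[OF \<Omega>(1) x bC] using lb[OF x] x by (simp add: a0_def)
      finally show ?thesis .
    qed
    show "a0 x = 0" if "x \<in> frontier \<Omega>" for x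
      using frontier_notin_open[OF \<Omega>(1) that] by (simp add: a0_def)
    show "(laplacian a0 \<longlongrightarrow> 0) (at x within \<Omega>)" if x: "x \<in> frontier \<Omega>" for x
    proof (rule tendsto_sandwich)
      have "laplacian v y \<le> laplacian a0 y \<and> laplacian a0 y \<le> 0" if "y \<in> \<Omega>" for y
        using b_bd[OF that] la0[OF that] by simp
      then show "\<forall>\<^sub>F y in at x within \<Omega>. laplacian v y \<le> laplacian a0 y" "\<forall>\<^sub>F y in at x within \<Omega>. laplacian a0 y \<le> 0"
        by (auto simp: eventually_at_filter)
    qed (use v_lim[OF x] in auto)
  qed
  from u_min[OF this] have ae: "AE x in lebesgue. x \<in> \<Omega> \<longrightarrow> u x \<le> a0 x"
    using \<Omega>(1) by (simp add: AE_restrict_space_iff)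
  \<comment> \<open>Minimality gives the inequality almost everywhere. The set where it fails is
    open by continuity, so being null it is empty.\<close>
  have ua: "u x \<le> a x" if x: "x \<in> \<Omega>" for x
  proof (rule ccontr)
    assume n: "\<not> u x \<le> a x"
    define S where "S = \<Omega> \<inter> (\<lambda>x. u x - a x) -` {0<..}"
    have "open S"
      unfolding S_def
      by (intro continuous_open_preimage \<Omega>(1) continuous_on_diff Ck_on_continuous_on[OF uC[of 0]]
          Ck_on_continuous_on[OF aC[of 0]]) simp
    moreover have "AE x\<in>S in lebesgue. x \<in> {}"
      using ae by eventually_elim (auto simp: S_def a0_def)
    ultimately have "x \<in> {}"
      by (rule mem_closed_if_AE_lebesgue_open[OF _ closed_empty]) (use n x in \<open>simp add: S_def\<close>)
    then show False by simp
  qed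
  have uv: "u x \<le> v x" if "x \<in> \<Omega>" for x using ua[OF that] a_bd[OF that] by simp
  have uV: "u x \<in> {0..V}" if "x \<in> \<Omega>" for x using uv[OF that] vV[OF that] uN(3) that by auto
  define U where "U x = v x - u x" for x
  define W where "W x = laplacian u x - laplacian v x" for x
  have UC: "Ck_on 2 \<Omega> U" and WC: "Ck_on 2 \<Omega> W"
    unfolding U_def[abs_def] W_def[abs_def] by (intro Ck_on_diff \<Omega>(1) uC vC lC)+
  have lU: "laplacian U x = - W x" if "x \<in> \<Omega>" for x
    unfolding U_def[abs_def] W_def laplacian_diff[OF \<Omega>(1) that vC uC] by simp
  have lW: "laplacian W x = lam * f (u x) - \<mu> * f (v x)" if "x \<in> \<Omega>" for x
    unfolding W_def[abs_def] laplacian_diff[OF \<Omega>(1) that lC(2,1)] u_eq[OF that] v_eq[OF that] ..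
  \<comment> \<open>Strict because mu exceeds lambda and f(v) > 0. It makes \<open>W\<close>
    positive, and then - Laplacian U = W makes \<open>U\<close> positive.\<close>
  have lW_neg: "laplacian W x < 0" if x: "x \<in> \<Omega>" for x
  proof -
    have "lam * f (u x) \<le> lam * f (v x)"
      using f_mono[of "u x" "v x"] uV[OF x] vV[OF x] uv[OF x] assms(5) by auto
    also have "\<dots> < \<mu> * f (v x)" using \<mu> f_pos[OF I_J[OF vV[OF x]]] by simp
    finally show ?thesis using lW[OF x] by simp
  qed
  have "0 \<le> W x" if x: "x \<in> \<Omega>" for x
  proof -
    have "-1 * W x \<le> 0"
    proof (rule nonpos_of_subharmonic[OF \<Omega>(1,2) Ck_on_cmult[OF \<Omega>(1) WC] _ _ x])
      show "((\<lambda>x. -1 * W x) \<longlongrightarrow> 0) (at y within \<Omega>)" if "y \<in> frontier \<Omega>" for y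
        unfolding W_def using u_lim[OF that] v_lim[OF that] by (auto intro!: tendsto_eq_intros)
      show "0 \<le> laplacian (\<lambda>x. -1 * W x) y" if "y \<in> \<Omega>" for y
        unfolding laplacian_cmult[OF \<Omega>(1) that WC] using lW_neg[OF that] by simp
    qed
    then show ?thesis by simp
  qed
  then have W_pos: "0 < W x" if "x \<in> \<Omega>" for x
    using pos_of_strictly_superharmonic[OF \<Omega>(1) WC _ lW_neg that] by blast
  have U_pos: "0 < U x" if "x \<in> \<Omega>" for x
    by (rule pos_of_strictly_superharmonic[OF \<Omega>(1) UC _ _ that]) (use uv W_pos lU in \<open>auto simp: U_def\<close>)
  define g where "g x = sqrt lam * sqrt (deriv f (u x))" for x
  have f'_u: "0 \<le> deriv f (u x)" if "x \<in> \<Omega>" for x using f'_nonneg[OF I_J[OF uV[OF that]]] .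
  \<comment> \<open>On \<open>J\<close> the derivative \<open>deriv f\<close> agrees with a member
    of the class \<open>H\<close>, whose compositions with smooth functions are smooth.\<close>
  have cg: "continuous_on \<Omega> g"
  proof -
    have "continuous_on \<Omega> (\<lambda>x. f1 (u x))"
      by (rule Ck_on_continuous_on[OF f_Ck[OF uC[of 0] _ f1(1)]]) (use uV I_J in blast)
    then have "continuous_on \<Omega> (\<lambda>x. deriv f (u x))"
      using f1_deriv uV I_J by (subst continuous_on_cong[OF refl, of _ _ "\<lambda>x. f1 (u x)"]) auto
    then show ?thesis unfolding g_def by (intro continuous_intros)
  qed
  \<comment> \<open>Convexity through the mean value theorem: f' at the intermediate point dominates
    f'(u). The remaining term (mu - lambda) f(v) is nonnegative and is dropped.\<close>
  have conv: "(g x)\<^sup>2 * U x \<le> - laplacian W x" if x: "x \<in> \<Omega>" for x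
  proof -
    have lt: "u x < v x" using U_pos[OF x] by (simp add: U_def)
    have in_J: "t \<in> J" if "u x \<le> t" "t \<le> v x" for t using that uV[OF x] vV[OF x] I_J by auto
    obtain \<xi> where \<xi>: "u x < \<xi>" "\<xi> < v x" "f (v x) - f (u x) = (v x - u x) * deriv f \<xi>"
      using MVT2[OF lt, of f "deriv f"] df in_J by blast
    have "deriv f (u x) \<le> deriv f \<xi>" using \<xi> in_J by (intro f'_mono) auto
    then have "deriv f (u x) * (v x - u x) \<le> f (v x) - f (u x)"
      unfolding \<xi>(3) using lt by (simp add: mult.commute)
    then have "lam * (deriv f (u x) * U x) \<le> lam * (f (v x) - f (u x))"
      unfolding U_def using assms(5) by (intro mult_left_mono) auto
    also have "\<dots> \<le> \<mu> * f (v x) - lam * f (u x)"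
      using \<mu> f_pos[OF I_J[OF vV[OF x]]] by (simp add: right_diff_distrib)
    finally show ?thesis
      using assms(5) f'_u[OF x] lW[OF x] by (simp add: g_def power_mult_distrib)
  qed
  \<comment> \<open>Since f' increases on [0, V], the weight is bounded, as the passage to the
    closure of the test functions requires.\<close>
  have g_bd: "0 \<le> g x \<and> g x \<le> sqrt lam * sqrt (deriv f V)" if x: "x \<in> \<Omega>" for x
    using uV[OF x] V0 f'_mono[OF I_J[OF uV[OF x]] I_J[of V]] f'_u[OF x] assms(5)
    by (auto simp: g_def intro!: mult_left_mono)
  have eU: "- laplacian U x = W x" if "x \<in> \<Omega>" for x using lU[OF that] by simp
  have "(LINT x|lebesgue_on \<Omega>. g x * (\<phi> x)\<^sup>2) \<le> (LINT x|lebesgue_on \<Omega>. (norm (G x))\<^sup>2)"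
    using H1_0_inequality_from_test_functions[OF \<Omega>(1) cg g_bd _ assms(8)]
      system_test_inequality[OF \<Omega>(1) UC U_pos WC W_pos eU conv cg] by blast
  then show ?thesis
    by (simp add: g_def mult.assoc)
qed

end
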